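(* For $i\in\{1,2\}$, let $(G_i, \mathcal{H}_i\cup\{K_i\})$ be a pair and let $\partial_i\colon C\to K_i$ be a group monomorphism. Let $G=G_1\ast_C G_2$ denote the amalgamated product determined by $G_1\xleftarrow{\partial_1}C\xrightarrow{\partial_2}G_2$, and let $\mathcal{H}=\mathcal{H}_1\cup\mathcal{H}_2$. Then: 1. If $\mathcal{H}_i\cup\{K_i\} \hookrightarrow_h G_i$ for each $i$, then $\mathcal H\cup \{\langle K_1,K_2\rangle\} \hookrightarrow_h G_1\ast_C G_2$. 2. If $( G_i,\mathcal{H}_i\cup\{K_i\} ) \in \mathcal D$ for each $i$, then $(G_1\ast_C G_2, \mathcal{H} \cup\{\langle K_1,K_2 \rangle\}) \in \mathcal D$. 3. For any $i\in\{1,2\}$ and any $g\in G_i$, the element $g$ is conjugate in $G_i$ to an element of some $Q\in\mathcal{H}_i\cup \{K_i\}$ if and only if $g$ is conjugate in $G$ to an element of some $H\in\mathcal{H}\cup \{ \langle K_1, K_2 \rangle\}$.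
   Context: A pair $(G,\mathcal H)$ consists of a group $G$ and a finite collection $\mathcal H$ of subgroups of $G$. In a collection written $\mathcal H_i\cup\{K_i\}$, $K_i$ is a distinguished member that is not an element of $\mathcal H_i$. The groups $G_1,G_2$ and their subgroups are regarded as subgroups of $G_1\ast_C G_2$ via the canonical embeddings; $\langle K_1,K_2\rangle$ is the subgroup of $G_1\ast_CG_2$ generated by $K_1\cup K_2$. Hyperbolically embedded collections ($\mathcal H\hookrightarrow_h G$). Definition (Dahmani–Guirardel–Osin): for $\mathcal H=\{H_1,\dots,H_n\}$ and $X\subseteq G$ such that $X\cup\bigcup_i H_i$ generates $G$, let $\Gamma$ be the Cayley graph of $G$ with respect to the alphabet $X\sqcup\bigsqcup_i (H_i\setminus\{1\})$, and for $h,h'\in H_i$ let $\hat d_i(h,h')\in[0,\infty]$ be the length of a shortest path in $\Gamma$ from $h$ to $h'$ containing no edge that joins two elements of $H_i$ and is labelled by an element of $H_i\setminus\{1\}$. Then $\mathcal H\hookrightarrow_h G$ if for some such $X$ the graph $\Gamma$ is hyperbolic and, for each $i$, every ball of finite radius in $(H_i,\hat d_i)$ is finite. An equivalent characterization, used as a working definition: call $(G,\mathcal H)$ proper if no two distinct infinite members of $\mathcal H$ are conjugate in $G$; a proper pair satisfies $\mathcal H\hookrightarrow_h G$ if and only if there is a connected hyperbolic simplicial $G$-graph $\Gamma$ with finitely many $G$-orbits of vertices and finite edge stabilizers, such that each vertex stabilizer is finite or conjugate to a member of $\mathcal H$, every $H\in\mathcal H$ is the stabilizer of a vertex, and $\Gamma$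 is fine at every vertex with infinite stabilizer. Here $\Gamma$ is fine at $v$ if, on the set $T_v\Gamma$ of vertices adjacent to $v$, with $\angle_v(x,y)\in[0,\infty]$ the length of a shortest path from $x$ to $y$ in $\Gamma-\{v\}$ ($\infty$ if none exists), all balls of finite radius are finite. (Hyperbolically embedded pairs are proper.) Class $\mathcal D$: pairs whose relative Dehn function is well-defined. For $S\subseteq G$ put $F(S,\mathcal H)=F(S)\ast\left(\ast_{H\in\mathcal H}H\right)$, where $F(S)$ is the free group on $S$. A presentation $\langle S,\mathcal H\mid R\rangle$ of $(G,\mathcal H)$ consists of $S\subseteq G$ such that the natural map $F(S,\mathcal H)\to G$ is surjective and $R\subseteq F(S,\mathcal H)$ normally generating its kernel; it is finite if $S$ and $R$ are finite. For a finite presentation, a function $f\colon\mathbb N\to\mathbb N$ is a relative isoperimetric function if every word $W$ of length at most $n$ over $S^{\pm1}\sqcup\bigsqcup_{H\in\mathcal H}(H\setminus\{1\})$ representing $1$ in $G$ can be written in $F(S,\mathcal H)$ as $W=\prod_{i=1}^k f_i^{-1}R_if_i$ with $R_i\in R\cup R^{-1}$, $f_i\in F(S,\mathcal H)$ and $k\le f(n)$. The smallest such function is the relative Dehn function; it is well-defined if it takes only finite values (a property independent of the finite presentation). $(G,\mathcal H)\in\mathcal D$ means that $(G,\mathcal H)$ has a finite presentation and its relative Dehn function is well-defined. *)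

theory Defs
  imports "HOL-Algebra.Generated_Groups" "HOL-Library.Extended_Nat"
begin

section \<open>Monoids given by generators and relations\<close>

text \<open>
  Words over an alphabet \<open>A\<close> modulo the smallest congruence containing the rules \<open>R\<close>. Both amalgamated
  products and relative free groups are of this form; the rules there make every letter invertible, so
  that the presented monoid is a group (\<open>group_amalg\<close>, \<open>group_rel_free\<close> below).
\<close>

inductive_set word_cong :: "'l set \<Rightarrow> ('l list \<times> 'l list) set \<Rightarrow> ('l list \<times> 'l list) set"
  for A R where
  rule: "(l, r) \<in> R \<Longrightarrow> u \<in> lists A \<Longrightarrow> v \<in> lists A \<Longrightarrow> (u @ l @ v, u @ r @ v) \<in> word_cong A R"
| refl: "w \<in> lists A \<Longrightarrow> (w, w) \<in> word_cong A R"
| sym: "(u, v) \<in> word_cong A R \<Longrightarrow> (v, u) \<in> word_cong A R"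
| trans: "(u, v) \<in> word_cong A R \<Longrightarrow> (v, w) \<in> word_cong A R \<Longrightarrow> (u, w) \<in> word_cong A R"

definition word_class :: "'l set \<Rightarrow> ('l list \<times> 'l list) set \<Rightarrow> 'l list \<Rightarrow> 'l list set" where
  "word_class A R w = word_cong A R `` {w}"

definition presented_monoid :: "'l set \<Rightarrow> ('l list \<times> 'l list) set \<Rightarrow> 'l list set monoid" where
  "presented_monoid A R =
    \<lparr>carrier = lists A // word_cong A R,
     monoid.mult = (\<lambda>x y. \<Union>u\<in>x. \<Union>v\<in>y. word_class A R (u @ v)),
     one = word_class A R []\<rparr>"

lemma word_cong_in_lists:
  assumes "R \<subseteq> lists A \<times> lists A" and "(u, v) \<in> word_cong A R"
  shows "u \<in> lists A \<and> v \<in> lists A"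
  using assms(2) assms(1) by induction auto

lemma equiv_word_cong:
  assumes "R \<subseteq> lists A \<times> lists A"
  shows "equiv (lists A) (word_cong A R)"
proof (rule equivI)
  show "word_cong A R \<subseteq> lists A \<times> lists A"
    using word_cong_in_lists[OF assms] by auto
  show "refl_on (lists A) (word_cong A R)"
    by (rule refl_onI) (simp add: word_cong.refl)
  show "Relation.sym (word_cong A R)"
    by (rule symI) (rule word_cong.sym)
  show "Relation.trans (word_cong A R)"
    by (rule transI) (rule word_cong.trans)
qed

lemma word_cong_context:
  assumes "(u, v) \<in> word_cong A R" and "p \<in> lists A" and "q \<in> lists A"
  shows "(p @ u @ q, p @ v @ q) \<in> word_cong A R"
  using assms
proof (induction rule: word_cong.induct)
  case (rule l r u v)
  then show ?case using word_cong.rule[of l r R "p @ u" A "v @ q"] by simp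
next
  case (refl w)
  then show ?case by (intro word_cong.refl) simp
qed (blast intro: word_cong.sym word_cong.trans)+

lemma word_cong_append:
  assumes R: "R \<subseteq> lists A \<times> lists A"
    and 1: "(u, u') \<in> word_cong A R" and 2: "(v, v') \<in> word_cong A R"
  shows "(u @ v, u' @ v') \<in> word_cong A R"
proof -
  have "u' \<in> lists A" "v \<in> lists A"
    using word_cong_in_lists[OF R 1] word_cong_in_lists[OF R 2] by auto
  then have "(u @ v, u' @ v) \<in> word_cong A R" "(u' @ v, u' @ v') \<in> word_cong A R"
    using word_cong_context[OF 1, of "[]" v] word_cong_context[OF 2, of u' "[]"] by auto
  then show ?thesis by (rule word_cong.trans)
qed

lemma word_class_eq_iff:
  assumes "R \<subseteq> lists A \<times> lists A" and "u \<in> lists A" and "v \<in> lists A"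
  shows "word_class A R u = word_class A R v \<longleftrightarrow> (u, v) \<in> word_cong A R"
  using eq_equiv_class_iff[OF equiv_word_cong[OF assms(1)] assms(2,3)]
  by (simp add: word_class_def)

lemma carrier_presented_monoid:
  "carrier (presented_monoid A R) = word_class A R ` lists A"
  by (auto simp: presented_monoid_def quotient_def word_class_def)

lemma one_presented_monoid: "\<one>\<^bsub>presented_monoid A R\<^esub> = word_class A R []"
  by (simp add: presented_monoid_def)

lemma mult_presented_monoid:
  assumes R: "R \<subseteq> lists A \<times> lists A" and u: "u \<in> lists A" and v: "v \<in> lists A"
  shows "word_class A R u \<otimes>\<^bsub>presented_monoid A R\<^esub> word_class A R v = word_class A R (u @ v)"
proof -
  have eq: "word_class A R (u' @ v') = word_class A R (u @ v)"
    if "u' \<in> word_class A R u" "v' \<in> word_class A R v" for u' v'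
  proof -
    have c: "(u, u') \<in> word_cong A R" "(v, v') \<in> word_cong A R"
      using that by (auto simp: word_class_def)
    have "(u' @ v', u @ v) \<in> word_cong A R"
      by (rule word_cong.sym[OF word_cong_append[OF R c]])
    then show ?thesis
      using equiv_class_eq[OF equiv_word_cong[OF R]] by (simp add: word_class_def)
  qed
  have "(\<Union>u'\<in>word_class A R u. \<Union>v'\<in>word_class A R v. word_class A R (u' @ v'))
      = (\<Union>u'\<in>word_class A R u. \<Union>v'\<in>word_class A R v. word_class A R (u @ v))"
    by (intro SUP_cong HOL.refl eq)
  moreover have "u \<in> word_class A R u" "v \<in> word_class A R v"
    using u v by (auto simp: word_class_def intro: word_cong.refl)
  then have "word_class A R u \<noteq> {}" "word_class A R v \<noteq> {}" by blast+
  ultimately show ?thesis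
    by (simp add: presented_monoid_def)
qed

lemma group_presented_monoid:
  assumes R: "R \<subseteq> lists A \<times> lists A"
    and inv: "\<And>a. a \<in> A \<Longrightarrow> \<exists>w\<in>lists A. (w @ [a], []) \<in> word_cong A R"
  shows "group (presented_monoid A R)"
proof (rule groupI)
  let ?M = "presented_monoid A R"
  show "x \<otimes>\<^bsub>?M\<^esub> y \<in> carrier ?M" if "x \<in> carrier ?M" "y \<in> carrier ?M" for x y
  proof -
    from that obtain u v where uv: "u \<in> lists A" "v \<in> lists A"
      and "x = word_class A R u" "y = word_class A R v"
      unfolding carrier_presented_monoid by blast
    then have "x \<otimes>\<^bsub>?M\<^esub> y = word_class A R (u @ v)"
      by (simp only: mult_presented_monoid[OF R])
    moreover have "u @ v \<in> lists A" using uv by simp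
    ultimately show ?thesis unfolding carrier_presented_monoid by blast
  qed
  show "\<one>\<^bsub>?M\<^esub> \<in> carrier ?M"
    by (simp add: carrier_presented_monoid one_presented_monoid)
  show "x \<otimes>\<^bsub>?M\<^esub> y \<otimes>\<^bsub>?M\<^esub> z = x \<otimes>\<^bsub>?M\<^esub> (y \<otimes>\<^bsub>?M\<^esub> z)"
    if "x \<in> carrier ?M" "y \<in> carrier ?M" "z \<in> carrier ?M" for x y z
  proof -
    from that obtain u v w where "u \<in> lists A" "v \<in> lists A" "w \<in> lists A"
      and "x = word_class A R u" "y = word_class A R v" "z = word_class A R w"
      unfolding carrier_presented_monoid by blast
    then show ?thesis
      by (simp only: mult_presented_monoid[OF R] append_in_lists_conv append_assoc simp_thms)
  qed
  show "\<one>\<^bsub>?M\<^esub> \<otimes>\<^bsub>?M\<^esub> x = x" if "x \<in> carrier ?M" for x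
  proof -
    from that obtain u where "u \<in> lists A" "x = word_class A R u"
      unfolding carrier_presented_monoid by blast
    then show ?thesis
      by (simp only: one_presented_monoid mult_presented_monoid[OF R lists.Nil] append_Nil)
  qed
  show "\<exists>y\<in>carrier ?M. y \<otimes>\<^bsub>?M\<^esub> x = \<one>\<^bsub>?M\<^esub>" if "x \<in> carrier ?M" for x
  proof -
    have left: "w \<in> lists A \<Longrightarrow> \<exists>w'\<in>lists A. (w' @ w, []) \<in> word_cong A R" for w
    proof (induction w)
      case Nil
      then show ?case by (intro bexI[of _ "[]"]) (auto intro: word_cong.refl)
    next
      case (Cons a w)
      then obtain w' where w': "w' \<in> lists A" "(w' @ w, []) \<in> word_cong A R" by auto
      from Cons.prems obtain b where b: "b \<in> lists A" "(b @ [a], []) \<in> word_cong A R"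
        using inv[of a] by (metis Cons_in_lists_iff)
      have "(w' @ (b @ [a]) @ w, w' @ [] @ w) \<in> word_cong A R"
        using word_cong_context[OF b(2) w'(1)] Cons.prems by simp
      then have "((w' @ b) @ a # w, []) \<in> word_cong A R"
        using w'(2) word_cong.trans by fastforce
      then show ?case using w'(1) b(1) by (intro bexI[of _ "w' @ b"]) auto
    qed
    from that obtain w where w: "w \<in> lists A" "x = word_class A R w"
      by (auto simp: carrier_presented_monoid)
    from left[OF w(1)] obtain w' where w': "w' \<in> lists A" "(w' @ w, []) \<in> word_cong A R" by blast
    have "word_class A R w' \<otimes>\<^bsub>?M\<^esub> x = \<one>\<^bsub>?M\<^esub>"
      using w w' word_class_eq_iff[OF R, of "w' @ w" "[]"]
      by (simp add: mult_presented_monoid[OF R] one_presented_monoid)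
    then show ?thesis using w'(1) by (auto simp: carrier_presented_monoid)
  qed
qed

text \<open>Evaluation in a group is constant on congruence classes if it respects the rules.\<close>

definition word_eval :: "('b, 'm) monoid_scheme \<Rightarrow> ('l \<Rightarrow> 'b) \<Rightarrow> 'l list \<Rightarrow> 'b" where
  "word_eval G val w = foldr (\<lambda>a g. val a \<otimes>\<^bsub>G\<^esub> g) w \<one>\<^bsub>G\<^esub>"

lemma word_eval_append:
  assumes "group G" and "val ` A \<subseteq> carrier G" and "u \<in> lists A" and "v \<in> lists A"
  shows "word_eval G val u \<in> carrier G"
    and "word_eval G val (u @ v) = word_eval G val u \<otimes>\<^bsub>G\<^esub> word_eval G val v"
proof -
  interpret group G by fact
  have closed: "w \<in> lists A \<Longrightarrow> word_eval G val w \<in> carrier G" for w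
    by (induction w) (use assms(2) in \<open>auto simp: word_eval_def\<close>)
  show "word_eval G val u \<in> carrier G"
    using assms(3) by (rule closed)
  show "word_eval G val (u @ v) = word_eval G val u \<otimes>\<^bsub>G\<^esub> word_eval G val v"
    using assms(3)
  proof (induction u rule: list.induct)
    case Nil
    then show ?case using closed[OF assms(4)] by (simp add: word_eval_def)
  next
    case (Cons a u)
    have "val a \<in> carrier G" "word_eval G val u \<in> carrier G" "word_eval G val v \<in> carrier G"
      using Cons.prems assms(2,4) closed by auto
    then show ?case using Cons by (simp add: word_eval_def m_assoc)
  qed
qed

lemma word_eval_cong:
  assumes G: "group G" and R: "R \<subseteq> lists A \<times> lists A" and val: "val ` A \<subseteq> carrier G"
    and rules: "\<And>l r. (l, r) \<in> R \<Longrightarrow> word_eval G val l = word_eval G val r"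
    and uv: "(u, v) \<in> word_cong A R"
  shows "word_eval G val u = word_eval G val v"
  using uv
proof induction
  case (rule l r u v)
  then have "l \<in> lists A" "r \<in> lists A" using R by auto
  with rule show ?case by (simp add: word_eval_append(2)[OF G val] rules)
qed simp_all


section \<open>Amalgamated products\<close>

text \<open>
  The free product of \<open>G1\<close> and \<open>G2\<close> with \<open>d1 c\<close> and \<open>d2 c\<close> identified for all \<open>c\<close>; \<open>amalg_in_hom\<close> and
  \<open>amalg_universal\<close> give its universal property.
\<close>

definition amalg_rules ::
  "('a, 'm) monoid_scheme \<Rightarrow> ('b, 'n) monoid_scheme \<Rightarrow> ('c, 'k) monoid_scheme
    \<Rightarrow> ('c \<Rightarrow> 'a) \<Rightarrow> ('c \<Rightarrow> 'b) \<Rightarrow> (('a + 'b) list \<times> ('a + 'b) list) set" where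
  "amalg_rules G1 G2 C d1 d2 =
     {([Inl \<one>\<^bsub>G1\<^esub>], []), ([Inr \<one>\<^bsub>G2\<^esub>], [])}
   \<union> {([Inl a, Inl b], [Inl (a \<otimes>\<^bsub>G1\<^esub> b)]) | a b. a \<in> carrier G1 \<and> b \<in> carrier G1}
   \<union> {([Inr a, Inr b], [Inr (a \<otimes>\<^bsub>G2\<^esub> b)]) | a b. a \<in> carrier G2 \<and> b \<in> carrier G2}
   \<union> {([Inl (d1 c)], [Inr (d2 c)]) | c. c \<in> carrier C}"

definition amalg ::
  "('a, 'm) monoid_scheme \<Rightarrow> ('b, 'n) monoid_scheme \<Rightarrow> ('c, 'k) monoid_scheme
    \<Rightarrow> ('c \<Rightarrow> 'a) \<Rightarrow> ('c \<Rightarrow> 'b) \<Rightarrow> ('a + 'b) list set monoid" where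
  "amalg G1 G2 C d1 d2 =
    presented_monoid (carrier G1 <+> carrier G2) (amalg_rules G1 G2 C d1 d2)"

definition amalg_in1 ::
  "('a, 'm) monoid_scheme \<Rightarrow> ('b, 'n) monoid_scheme \<Rightarrow> ('c, 'k) monoid_scheme
    \<Rightarrow> ('c \<Rightarrow> 'a) \<Rightarrow> ('c \<Rightarrow> 'b) \<Rightarrow> 'a \<Rightarrow> ('a + 'b) list set" where
  "amalg_in1 G1 G2 C d1 d2 g =
    word_class (carrier G1 <+> carrier G2) (amalg_rules G1 G2 C d1 d2) [Inl g]"

definition amalg_in2 ::
  "('a, 'm) monoid_scheme \<Rightarrow> ('b, 'n) monoid_scheme \<Rightarrow> ('c, 'k) monoid_scheme
    \<Rightarrow> ('c \<Rightarrow> 'a) \<Rightarrow> ('c \<Rightarrow> 'b) \<Rightarrow> 'b \<Rightarrow> ('a + 'b) list set" where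
  "amalg_in2 G1 G2 C d1 d2 g =
    word_class (carrier G1 <+> carrier G2) (amalg_rules G1 G2 C d1 d2) [Inr g]"

lemma amalg_rules_in_lists:
  assumes "group G1" and "group G2"
    and "d1 ` carrier C \<subseteq> carrier G1" and "d2 ` carrier C \<subseteq> carrier G2"
  shows "amalg_rules G1 G2 C d1 d2
    \<subseteq> lists (carrier G1 <+> carrier G2) \<times> lists (carrier G1 <+> carrier G2)"
proof -
  interpret G1: group G1 by fact
  interpret G2: group G2 by fact
  show ?thesis using assms(3,4) by (auto simp: amalg_rules_def)
qed

lemma group_amalg:
  assumes "group G1" and "group G2"
    and "d1 ` carrier C \<subseteq> carrier G1" and "d2 ` carrier C \<subseteq> carrier G2"
  shows "group (amalg G1 G2 C d1 d2)"
  unfolding amalg_def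
proof (rule group_presented_monoid[OF amalg_rules_in_lists[OF assms]])
  interpret G1: group G1 by fact
  interpret G2: group G2 by fact
  let ?A = "carrier G1 <+> carrier G2" and ?R = "amalg_rules G1 G2 C d1 d2"
  fix x assume x: "x \<in> ?A"
  have r: "(l, r) \<in> word_cong ?A ?R" if "(l, r) \<in> ?R" for l r
    using word_cong.rule[OF that, of "[]" ?A "[]"] by simp
  show "\<exists>w\<in>lists ?A. (w @ [x], []) \<in> word_cong ?A ?R"
  proof (cases x)
    case (Inl a)
    then have a: "a \<in> carrier G1" using x by auto
    have "([Inl (inv\<^bsub>G1\<^esub> a), Inl a], [Inl (inv\<^bsub>G1\<^esub> a \<otimes>\<^bsub>G1\<^esub> a)]) \<in> ?R"
      using a by (auto simp: amalg_rules_def)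
    moreover have "([Inl \<one>\<^bsub>G1\<^esub>], []) \<in> ?R" by (simp add: amalg_rules_def)
    ultimately have "([Inl (inv\<^bsub>G1\<^esub> a), Inl a], []) \<in> word_cong ?A ?R"
      using word_cong.trans[OF r r, of "[Inl (inv\<^bsub>G1\<^esub> a), Inl a]"] G1.l_inv[OF a] by metis
    then show ?thesis using a Inl by (intro bexI[of _ "[Inl (inv\<^bsub>G1\<^esub> a)]"]) auto
  next
    case (Inr a)
    then have a: "a \<in> carrier G2" using x by auto
    have "([Inr (inv\<^bsub>G2\<^esub> a), Inr a], [Inr (inv\<^bsub>G2\<^esub> a \<otimes>\<^bsub>G2\<^esub> a)]) \<in> ?R"
      using a by (auto simp: amalg_rules_def)
    moreover have "([Inr \<one>\<^bsub>G2\<^esub>], []) \<in> ?R" by (simp add: amalg_rules_def)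
    ultimately have "([Inr (inv\<^bsub>G2\<^esub> a), Inr a], []) \<in> word_cong ?A ?R"
      using word_cong.trans[OF r r, of "[Inr (inv\<^bsub>G2\<^esub> a), Inr a]"] G2.l_inv[OF a] by metis
    then show ?thesis using a Inr by (intro bexI[of _ "[Inr (inv\<^bsub>G2\<^esub> a)]"]) auto
  qed
qed

lemma amalg_in_hom:
  assumes "group G1" and "group G2"
    and "d1 ` carrier C \<subseteq> carrier G1" and "d2 ` carrier C \<subseteq> carrier G2"
  shows "amalg_in1 G1 G2 C d1 d2 \<in> hom G1 (amalg G1 G2 C d1 d2)"
    and "amalg_in2 G1 G2 C d1 d2 \<in> hom G2 (amalg G1 G2 C d1 d2)"
    and "c \<in> carrier C \<Longrightarrow> amalg_in1 G1 G2 C d1 d2 (d1 c) = amalg_in2 G1 G2 C d1 d2 (d2 c)"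
proof -
  interpret G1: group G1 by fact
  interpret G2: group G2 by fact
  let ?A = "carrier G1 <+> carrier G2" and ?R = "amalg_rules G1 G2 C d1 d2"
  note R = amalg_rules_in_lists[OF assms]
  have r: "word_class ?A ?R l = word_class ?A ?R r" if "(l, r) \<in> ?R" for l r
  proof -
    have "l \<in> lists ?A" "r \<in> lists ?A" using R that by auto
    moreover have "(l, r) \<in> word_cong ?A ?R"
      using word_cong.rule[OF that, of "[]" ?A "[]"] by simp
    ultimately show ?thesis using word_class_eq_iff[OF R] by blast
  qed
  show "amalg_in1 G1 G2 C d1 d2 \<in> hom G1 (amalg G1 G2 C d1 d2)"
  proof (rule homI)
    fix a b assume ab: "a \<in> carrier G1" "b \<in> carrier G1"
    then have "([Inl a, Inl b], [Inl (a \<otimes>\<^bsub>G1\<^esub> b)]) \<in> ?R" by (auto simp: amalg_rules_def)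
    from r[OF this] show "amalg_in1 G1 G2 C d1 d2 (a \<otimes>\<^bsub>G1\<^esub> b)
        = amalg_in1 G1 G2 C d1 d2 a \<otimes>\<^bsub>amalg G1 G2 C d1 d2\<^esub> amalg_in1 G1 G2 C d1 d2 b"
      using ab mult_presented_monoid[OF R, of "[Inl a]" "[Inl b]"]
      by (simp add: amalg_def amalg_in1_def InlI)
  qed (auto simp: amalg_def amalg_in1_def carrier_presented_monoid)
  show "amalg_in2 G1 G2 C d1 d2 \<in> hom G2 (amalg G1 G2 C d1 d2)"
  proof (rule homI)
    fix a b assume ab: "a \<in> carrier G2" "b \<in> carrier G2"
    then have "([Inr a, Inr b], [Inr (a \<otimes>\<^bsub>G2\<^esub> b)]) \<in> ?R" by (auto simp: amalg_rules_def)
    from r[OF this] show "amalg_in2 G1 G2 C d1 d2 (a \<otimes>\<^bsub>G2\<^esub> b)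
        = amalg_in2 G1 G2 C d1 d2 a \<otimes>\<^bsub>amalg G1 G2 C d1 d2\<^esub> amalg_in2 G1 G2 C d1 d2 b"
      using ab mult_presented_monoid[OF R, of "[Inr a]" "[Inr b]"]
      by (simp add: amalg_def amalg_in2_def InrI)
  qed (auto simp: amalg_def amalg_in2_def carrier_presented_monoid)
  show "amalg_in1 G1 G2 C d1 d2 (d1 c) = amalg_in2 G1 G2 C d1 d2 (d2 c)" if "c \<in> carrier C"
    unfolding amalg_in1_def amalg_in2_def using that by (intro r) (auto simp: amalg_rules_def)
qed

lemma amalg_universal:
  assumes "group G1" and "group G2"
    and d: "d1 ` carrier C \<subseteq> carrier G1" "d2 ` carrier C \<subseteq> carrier G2"
    and L: "group L" and f1: "f1 \<in> hom G1 L" and f2: "f2 \<in> hom G2 L"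
    and eq: "\<And>c. c \<in> carrier C \<Longrightarrow> f1 (d1 c) = f2 (d2 c)"
  obtains f where "f \<in> hom (amalg G1 G2 C d1 d2) L"
    and "\<And>a. a \<in> carrier G1 \<Longrightarrow> f (amalg_in1 G1 G2 C d1 d2 a) = f1 a"
    and "\<And>b. b \<in> carrier G2 \<Longrightarrow> f (amalg_in2 G1 G2 C d1 d2 b) = f2 b"
proof -
  interpret G1: group G1 by fact
  interpret G2: group G2 by fact
  interpret L: group L by fact
  interpret f1: group_hom G1 L f1 by unfold_locales (rule f1)
  interpret f2: group_hom G2 L f2 by unfold_locales (rule f2)
  let ?A = "carrier G1 <+> carrier G2" and ?R = "amalg_rules G1 G2 C d1 d2"
  note R = amalg_rules_in_lists[OF assms(1-4)]
  define e where "e = word_eval L (case_sum f1 f2)"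
  have val: "case_sum f1 f2 ` ?A \<subseteq> carrier L" by auto
  have rules: "word_eval L (case_sum f1 f2) l = word_eval L (case_sum f1 f2) r"
    if "(l, r) \<in> ?R" for l r
    using that d eq f1.hom_closed f2.hom_closed
    by (auto simp: amalg_rules_def word_eval_def image_subset_iff)
  define f where "f c = e (SOME w. w \<in> c)" for c
  have f: "f (word_class ?A ?R w) = e w" if w: "w \<in> lists ?A" for w
  proof -
    have "w \<in> word_class ?A ?R w"
      using w by (auto simp: word_class_def intro: word_cong.refl)
    then have "(SOME v. v \<in> word_class ?A ?R w) \<in> word_class ?A ?R w" by (rule someI)
    then have "(w, SOME v. v \<in> word_class ?A ?R w) \<in> word_cong ?A ?R"
      by (simp add: word_class_def)
    from word_eval_cong[OF L R val rules this] show ?thesis by (simp add: f_def e_def)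
  qed
  show ?thesis
  proof
    show "f \<in> hom (amalg G1 G2 C d1 d2) L"
    proof (rule homI)
      fix x assume "x \<in> carrier (amalg G1 G2 C d1 d2)"
      then obtain u where u: "u \<in> lists ?A" "x = word_class ?A ?R u"
        unfolding amalg_def carrier_presented_monoid by blast
      then show "f x \<in> carrier L"
        using f word_eval_append(1)[OF L val u(1) u(1)] by (simp only: e_def)
      fix y assume "y \<in> carrier (amalg G1 G2 C d1 d2)"
      then obtain v where v: "v \<in> lists ?A" "y = word_class ?A ?R v"
        unfolding amalg_def carrier_presented_monoid by blast
      have "u @ v \<in> lists ?A" using u v by simp
      then show "f (x \<otimes>\<^bsub>amalg G1 G2 C d1 d2\<^esub> y) = f x \<otimes>\<^bsub>L\<^esub> f y"
        unfolding u(2) v(2) amalg_def mult_presented_monoid[OF R u(1) v(1)]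
        using f u(1) v(1) word_eval_append(2)[OF L val u(1) v(1)] by (simp only: e_def)
    qed
    show "f (amalg_in1 G1 G2 C d1 d2 a) = f1 a" if "a \<in> carrier G1" for a
      using that f[of "[Inl a]"] by (simp add: amalg_in1_def e_def word_eval_def InlI)
    show "f (amalg_in2 G1 G2 C d1 d2 b) = f2 b" if "b \<in> carrier G2" for b
      using that f[of "[Inr b]"] by (simp add: amalg_in2_def e_def word_eval_def InrI)
  qed
qed


section \<open>Pairs and words relative to a collection of subgroups\<close>

definition group_pair :: "('a, 'm) monoid_scheme \<Rightarrow> 'a set set \<Rightarrow> bool" where
  "group_pair G \<H> \<longleftrightarrow> group G \<and> finite \<H> \<and> (\<forall>H\<in>\<H>. subgroup H G)"

text \<open>
  Letters of the disjoint union of \<open>S\<close>, its formal inverses, and the sets \<open>H - {1}\<close> for \<open>H \<in> \<H>\<close>.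
  The tag \<open>H\<close> in \<open>Sub H h\<close> keeps the copies of an element lying in several members of \<open>\<H>\<close> apart.
\<close>

datatype 'a letter = Gen 'a | GenInv 'a | Sub "'a set" 'a

definition rel_alphabet ::
  "('a, 'm) monoid_scheme \<Rightarrow> 'a set \<Rightarrow> 'a set set \<Rightarrow> 'a letter set" where
  "rel_alphabet G S \<H> = Gen ` S \<union> GenInv ` S \<union> (\<Union>H\<in>\<H>. Sub H ` (H - {\<one>\<^bsub>G\<^esub>}))"

lemma rel_alphabet_iff:
  "Gen s \<in> rel_alphabet G S \<H> \<longleftrightarrow> s \<in> S"
  "GenInv s \<in> rel_alphabet G S \<H> \<longleftrightarrow> s \<in> S"
  "Sub H h \<in> rel_alphabet G S \<H> \<longleftrightarrow> H \<in> \<H> \<and> h \<in> H \<and> h \<noteq> \<one>\<^bsub>G\<^esub>"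
  by (auto simp: rel_alphabet_def)

fun letter_val :: "('a, 'm) monoid_scheme \<Rightarrow> 'a letter \<Rightarrow> 'a" where
  "letter_val G (Gen s) = s"
| "letter_val G (GenInv s) = inv\<^bsub>G\<^esub> s"
| "letter_val G (Sub H h) = h"

definition word_val :: "('a, 'm) monoid_scheme \<Rightarrow> 'a letter list \<Rightarrow> 'a" where
  "word_val G = word_eval G (letter_val G)"


section \<open>Hyperbolically embedded collections\<close>

text \<open>
  A graph is given by its adjacency relation; relation powers count the edges of a path, and the
  infimum over the empty set is \<open>\<infinity>\<close>.
\<close>

definition graph_dist :: "('v \<times> 'v) set \<Rightarrow> 'v \<Rightarrow> 'v \<Rightarrow> enat" where
  "graph_dist E x y = (INF n\<in>{n. (x, y) \<in> E ^^ n}. enat n)"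

definition geodesic :: "('v \<times> 'v) set \<Rightarrow> 'v \<Rightarrow> 'v \<Rightarrow> 'v list \<Rightarrow> bool" where
  "geodesic E x y p \<longleftrightarrow>
     p \<noteq> [] \<and> hd p = x \<and> last p = y \<and> successively (\<lambda>u v. (u, v) \<in> E) p
   \<and> enat (length p - 1) = graph_dist E x y"

text \<open>
  Rips' condition: geodesic triangles are uniformly slim. Corners and points on sides range over vertices;
  compared with the geometric realization this only changes the constant.
\<close>

definition hyperbolic_graph :: "'v set \<Rightarrow> ('v \<times> 'v) set \<Rightarrow> bool" where
  "hyperbolic_graph V E \<longleftrightarrow>
    (\<exists>\<delta>::nat. \<forall>x\<in>V. \<forall>y\<in>V. \<forall>z\<in>V. \<forall>p q r.
       geodesic E x y p \<longrightarrow> geodesic E y z q \<longrightarrow> geodesic E z x r \<longrightarrow>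
       (\<forall>u\<in>set p. \<exists>v\<in>set q \<union> set r. graph_dist E u v \<le> enat \<delta>))"

text \<open>
  Paths in the Cayley graph traverse edges in both directions; a backward step along an edge labelled by
  a letter of \<open>X\<close> or of \<open>H - {1}\<close> is a forward step along its inverse, which is in \<open>rel_alphabet G X \<H>\<close>.
\<close>

definition cayley_adj ::
  "('a, 'm) monoid_scheme \<Rightarrow> 'a set \<Rightarrow> 'a set set \<Rightarrow> ('a \<times> 'a) set" where
  "cayley_adj G X \<H> =
    {(u, u \<otimes>\<^bsub>G\<^esub> letter_val G a) | u a. u \<in> carrier G \<and> a \<in> rel_alphabet G X \<H>}"

text \<open>
  Only the edges of the complete graph on \<open>H\<close> labelled by letters from the copy of \<open>H\<close> are removed. An edge
  between elements of \<open>H\<close> that is labelled by \<open>X\<close> or by another member of \<open>\<H>\<close> stays.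
\<close>

definition hat_adj ::
  "('a, 'm) monoid_scheme \<Rightarrow> 'a set \<Rightarrow> 'a set set \<Rightarrow> 'a set \<Rightarrow> ('a \<times> 'a) set" where
  "hat_adj G X \<H> H =
    {(u, u \<otimes>\<^bsub>G\<^esub> letter_val G a) | u a. u \<in> carrier G \<and> a \<in> rel_alphabet G X \<H> \<and>
       \<not> (u \<in> H \<and> u \<otimes>\<^bsub>G\<^esub> letter_val G a \<in> H \<and> a \<in> range (Sub H))}"

definition hat_dist ::
  "('a, 'm) monoid_scheme \<Rightarrow> 'a set \<Rightarrow> 'a set set \<Rightarrow> 'a set \<Rightarrow> 'a \<Rightarrow> 'a \<Rightarrow> enat" where
  "hat_dist G X \<H> H = graph_dist (hat_adj G X \<H> H)"

definition hyp_embedded :: "'a set set \<Rightarrow> ('a, 'm) monoid_scheme \<Rightarrow> bool"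
  (infix \<open>\<hookrightarrow>\<^sub>h\<close> 50) where
  "\<H> \<hookrightarrow>\<^sub>h G \<longleftrightarrow> group_pair G \<H> \<and>
    (\<exists>X. X \<subseteq> carrier G \<and> generate G (X \<union> \<Union>\<H>) = carrier G \<and>
       hyperbolic_graph (carrier G) (cayley_adj G X \<H>) \<and>
       (\<forall>H\<in>\<H>. \<forall>h\<in>H. \<forall>n::nat. finite {h' \<in> H. hat_dist G X \<H> H h h' \<le> enat n}))"


section \<open>Relative presentations and relative Dehn functions\<close>

text \<open>
  The free product of the free group on \<open>S\<close> and the members of \<open>\<H>\<close>. The identities of the members of
  \<open>\<H>\<close> are not letters, so a product \<open>1\<close> in \<open>H\<close> is rewritten to the empty word.
\<close>

definition rel_rules ::
  "('a, 'm) monoid_scheme \<Rightarrow> 'a set \<Rightarrow> 'a set set \<Rightarrow> ('a letter list \<times> 'a letter list) set" where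
  "rel_rules G S \<H> =
     {([Gen s, GenInv s], []) | s. s \<in> S} \<union> {([GenInv s, Gen s], []) | s. s \<in> S}
   \<union> {([Sub H a, Sub H b], if a \<otimes>\<^bsub>G\<^esub> b = \<one>\<^bsub>G\<^esub> then [] else [Sub H (a \<otimes>\<^bsub>G\<^esub> b)]) | H a b.
        H \<in> \<H> \<and> a \<in> H - {\<one>\<^bsub>G\<^esub>} \<and> b \<in> H - {\<one>\<^bsub>G\<^esub>}}"

definition rel_free ::
  "('a, 'm) monoid_scheme \<Rightarrow> 'a set \<Rightarrow> 'a set set \<Rightarrow> 'a letter list set monoid" where
  "rel_free G S \<H> = presented_monoid (rel_alphabet G S \<H>) (rel_rules G S \<H>)"

lemma rel_rules_in_lists:
  assumes "group_pair G \<H>" and "S \<subseteq> carrier G"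
  shows "rel_rules G S \<H> \<subseteq> lists (rel_alphabet G S \<H>) \<times> lists (rel_alphabet G S \<H>)"
  using assms by (auto simp: rel_rules_def rel_alphabet_iff group_pair_def subgroup.m_closed)

lemma group_rel_free:
  assumes "group_pair G \<H>" and "S \<subseteq> carrier G"
  shows "group (rel_free G S \<H>)"
  unfolding rel_free_def
proof (rule group_presented_monoid[OF rel_rules_in_lists[OF assms]])
  interpret group G using assms(1) by (simp add: group_pair_def)
  let ?A = "rel_alphabet G S \<H>" and ?R = "rel_rules G S \<H>"
  fix x assume x: "x \<in> ?A"
  have r: "(l, []) \<in> word_cong ?A ?R" if "(l, []) \<in> ?R" for l
    using word_cong.rule[OF that, of "[]" ?A "[]"] by simp
  show "\<exists>w\<in>lists ?A. (w @ [x], []) \<in> word_cong ?A ?R"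
  proof (cases x)
    case (Gen s)
    then show ?thesis using x
      by (intro bexI[of _ "[GenInv s]"] r) (auto simp: rel_alphabet_iff rel_rules_def)
  next
    case (GenInv s)
    then show ?thesis using x
      by (intro bexI[of _ "[Gen s]"] r) (auto simp: rel_alphabet_iff rel_rules_def)
  next
    case (Sub H h)
    then have h: "H \<in> \<H>" "h \<in> H" "h \<noteq> \<one>\<^bsub>G\<^esub>" "subgroup H G"
      using x assms(1) by (auto simp: rel_alphabet_iff group_pair_def)
    then have hc: "h \<in> carrier G" by (auto dest: subgroup.subset)
    have i: "inv\<^bsub>G\<^esub> h \<in> H" "inv\<^bsub>G\<^esub> h \<noteq> \<one>\<^bsub>G\<^esub>" "inv\<^bsub>G\<^esub> h \<otimes>\<^bsub>G\<^esub> h = \<one>\<^bsub>G\<^esub>"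
      using h hc by (auto simp: subgroup.m_inv_closed)
    have "([Sub H (inv\<^bsub>G\<^esub> h), Sub H h],
        if inv\<^bsub>G\<^esub> h \<otimes>\<^bsub>G\<^esub> h = \<one>\<^bsub>G\<^esub> then [] else [Sub H (inv\<^bsub>G\<^esub> h \<otimes>\<^bsub>G\<^esub> h)]) \<in> ?R"
      unfolding rel_rules_def using h i by blast
    then have "([Sub H (inv\<^bsub>G\<^esub> h)] @ [x], []) \<in> ?R"
      using i Sub by simp
    then have "([Sub H (inv\<^bsub>G\<^esub> h)] @ [x], []) \<in> word_cong ?A ?R"
      by (rule r)
    then show ?thesis using h(1) i
      by (intro bexI[of _ "[Sub H (inv\<^bsub>G\<^esub> h)]"]) (auto simp: rel_alphabet_iff)
  qed
qed

definition rel_class ::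
  "('a, 'm) monoid_scheme \<Rightarrow> 'a set \<Rightarrow> 'a set set \<Rightarrow> 'a letter list \<Rightarrow> 'a letter list set" where
  "rel_class G S \<H> w = word_class (rel_alphabet G S \<H>) (rel_rules G S \<H>) w"

text \<open>The natural map to \<open>G\<close>: all words in a class have the same value (\<open>rel_eval_class\<close> below).\<close>

definition rel_eval :: "('a, 'm) monoid_scheme \<Rightarrow> 'a letter list set \<Rightarrow> 'a" where
  "rel_eval G c = the_elem (word_val G ` c)"

lemma rel_eval_class:
  assumes "group_pair G \<H>" and "S \<subseteq> carrier G" and w: "w \<in> lists (rel_alphabet G S \<H>)"
  shows "rel_eval G (rel_class G S \<H> w) = word_val G w"
proof -
  interpret group G using assms(1) by (simp add: group_pair_def)
  let ?A = "rel_alphabet G S \<H>" and ?R = "rel_rules G S \<H>"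
  have sub: "h \<in> carrier G" if "H \<in> \<H>" "h \<in> H" for H h
    using assms(1) that by (auto simp: group_pair_def dest: subgroup.subset)
  have val: "letter_val G ` ?A \<subseteq> carrier G"
    using assms(2) sub by (auto simp: rel_alphabet_def)
  have rules: "word_eval G (letter_val G) l = word_eval G (letter_val G) r" if "(l, r) \<in> ?R" for l r
    using that assms(2) sub by (auto simp: rel_rules_def word_eval_def)
  have "word_val G v = word_val G w" if "(w, v) \<in> word_cong ?A ?R" for v
    using word_eval_cong[OF group_axioms rel_rules_in_lists[OF assms(1,2)] val rules that]
    by (simp add: word_val_def)
  moreover have "w \<in> rel_class G S \<H> w"
    using w by (auto simp: rel_class_def word_class_def intro: word_cong.refl)
  ultimately have "word_val G ` rel_class G S \<H> w = {word_val G w}"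
    unfolding rel_class_def word_class_def by blast
  then show ?thesis by (simp add: rel_eval_def)
qed

definition normal_closure :: "('a, 'm) monoid_scheme \<Rightarrow> 'a set \<Rightarrow> 'a set" where
  "normal_closure F R =
    generate F {inv\<^bsub>F\<^esub> f \<otimes>\<^bsub>F\<^esub> r \<otimes>\<^bsub>F\<^esub> f | f r. f \<in> carrier F \<and> r \<in> R}"

definition finite_rel_presentation ::
  "('a, 'm) monoid_scheme \<Rightarrow> 'a set set \<Rightarrow> 'a set \<Rightarrow> 'a letter list set set \<Rightarrow> bool" where
  "finite_rel_presentation G \<H> S R \<longleftrightarrow>
     finite S \<and> S \<subseteq> carrier G \<and> rel_eval G ` carrier (rel_free G S \<H>) = carrier G
   \<and> finite R \<and> R \<subseteq> carrier (rel_free G S \<H>)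
   \<and> normal_closure (rel_free G S \<H>) R = kernel (rel_free G S \<H>) G (rel_eval G)"

definition conj_prod :: "('a, 'm) monoid_scheme \<Rightarrow> ('a \<times> 'a) list \<Rightarrow> 'a" where
  "conj_prod F ps =
    foldr (\<lambda>(f, r) g. (inv\<^bsub>F\<^esub> f \<otimes>\<^bsub>F\<^esub> r \<otimes>\<^bsub>F\<^esub> f) \<otimes>\<^bsub>F\<^esub> g) ps \<one>\<^bsub>F\<^esub>"

definition rel_isoperimetric ::
  "('a, 'm) monoid_scheme \<Rightarrow> 'a set set \<Rightarrow> 'a set \<Rightarrow> 'a letter list set set
    \<Rightarrow> (nat \<Rightarrow> enat) \<Rightarrow> bool" where
  "rel_isoperimetric G \<H> S R f \<longleftrightarrow>
    (\<forall>n. \<forall>w\<in>lists (rel_alphabet G S \<H>). length w \<le> n \<and> word_val G w = \<one>\<^bsub>G\<^esub> \<longrightarrow>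
      (\<exists>ps. ps \<in> lists (carrier (rel_free G S \<H>) \<times> (R \<union> m_inv (rel_free G S \<H>) ` R)) \<and>
            rel_class G S \<H> w = conj_prod (rel_free G S \<H>) ps \<and> enat (length ps) \<le> f n))"

definition rel_dehn ::
  "('a, 'm) monoid_scheme \<Rightarrow> 'a set set \<Rightarrow> 'a set \<Rightarrow> 'a letter list set set \<Rightarrow> nat \<Rightarrow> enat" where
  "rel_dehn G \<H> S R n = (INF f\<in>{f. rel_isoperimetric G \<H> S R f}. f n)"

definition dehn_class :: "('a, 'm) monoid_scheme \<Rightarrow> 'a set set \<Rightarrow> bool" where
  "dehn_class G \<H> \<longleftrightarrow> group_pair G \<H> \<and>
    (\<exists>S R. finite_rel_presentation G \<H> S R \<and> (\<forall>n. rel_dehn G \<H> S R n \<noteq> \<infinity>))"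


section \<open>Conjugacy into a collection\<close>

definition conj_into :: "('a, 'm) monoid_scheme \<Rightarrow> 'a set set \<Rightarrow> 'a \<Rightarrow> bool" where
  "conj_into G \<H> g \<longleftrightarrow> (\<exists>Q\<in>\<H>. \<exists>q\<in>Q. \<exists>x\<in>carrier G. g = x \<otimes>\<^bsub>G\<^esub> q \<otimes>\<^bsub>G\<^esub> inv\<^bsub>G\<^esub> x)"

end

theory Submission
  imports Defs
begin

text \<open>
  With \<open>K = \<langle>K\<^sub>1, K\<^sub>2\<rangle>\<close> the amalgam splits as \<open>G = G\<^sub>1 *\<^bsub>K\<^sub>1\<^esub> K *\<^bsub>K\<^sub>2\<^esub> G\<^sub>2\<close>. By the normal form theorem
  every coset of \<open>K\<^sub>i\<close> separates the Cayley graph of \<open>G\<close> relative to \<open>\<H> \<union> {K}\<close>, and it has diameter at most 1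
  there. So this graph is a tree of copies of the relative Cayley graphs of \<open>G\<^sub>1\<close> and \<open>G\<^sub>2\<close> and of complete
  graphs on the cosets of \<open>K\<close>.

  A geodesic meets each piece in a geodesic, and two geodesics of a triangle that meet a piece enter and leave
  it through common sets of diameter at most 1; hence triangles are slim. Projecting to a factor does not
  increase distances, which compares the metrics on the peripheral subgroups; a path avoiding \<open>K\<close> between
  points of \<open>K\<close> is a concatenation of excursions, each of which changes the point of \<open>K\<close> by an element of
  some \<open>K\<^sub>i\<close> from a fixed finite set.

  A word with value in \<open>K\<close> that is not a word in the letters of \<open>K\<close> has a subword over one factor with value
  in \<open>K\<^sub>i\<close>. Replacing this subword by a single letter of \<open>K\<close> costs the area of a relation of that factor and
  lowers the number of other letters, which bounds the area of every relation of given length.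

  An element of \<open>G\<^sub>i\<close> that stabilizes a coset on the far side of a coset of \<open>K\<^sub>i\<close> is conjugate into \<open>K\<^sub>i\<close>.
\<close>


section \<open>Normal forms in amalgamated products\<close>

text \<open>Words over the amalgam carry no visible structure, so sidedness has to be extracted from
  normal forms once and for all. Existence and uniqueness of normal forms are obtained by van der
  Waerden's method: both factors act on the set of forms by right multiplication, the actions agree
  on \<open>C\<close>, and evaluation inverts the orbit map of the trivial form. What the geometry
  needs is then condensed into a set \<open>N i\<close>: one letter leads from \<open>N i\<close>
  only to \<open>N i\<close> or \<open>B i\<close>, and leads from \<open>B i\<close> into
  \<open>N i\<close> only if it lies in \<open>A i - B i\<close>. All separation statements are
  inductions along paths from these two facts.

  Gates are cosets of \<open>B i\<close> and not points. This shapes the constants and the maps: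
  cutting a triangle at a piece gives a hexagon with three sides of length at most 1, hence the
  constant \<open>3 * \<delta> + 2\<close>, and a projection to a factor is a choice inside a gate
  that may jump by an element of \<open>B i\<close> along an edge. Such a jump is harmless because
  the letters of \<open>K1\<close> and \<open>K2\<close> are relabelled as letters of
  \<open>K\<close>, so that \<open>B i\<close> consists of letters of the factor as well as of
  \<open>K\<close>.\<close>

definition left_rep :: "('a, 'm) monoid_scheme \<Rightarrow> 'a set \<Rightarrow> 'a \<Rightarrow> 'a" where
  "left_rep G D g = (if g \<in> D then \<one>\<^bsub>G\<^esub> else SOME x. x \<in> g <#\<^bsub>G\<^esub> D)"

context group begin

lemma left_rep_in_coset:
  assumes D: "subgroup D G" and g: "g \<in> carrier G"
  shows "left_rep G D g \<in> g <# D"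
proof (cases "g \<in> D")
  case True
  then have "g \<otimes> inv g \<in> g <# D"
    using D by (auto simp: l_coset_def subgroup.m_inv_closed)
  then show ?thesis using True g by (simp add: left_rep_def)
next
  case False
  have "g \<in> g <# D"
    using D g subgroup.one_closed[OF D] r_one[OF g] unfolding l_coset_def by force
  then show ?thesis using False by (simp add: left_rep_def) (rule someI)
qed

text \<open>The chosen element depends on the coset alone, as a set. The separate value
  \<open>\<one>\<close> on \<open>D\<close> lets a trivial syllable be recognized by its
  representative.\<close>

lemma left_rep_mult:
  assumes D: "subgroup D G" and g: "g \<in> carrier G" and x: "x \<in> D"
  shows "left_rep G D (g \<otimes> x) = left_rep G D g"
proof -
  have xc: "x \<in> carrier G" using D x by (auto dest: subgroup.subset)
  have "g = (g \<otimes> x) \<otimes> inv x" using g xc by (simp add: m_assoc)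
  then have "g \<otimes> x \<in> D \<longleftrightarrow> g \<in> D"
    using D x by (metis subgroup.m_closed subgroup.m_inv_closed)
  moreover have "x <# D = D"
    using D x by (simp add: coset_join3 xc)
  then have "(g \<otimes> x) <# D = g <# D"
    using lcos_m_assoc[OF _ g xc, of D] D by (metis subgroup.subset)
  ultimately show ?thesis by (simp add: left_rep_def)
qed

lemma left_rep_closed:
  assumes D: "subgroup D G" and g: "g \<in> carrier G"
  shows "left_rep G D g \<in> carrier G" and "inv (left_rep G D g) \<otimes> g \<in> D"
proof -
  obtain x where x: "x \<in> D" "left_rep G D g = g \<otimes> x"
    using left_rep_in_coset[OF assms] by (auto simp: l_coset_def)
  have xc: "x \<in> carrier G" using D x by (auto dest: subgroup.subset)
  show "left_rep G D g \<in> carrier G" using x g xc by simp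
  have "inv (left_rep G D g) \<otimes> g = inv x"
    using g xc x by (simp add: inv_mult_group m_assoc)
  then show "inv (left_rep G D g) \<otimes> g \<in> D"
    using D x by (simp add: subgroup.m_inv_closed)
qed

end

text \<open>
  One factor \<open>A\<close> of an amalgam over \<open>C\<close>. A normal form \<open>t\<^sub>1 \<cdots> t\<^sub>n c\<close> with coset representatives \<open>t\<^sub>j\<close>
  is the pair of the reversed list \<open>[t\<^sub>n, \<dots>, t\<^sub>1]\<close> and \<open>c\<close>. Splitting off the syllable of
  \<open>A\<close> at the end identifies the normal forms with pairs of a list not ending in that factor and an
  element of \<open>A\<close>, so that \<open>A\<close> acts by right multiplication.
\<close>

locale nf_factor = A: group A + C: group C
  for A :: "('a, 'm) monoid_scheme" and C :: "('c, 'k) monoid_scheme" +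
  fixes d :: "'c \<Rightarrow> 'a" and tag :: "'a \<Rightarrow> 'l" and V :: "'l list set"
  assumes d_hom: "d \<in> hom C A" and d_inj: "inj_on d (carrier C)"
    and tag_inj: "inj tag" and Nil_V: "[] \<in> V"
    and Cons_V: "tag t # l \<in> V \<longleftrightarrow>
      l \<in> V \<and> (l = [] \<or> hd l \<notin> range tag) \<and>
      t \<in> carrier A \<and> t \<noteq> \<one>\<^bsub>A\<^esub> \<and> left_rep A (d ` carrier C) t = t"
begin

abbreviation rep :: "'a \<Rightarrow> 'a" where
  "rep \<equiv> left_rep A (d ` carrier C)"

definition cpart :: "'a \<Rightarrow> 'c" where
  "cpart g = inv_into (carrier C) d (inv\<^bsub>A\<^esub> (rep g) \<otimes>\<^bsub>A\<^esub> g)"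

definition other_end :: "'l list set" where
  "other_end = {l \<in> V. l = [] \<or> hd l \<notin> range tag}"

text \<open>Splitting off the last syllable is inverted by \<open>join\<close>: it is a bijection
  from \<open>other_end \<times> carrier A\<close> to \<open>V \<times> carrier C\<close>, by
  \<open>join_in\<close>, \<open>join_inj\<close> and \<open>join_surj\<close>.\<close>

definition join :: "'l list \<Rightarrow> 'a \<Rightarrow> 'l list \<times> 'c" where
  "join l g = (if rep g = \<one>\<^bsub>A\<^esub> then l else tag (rep g) # l, cpart g)"

text \<open>Right multiplication on the second component of
  \<open>other_end \<times> carrier A\<close>, carried over by \<open>join\<close>. In these
  coordinates the laws of an action are immediate.\<close>

definition act :: "'l list \<times> 'c \<Rightarrow> 'a \<Rightarrow> 'l list \<times> 'c" where
  "act \<omega> h = (THE \<omega>'. \<exists>l\<in>other_end. \<exists>g\<in>carrier A. \<omega> = join l g \<and> \<omega>' = join l (g \<otimes>\<^bsub>A\<^esub> h))"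

lemma subgroup_d: "subgroup (d ` carrier C) A"
  using d_hom group_hom.img_is_subgroup[of C A d]
  by (simp add: group_hom_def group_hom_axioms_def A.is_group C.is_group)

lemma d_closed: "c \<in> carrier C \<Longrightarrow> d c \<in> carrier A"
  using d_hom by (auto simp: hom_def)

lemma d_mult: "c \<in> carrier C \<Longrightarrow> c' \<in> carrier C \<Longrightarrow> d (c \<otimes>\<^bsub>C\<^esub> c') = d c \<otimes>\<^bsub>A\<^esub> d c'"
  using d_hom by (auto simp: hom_def)

lemma rep_closed: "g \<in> carrier A \<Longrightarrow> rep g \<in> carrier A"
  by (rule A.left_rep_closed(1)[OF subgroup_d])

lemma rep_mult: "g \<in> carrier A \<Longrightarrow> c \<in> carrier C \<Longrightarrow> rep (g \<otimes>\<^bsub>A\<^esub> d c) = rep g"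
  by (intro A.left_rep_mult[OF subgroup_d]) auto

lemma cpart:
  assumes "g \<in> carrier A"
  shows "cpart g \<in> carrier C" and "rep g \<otimes>\<^bsub>A\<^esub> d (cpart g) = g"
proof -
  have *: "inv\<^bsub>A\<^esub> (rep g) \<otimes>\<^bsub>A\<^esub> g \<in> d ` carrier C"
    by (rule A.left_rep_closed(2)[OF subgroup_d assms])
  show "cpart g \<in> carrier C" unfolding cpart_def by (rule inv_into_into[OF *])
  have "d (cpart g) = inv\<^bsub>A\<^esub> (rep g) \<otimes>\<^bsub>A\<^esub> g"
    unfolding cpart_def by (rule f_inv_into_f[OF *])
  then show "rep g \<otimes>\<^bsub>A\<^esub> d (cpart g) = g"
    using rep_closed[OF assms] assms by (simp add: A.m_assoc[symmetric])
qed

lemma cpart_eqI: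
  assumes "g \<in> carrier A" "c \<in> carrier C" "g = rep g \<otimes>\<^bsub>A\<^esub> d c"
  shows "cpart g = c"
proof -
  have "d (cpart g) = d c"
    using assms cpart[OF assms(1)] rep_closed[OF assms(1)] d_closed
    by (metis A.inv_solve_left)
  then show ?thesis using d_inj assms(2) cpart(1)[OF assms(1)] by (auto dest: inj_onD)
qed

lemma rep_eq_one_iff: "g \<in> carrier A \<Longrightarrow> rep g = \<one>\<^bsub>A\<^esub> \<longleftrightarrow> g \<in> d ` carrier C"
  using cpart[of g] by (force simp: left_rep_def d_closed)

lemma rep_rep: "g \<in> carrier A \<Longrightarrow> rep (rep g) = rep g"
  using rep_mult[of "rep g" "cpart g"] cpart[of g] rep_closed[of g] by simp

lemma join_in:
  assumes "l \<in> other_end" "g \<in> carrier A"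
  shows "join l g \<in> V \<times> carrier C"
  using assms cpart(1)[OF assms(2)] rep_closed[OF assms(2)] rep_rep[OF assms(2)]
  by (auto simp: join_def other_end_def Cons_V)

text \<open>A list in \<open>other_end\<close> has no syllable of \<open>A\<close> at its head, so
  the head of the result tells whether \<open>rep g\<close> is trivial. Then \<open>rep g\<close>
  and \<open>cpart g\<close> together recover \<open>g\<close>.\<close>

lemma join_inj:
  assumes "l \<in> other_end" "l' \<in> other_end" "g \<in> carrier A" "g' \<in> carrier A"
    and "join l g = join l' g'"
  shows "l = l' \<and> g = g'"
proof -
  have *: "m \<noteq> tag t # m'" if "m \<in> other_end" for m m' t
    using that by (auto simp: other_end_def)
  have eq: "(if rep g = \<one>\<^bsub>A\<^esub> then l else tag (rep g) # l) = (if rep g' = \<one>\<^bsub>A\<^esub> then l' else tag (rep g') # l')"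
    and c: "cpart g = cpart g'"
    using assms(5) by (simp_all add: join_def)
  have "l = l' \<and> rep g = rep g'"
  proof (cases "rep g = \<one>\<^bsub>A\<^esub>")
    case True
    then have "rep g' = \<one>\<^bsub>A\<^esub>" using eq *[OF assms(1)] by metis
    then show ?thesis using eq True by simp
  next
    case False
    then have "rep g' \<noteq> \<one>\<^bsub>A\<^esub>" using eq *[OF assms(2)] by metis
    then show ?thesis using eq False by (simp add: inj_eq[OF tag_inj])
  qed
  with c show ?thesis using cpart(2)[OF assms(3)] cpart(2)[OF assms(4)] by metis
qed

lemma join_surj:
  assumes "l \<in> V" "c \<in> carrier C"
  shows "\<exists>l'\<in>other_end. \<exists>g\<in>carrier A. (l, c) = join l' g"
proof (cases "l \<in> other_end")
  case True
  have "rep (d c) = \<one>\<^bsub>A\<^esub>" using assms by (simp add: left_rep_def)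
  moreover have "cpart (d c) = c"
    using assms calculation by (intro cpart_eqI) (auto simp: d_closed)
  ultimately have "(l, c) = join l (d c)" by (simp add: join_def)
  then show ?thesis using True d_closed[OF assms(2)] by blast
next
  case False
  then obtain t l' where l: "l = tag t # l'" using assms(1) by (cases l) (auto simp: other_end_def)
  then have t: "t \<in> carrier A" "t \<noteq> \<one>\<^bsub>A\<^esub>" "rep t = t" "l' \<in> other_end"
    using assms(1) by (auto simp: Cons_V other_end_def)
  let ?g = "t \<otimes>\<^bsub>A\<^esub> d c"
  have g: "?g \<in> carrier A" "rep ?g = t" using t d_closed[OF assms(2)] rep_mult[OF t(1) assms(2)] by auto
  have "cpart ?g = c" using g assms by (intro cpart_eqI) auto
  then have "(l, c) = join l' ?g" using g t l by (simp add: join_def)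
  then show ?thesis using t g by blast
qed

lemma joinE:
  assumes "\<omega> \<in> V \<times> carrier C"
  obtains l g where "l \<in> other_end" "g \<in> carrier A" "\<omega> = join l g"
  using assms join_surj by blast

lemma last_join: "l \<noteq> [] \<Longrightarrow> fst (join l g) \<noteq> [] \<and> last (fst (join l g)) = last l"
  by (simp add: join_def)

lemma act_join:
  assumes "l \<in> other_end" "g \<in> carrier A"
  shows "act (join l g) h = join l (g \<otimes>\<^bsub>A\<^esub> h)"
  unfolding act_def using assms join_inj by (intro the_equality) blast+

lemma act_closed:
  assumes "\<omega> \<in> V \<times> carrier C" "h \<in> carrier A"
  shows "act \<omega> h \<in> V \<times> carrier C"
proof -
  obtain l g where "l \<in> other_end" "g \<in> carrier A" "\<omega> = join l g"
    using join_surj assms(1) by blast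
  then show ?thesis using assms(2) by (simp only: act_join join_in A.m_closed)
qed

lemma act_act:
  assumes "\<omega> \<in> V \<times> carrier C" "h \<in> carrier A" "h' \<in> carrier A"
  shows "act (act \<omega> h) h' = act \<omega> (h \<otimes>\<^bsub>A\<^esub> h')"
proof -
  obtain l g where "l \<in> other_end" "g \<in> carrier A" "\<omega> = join l g"
    using join_surj assms(1) by blast
  then show ?thesis using assms(2,3) by (simp add: act_join A.m_assoc)
qed

lemma act_one:
  assumes "\<omega> \<in> V \<times> carrier C"
  shows "act \<omega> \<one>\<^bsub>A\<^esub> = \<omega>"
proof -
  obtain l g where "l \<in> other_end" "g \<in> carrier A" "\<omega> = join l g"
    using join_surj assms(1) by blast
  then show ?thesis by (simp add: act_join)
qed

text \<open>On \<open>C\<close> the action is visible without splitting off a syllable and does not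
  mention the factor. Hence the actions of the two factors respect the identification of
  \<open>d1 c\<close> with \<open>d2 c\<close>.\<close>

lemma act_d:
  assumes "l \<in> V" "c \<in> carrier C" "c' \<in> carrier C"
  shows "act (l, c) (d c') = (l, c \<otimes>\<^bsub>C\<^esub> c')"
proof -
  obtain l' g where lg: "l' \<in> other_end" "g \<in> carrier A" "(l, c) = join l' g"
    using join_surj assms(1,2) by blast
  have "g \<otimes>\<^bsub>A\<^esub> d c' = rep g \<otimes>\<^bsub>A\<^esub> (d (cpart g) \<otimes>\<^bsub>A\<^esub> d c')"
    using cpart[OF lg(2)] rep_closed[OF lg(2)] assms(3) d_closed by (metis A.m_assoc)
  then have "g \<otimes>\<^bsub>A\<^esub> d c' = rep (g \<otimes>\<^bsub>A\<^esub> d c') \<otimes>\<^bsub>A\<^esub> d (cpart g \<otimes>\<^bsub>C\<^esub> c')"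
    unfolding rep_mult[OF lg(2) assms(3)] d_mult[OF cpart(1)[OF lg(2)] assms(3)] .
  then have "cpart (g \<otimes>\<^bsub>A\<^esub> d c') = cpart g \<otimes>\<^bsub>C\<^esub> c'"
    using cpart(1)[OF lg(2)] assms(3) lg(2) d_closed by (intro cpart_eqI) auto
  then show ?thesis
    using lg assms(3) by (simp add: act_join) (simp add: join_def rep_mult)
qed

lemma join_Nil_one: "join [] \<one>\<^bsub>A\<^esub> = ([], \<one>\<^bsub>C\<^esub>)" and Nil_other_end: "[] \<in> other_end"
proof -
  have "d \<one>\<^bsub>C\<^esub> = \<one>\<^bsub>A\<^esub>"
    using d_hom by (simp add: hom_one A.is_group C.is_group)
  moreover have "\<one>\<^bsub>A\<^esub> \<in> d ` carrier C" using subgroup.one_closed[OF subgroup_d] .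
  then have 1: "rep \<one>\<^bsub>A\<^esub> = \<one>\<^bsub>A\<^esub>" by (simp add: rep_eq_one_iff)
  ultimately have "cpart \<one>\<^bsub>A\<^esub> = \<one>\<^bsub>C\<^esub>" by (intro cpart_eqI) auto
  then show "join [] \<one>\<^bsub>A\<^esub> = ([], \<one>\<^bsub>C\<^esub>)" using 1 by (simp add: join_def)
  show "[] \<in> other_end" by (simp add: other_end_def Nil_V)
qed

text \<open>Evaluating a form turns \<open>act\<close> into right multiplication in the group. This
  makes evaluation a left inverse of the normal form map, which is therefore injective.\<close>

lemma value_act:
  assumes G: "group G" and \<iota>: "\<iota> \<in> hom A G"
    and v: "\<And>l. l \<in> V \<Longrightarrow> v l \<in> carrier G"
    and v_Cons: "\<And>t l. tag t # l \<in> V \<Longrightarrow> v (tag t # l) = v l \<otimes>\<^bsub>G\<^esub> \<iota> t"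
    and \<omega>: "\<omega> \<in> V \<times> carrier C" and h: "h \<in> carrier A"
  shows "v (fst (act \<omega> h)) \<otimes>\<^bsub>G\<^esub> \<iota> (d (snd (act \<omega> h))) = v (fst \<omega>) \<otimes>\<^bsub>G\<^esub> \<iota> (d (snd \<omega>)) \<otimes>\<^bsub>G\<^esub> \<iota> h"
proof -
  interpret G: group G by fact
  have \<iota>c: "\<iota> g \<in> carrier G" if "g \<in> carrier A" for g
    using \<iota> that by (auto simp: hom_def)
  have \<iota>m: "\<iota> (g \<otimes>\<^bsub>A\<^esub> g') = \<iota> g \<otimes>\<^bsub>G\<^esub> \<iota> g'" if "g \<in> carrier A" "g' \<in> carrier A" for g g'
    using \<iota> that by (auto simp: hom_def)
  have *: "v (fst (join l g)) \<otimes>\<^bsub>G\<^esub> \<iota> (d (snd (join l g))) = v l \<otimes>\<^bsub>G\<^esub> \<iota> g"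
    if l: "l \<in> other_end" and g: "g \<in> carrier A" for l g
  proof (cases "rep g = \<one>\<^bsub>A\<^esub>")
    case True
    then show ?thesis using cpart[OF g] by (simp add: join_def d_closed)
  next
    case False
    then have "tag (rep g) # l \<in> V" using join_in[OF l g] by (simp add: join_def)
    moreover have "v l \<in> carrier G" using l v by (simp add: other_end_def)
    moreover have "\<iota> (rep g) \<otimes>\<^bsub>G\<^esub> \<iota> (d (cpart g)) = \<iota> g"
      using \<iota>m[of "rep g" "d (cpart g)"] cpart[OF g] rep_closed[OF g] by (simp add: d_closed)
    ultimately show ?thesis
      using False cpart(1)[OF g] rep_closed[OF g]
      by (simp add: join_def v_Cons G.m_assoc \<iota>c d_closed)
  qed
  obtain l g where lg: "l \<in> other_end" "g \<in> carrier A" "\<omega> = join l g"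
    using join_surj \<omega> by blast
  moreover have "v l \<in> carrier G" using lg v by (simp add: other_end_def)
  ultimately show ?thesis
    using h *[OF lg(1)] by (simp add: act_join \<iota>m \<iota>c G.m_assoc)
qed

end

section \<open>Elements whose normal form begins with a prescribed kind of syllable\<close>

locale amalgam_nf = G: group G + F1: nf_factor A1 C d1 tag1 V + F2: nf_factor A2 C d2 tag2 V
  for G :: "('g, 'z) monoid_scheme" and A1 :: "('a, 'm) monoid_scheme"
    and A2 :: "('b, 'n) monoid_scheme" and C :: "('c, 'k) monoid_scheme"
    and d1 d2 and tag1 :: "'a \<Rightarrow> 'l" and tag2 :: "'b \<Rightarrow> 'l" and V +
  fixes \<iota>1 :: "'a \<Rightarrow> 'g" and \<iota>2 :: "'b \<Rightarrow> 'g" and nf :: "'g \<Rightarrow> 'l list \<times> 'c"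
  assumes \<iota>1: "\<iota>1 \<in> hom A1 G" and \<iota>2: "\<iota>2 \<in> hom A2 G"
    and tags: "tag1 a \<noteq> tag2 b"
    and nf: "x \<in> carrier G \<Longrightarrow> nf x \<in> V \<times> carrier C"
    and nf_inj: "inj_on nf (carrier G)"
    and nf_one: "nf \<one>\<^bsub>G\<^esub> = ([], \<one>\<^bsub>C\<^esub>)"
    and nf_mult1: "x \<in> carrier G \<Longrightarrow> a \<in> carrier A1 \<Longrightarrow> nf (x \<otimes>\<^bsub>G\<^esub> \<iota>1 a) = F1.act (nf x) a"
    and nf_mult2: "x \<in> carrier G \<Longrightarrow> b \<in> carrier A2 \<Longrightarrow> nf (x \<otimes>\<^bsub>G\<^esub> \<iota>2 b) = F2.act (nf x) b"
begin

text \<open>Lists are stored in reverse, so \<open>last\<close> is the first syllable of the normal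
  form. It is untouched by right multiplication as long as other syllables follow.\<close>

definition starts_in :: "'a set \<Rightarrow> 'g set" where
  "starts_in S = {x \<in> carrier G. fst (nf x) \<noteq> [] \<and> last (fst (nf x)) \<in> tag1 ` S}"

lemma \<iota>_closed: "a \<in> carrier A1 \<Longrightarrow> \<iota>1 a \<in> carrier G" "b \<in> carrier A2 \<Longrightarrow> \<iota>2 b \<in> carrier G"
  using \<iota>1 \<iota>2 by (auto simp: hom_def)

lemma nf_\<iota>1: "a \<in> carrier A1 \<Longrightarrow> nf (\<iota>1 a) = F1.join [] a"
  using nf_mult1[OF G.one_closed, of a] F1.act_join[OF F1.Nil_other_end F1.A.one_closed, of a]
  by (simp add: nf_one F1.join_Nil_one \<iota>_closed)

lemma nf_\<iota>2: "b \<in> carrier A2 \<Longrightarrow> nf (\<iota>2 b) = F2.join [] b"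
  using nf_mult2[OF G.one_closed, of b] F2.act_join[OF F2.Nil_other_end F2.A.one_closed, of b]
  by (simp add: nf_one F2.join_Nil_one \<iota>_closed)

lemma \<iota>1_inj: "inj_on \<iota>1 (carrier A1)"
proof (rule inj_onI)
  fix a b assume "a \<in> carrier A1" "b \<in> carrier A1" "\<iota>1 a = \<iota>1 b"
  then show "a = b"
    using nf_\<iota>1[of a] nf_\<iota>1[of b] F1.join_inj[OF F1.Nil_other_end F1.Nil_other_end] by simp
qed

text \<open>The two normal forms have at most one syllable, with different tags; they can agree only
  if both lists are empty.\<close>

lemma \<iota>1_\<iota>2_inter:
  assumes "a \<in> carrier A1" "b \<in> carrier A2" "\<iota>1 a = \<iota>2 b"
  shows "a \<in> d1 ` carrier C"
proof -
  have "F1.join [] a = F2.join [] b" using assms by (metis nf_\<iota>1 nf_\<iota>2)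
  then have "F1.rep a = \<one>\<^bsub>A1\<^esub>"
    using tags by (auto simp: F1.join_def F2.join_def split: if_splits)
  then show ?thesis using assms F1.rep_eq_one_iff by blast
qed

context
  fixes K :: "'a set"
  assumes K: "subgroup K A1" and dK: "d1 ` carrier C \<subseteq> K"
begin

lemma Kc: "k \<in> K \<Longrightarrow> k \<in> carrier A1"
  using K by (auto dest: subgroup.subset)

lemma \<iota>1_image_iff: "a \<in> carrier A1 \<Longrightarrow> \<iota>1 a \<in> \<iota>1 ` K \<longleftrightarrow> a \<in> K"
  using \<iota>1_inj Kc by (auto dest: inj_onD)

lemma rep_in_K_iff: "a \<in> carrier A1 \<Longrightarrow> F1.rep a \<in> K \<longleftrightarrow> a \<in> K"
proof -
  assume a: "a \<in> carrier A1"
  have "d1 (F1.cpart a) \<in> K" using dK F1.cpart(1)[OF a] by blast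
  then show ?thesis
    using F1.cpart(2)[OF a] K F1.rep_closed[OF a] Kc
    by (metis F1.A.inv_solve_right subgroup.m_closed subgroup.m_inv_closed)
qed

lemma \<iota>1_starts_in: "a \<in> carrier A1 \<Longrightarrow> \<iota>1 a \<in> starts_in (carrier A1 - K) \<longleftrightarrow> a \<notin> K"
  using rep_in_K_iff[of a] F1.rep_closed[of a] subgroup.one_closed[OF K]
  by (auto simp: starts_in_def nf_\<iota>1 \<iota>_closed F1.join_def inj_image_mem_iff[OF F1.tag_inj])

text \<open>An element of a factor changes only the end of a normal form. The first syllable is at
  risk only if it is the only one and \<open>s\<close> comes from the same factor; then the product
  lies in that factor, where \<open>\<iota>1_starts_in\<close> decides.\<close>

lemma starts_in_step:
  assumes x: "x \<in> starts_in (carrier A1 - K)" and s: "s \<in> \<iota>1 ` carrier A1 \<union> \<iota>2 ` carrier A2"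
  shows "x \<otimes>\<^bsub>G\<^esub> s \<in> starts_in (carrier A1 - K) \<union> \<iota>1 ` K"
proof -
  have xc: "x \<in> carrier G" using x by (simp add: starts_in_def)
  then have nfx: "nf x \<in> V \<times> carrier C" by (rule nf)
  show ?thesis
  proof (cases "s \<in> \<iota>1 ` carrier A1")
    case True
    then obtain a where a: "a \<in> carrier A1" "s = \<iota>1 a" by blast
    obtain l g where lg: "l \<in> F1.other_end" "g \<in> carrier A1" "nf x = F1.join l g"
      by (rule F1.joinE[OF nfx])
    show ?thesis
    proof (cases "l = []")
      case True
      then have "nf x = nf (\<iota>1 g)" using lg nf_\<iota>1 by simp
      then have "x = \<iota>1 g" using nf_inj xc \<iota>_closed lg(2) by (auto dest: inj_onD)
      then have eq: "x \<otimes>\<^bsub>G\<^esub> s = \<iota>1 (g \<otimes>\<^bsub>A1\<^esub> a)" using \<iota>1 a lg by (simp add: hom_mult)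
      have "g \<otimes>\<^bsub>A1\<^esub> a \<in> carrier A1" using a lg by simp
      then show ?thesis using \<iota>1_starts_in \<iota>1_image_iff unfolding eq by blast
    next
      case False
      have "nf (x \<otimes>\<^bsub>G\<^esub> s) = F1.join l (g \<otimes>\<^bsub>A1\<^esub> a)"
        using a lg xc by (simp add: nf_mult1 F1.act_join)
      then show ?thesis
        using False x lg a xc F1.last_join[OF False] by (simp add: starts_in_def \<iota>_closed)
    qed
  next
    case False
    then obtain a where a: "a \<in> carrier A2" "s = \<iota>2 a" using s by blast
    obtain l g where lg: "l \<in> F2.other_end" "g \<in> carrier A2" "nf x = F2.join l g"
      by (rule F2.joinE[OF nfx])
    have "l \<noteq> []"
      using x lg by (auto simp: starts_in_def F2.join_def tags[symmetric] split: if_splits)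
    moreover have "nf (x \<otimes>\<^bsub>G\<^esub> s) = F2.join l (g \<otimes>\<^bsub>A2\<^esub> a)"
      using a lg xc by (simp add: nf_mult2 F2.act_join)
    ultimately show ?thesis
      using x lg a xc F2.last_join[of l] by (simp add: starts_in_def \<iota>_closed)
  qed
qed

lemma starts_in_leave:
  assumes x: "x \<in> \<iota>1 ` K" and s: "s \<in> \<iota>1 ` carrier A1 \<union> \<iota>2 ` carrier A2"
  shows "x \<otimes>\<^bsub>G\<^esub> s \<in> starts_in (carrier A1 - K) \<longleftrightarrow> s \<in> \<iota>1 ` carrier A1 - \<iota>1 ` K"
proof -
  obtain k where k: "k \<in> K" "x = \<iota>1 k" using x by blast
  note kc = Kc[OF k(1)]
  show ?thesis
  proof (cases "s \<in> \<iota>1 ` carrier A1")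
    case True
    then obtain a where a: "a \<in> carrier A1" "s = \<iota>1 a" by blast
    have "x \<otimes>\<^bsub>G\<^esub> s = \<iota>1 (k \<otimes>\<^bsub>A1\<^esub> a)" using \<iota>1 a k kc by (simp add: hom_mult)
    moreover have "k \<otimes>\<^bsub>A1\<^esub> a \<in> K \<longleftrightarrow> a \<in> K"
      using K k(1) a kc
      by (metis F1.A.inv_solve_left F1.A.m_closed subgroup.m_closed subgroup.m_inv_closed)
    ultimately show ?thesis
      using a kc \<iota>1_starts_in[of "k \<otimes>\<^bsub>A1\<^esub> a"] \<iota>1_image_iff[of a] by simp
  next
    case False
    then obtain b where b: "b \<in> carrier A2" "s = \<iota>2 b" using s by blast
    have "nf x \<in> V \<times> carrier C" using k kc \<iota>_closed by (intro nf) simp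
    then obtain l g where lg: "l \<in> F2.other_end" "g \<in> carrier A2" "nf x = F2.join l g"
      by (rule F2.joinE)
    moreover have "nf x = F1.join [] k" using k kc nf_\<iota>1 by simp
    moreover have "nf (x \<otimes>\<^bsub>G\<^esub> s) = F2.join l (g \<otimes>\<^bsub>A2\<^esub> b)"
      using b lg k kc by (simp add: nf_mult2 F2.act_join \<iota>_closed)
    moreover have "F1.rep k \<in> K" using k rep_in_K_iff kc by blast
    \<comment> \<open>The form of \<open>x\<close> is empty or the single syllable
      \<open>rep k\<close>. After a step in the second factor the first syllable is
      \<open>rep k\<close>, which lies in \<open>K\<close>, or a syllable of the second factor, or
      there is none.\<close>
    ultimately have "x \<otimes>\<^bsub>G\<^esub> s \<notin> starts_in (carrier A1 - K)"
      by (auto simp: starts_in_def F1.join_def F2.join_def tags tags[symmetric] inj_eq[OF F1.tag_inj] split: if_splits)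
    then show ?thesis using False by blast
  qed
qed

end

end

section \<open>Words acting on normal forms\<close>

locale amalgam = G1: group G1 + G2: group G2 + C: group C
  for G1 :: "('a, 'm) monoid_scheme" and G2 :: "('b, 'n) monoid_scheme"
    and C :: "('c, 'k) monoid_scheme" +
  fixes d1 :: "'c \<Rightarrow> 'a" and d2 :: "'c \<Rightarrow> 'b"
  assumes d1: "d1 \<in> mon C G1" and d2: "d2 \<in> mon C G2"
begin

abbreviation "letters \<equiv> carrier G1 <+> carrier G2"
abbreviation "rules \<equiv> amalg_rules G1 G2 C d1 d2"
abbreviation "P \<equiv> amalg G1 G2 C d1 d2"
abbreviation "in1 \<equiv> amalg_in1 G1 G2 C d1 d2"
abbreviation "in2 \<equiv> amalg_in2 G1 G2 C d1 d2"

definition syllables :: "('a + 'b) set" where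
  "syllables =
     Inl ` {t \<in> carrier G1. t \<noteq> \<one>\<^bsub>G1\<^esub> \<and> left_rep G1 (d1 ` carrier C) t = t} \<union>
     Inr ` {t \<in> carrier G2. t \<noteq> \<one>\<^bsub>G2\<^esub> \<and> left_rep G2 (d2 ` carrier C) t = t}"

definition alternating :: "('a + 'b) list set" where
  "alternating = {l \<in> lists syllables. successively (\<lambda>x y. isl x \<noteq> isl y) l}"

lemma d_hom: "d1 \<in> hom C G1" "d2 \<in> hom C G2" "inj_on d1 (carrier C)" "inj_on d2 (carrier C)"
  using d1 d2 by (auto simp: mon_def)

lemma d_image: "d1 ` carrier C \<subseteq> carrier G1" "d2 ` carrier C \<subseteq> carrier G2"
  using d_hom by (auto simp: hom_def)

lemma range_Inl_iff: "x \<in> range Inl \<longleftrightarrow> isl x" and range_Inr_iff: "x \<in> range Inr \<longleftrightarrow> \<not> isl x"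
  by (cases x; auto)+

lemma Inl_syllables: "Inl t \<in> syllables \<longleftrightarrow> t \<in> carrier G1 \<and> t \<noteq> \<one>\<^bsub>G1\<^esub> \<and> left_rep G1 (d1 ` carrier C) t = t"
  and Inr_syllables: "Inr u \<in> syllables \<longleftrightarrow> u \<in> carrier G2 \<and> u \<noteq> \<one>\<^bsub>G2\<^esub> \<and> left_rep G2 (d2 ` carrier C) u = u"
  by (auto simp: syllables_def)

lemma in_letters: "Inl a \<in> letters \<longleftrightarrow> a \<in> carrier G1" "Inr b \<in> letters \<longleftrightarrow> b \<in> carrier G2"
  by auto

sublocale F1: nf_factor G1 C d1 "Inl :: 'a \<Rightarrow> 'a + 'b" alternating
proof
  fix t :: 'a and l :: "('a + 'b) list"
  show "Inl t # l \<in> alternating \<longleftrightarrow>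
      l \<in> alternating \<and> (l = [] \<or> hd l \<notin> range Inl) \<and>
      t \<in> carrier G1 \<and> t \<noteq> \<one>\<^bsub>G1\<^esub> \<and> left_rep G1 (d1 ` carrier C) t = t"
    unfolding range_Inl_iff by (simp add: alternating_def Inl_syllables successively_Cons) (metis successively.simps(1))
qed (auto simp: d_hom alternating_def)

sublocale F2: nf_factor G2 C d2 "Inr :: 'b \<Rightarrow> 'a + 'b" alternating
proof
  fix t :: 'b and l :: "('a + 'b) list"
  show "Inr t # l \<in> alternating \<longleftrightarrow>
      l \<in> alternating \<and> (l = [] \<or> hd l \<notin> range Inr) \<and>
      t \<in> carrier G2 \<and> t \<noteq> \<one>\<^bsub>G2\<^esub> \<and> left_rep G2 (d2 ` carrier C) t = t"
    unfolding range_Inr_iff by (simp add: alternating_def Inr_syllables successively_Cons) (metis successively.simps(1))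
qed (auto simp: d_hom alternating_def)

abbreviation "forms \<equiv> alternating \<times> carrier C"

definition letter_act :: "('a + 'b) list \<times> 'c \<Rightarrow> 'a + 'b \<Rightarrow> ('a + 'b) list \<times> 'c" where
  "letter_act \<omega> x = (case x of Inl a \<Rightarrow> F1.act \<omega> a | Inr b \<Rightarrow> F2.act \<omega> b)"

lemma run_closed: "\<omega> \<in> forms \<Longrightarrow> w \<in> lists letters \<Longrightarrow> foldl letter_act \<omega> w \<in> forms"
proof (induction w arbitrary: \<omega>)
  case (Cons x w)
  then have "letter_act \<omega> x \<in> forms"
    using F1.act_closed[of \<omega>] F2.act_closed[of \<omega>]
    by (cases x) (simp_all add: letter_act_def in_letters del: mem_Times_iff)
  with Cons show ?case by simp
qed simp

lemma rules_in_lists: "rules \<subseteq> lists letters \<times> lists letters"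
  by (rule amalg_rules_in_lists[OF G1.is_group G2.is_group d_image])

text \<open>The rules express exactly that each factor acts on forms (unit and product) and that the
  two actions agree on \<open>C\<close>.\<close>

lemma run_rule:
  assumes "(l, r) \<in> rules" "\<omega> \<in> forms"
  shows "foldl letter_act \<omega> l = foldl letter_act \<omega> r"
  using assms by (auto simp: amalg_rules_def letter_act_def F1.act_one F2.act_one F1.act_act F2.act_act F1.act_d F2.act_d)

lemma run_cong:
  assumes "(u, v) \<in> word_cong letters rules" "\<omega> \<in> forms"
  shows "foldl letter_act \<omega> u = foldl letter_act \<omega> v"
  using assms
proof (induction arbitrary: \<omega>)
  case (rule l r u v)
  then show ?case using run_rule[OF rule(1) run_closed] by simp
qed simp_all

text \<open>The orbit map of the trivial form. The choice of a word is immaterial by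
  \<open>run_cong\<close>, so \<open>nf_class\<close> computes it from any word.\<close>

definition nf :: "('a + 'b) list set \<Rightarrow> ('a + 'b) list \<times> 'c" where
  "nf x = foldl letter_act ([], \<one>\<^bsub>C\<^esub>) (SOME w. w \<in> x)"

lemma initial_form: "([], \<one>\<^bsub>C\<^esub>) \<in> forms"
  using F1.Nil_V by simp

lemma nf_class:
  assumes "w \<in> lists letters"
  shows "nf (word_class letters rules w) = foldl letter_act ([], \<one>\<^bsub>C\<^esub>) w"
proof -
  have "w \<in> word_class letters rules w"
    using assms by (auto simp: word_class_def intro: word_cong.refl)
  then have "(SOME v. v \<in> word_class letters rules w) \<in> word_class letters rules w" by (rule someI)
  then show ?thesis
    using run_cong[OF _ initial_form] unfolding nf_def word_class_def by simp
qed

lemma group_P: "group P"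
  by (rule group_amalg[OF G1.is_group G2.is_group d_image])

lemmas in_hom = amalg_in_hom[OF G1.is_group G2.is_group d_image]

lemma in_closed: "a \<in> carrier G1 \<Longrightarrow> in1 a \<in> carrier P" "b \<in> carrier G2 \<Longrightarrow> in2 b \<in> carrier P"
  using in_hom(1,2) by (auto dest: hom_in_carrier)

definition syllable_value :: "('a + 'b) list \<Rightarrow> ('a + 'b) list set" where
  "syllable_value l = foldr (\<lambda>x y. y \<otimes>\<^bsub>P\<^esub> (case x of Inl a \<Rightarrow> in1 a | Inr b \<Rightarrow> in2 b)) l \<one>\<^bsub>P\<^esub>"

definition form_value :: "('a + 'b) list \<times> 'c \<Rightarrow> ('a + 'b) list set" where
  "form_value \<omega> = syllable_value (fst \<omega>) \<otimes>\<^bsub>P\<^esub> in1 (d1 (snd \<omega>))"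

lemma syllable_value_closed:
  assumes "l \<in> alternating"
  shows "syllable_value l \<in> carrier P"
proof -
  interpret P: group P by (rule group_P)
  have "l \<in> lists syllables" using assms by (simp add: alternating_def)
  then show ?thesis
  proof (induction l)
    case (Cons x l)
    then show ?case
      by (cases x) (simp_all add: syllable_value_def Inl_syllables Inr_syllables in_closed)
  qed (simp add: syllable_value_def)
qed

lemma form_value_closed: "\<omega> \<in> forms \<Longrightarrow> form_value \<omega> \<in> carrier P"
  unfolding form_value_def using group.is_monoid[OF group_P]
  by (intro monoid.m_closed syllable_value_closed in_closed F1.d_closed)
    (simp_all add: mem_Times_iff)

lemma form_value_act:
  assumes "\<omega> \<in> forms" "x \<in> letters"
  shows "form_value (letter_act \<omega> x) = form_value \<omega> \<otimes>\<^bsub>P\<^esub> word_class letters rules [x]"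
proof (cases x)
  case (Inl a)
  have "form_value (F1.act \<omega> a) = form_value \<omega> \<otimes>\<^bsub>P\<^esub> in1 a"
    unfolding form_value_def using assms Inl
    by (intro F1.value_act[OF group_P in_hom(1) syllable_value_closed])
      (auto simp: syllable_value_def)
  then show ?thesis by (simp add: Inl letter_act_def amalg_in1_def)
next
  case (Inr b)
  have eq: "form_value \<omega> = syllable_value (fst \<omega>) \<otimes>\<^bsub>P\<^esub> in2 (d2 (snd \<omega>))" if "\<omega> \<in> forms" for \<omega>
    using that in_hom(3) by (auto simp: form_value_def)
  have "b \<in> carrier G2" using assms Inr by auto
  then have "form_value (F2.act \<omega> b) = form_value \<omega> \<otimes>\<^bsub>P\<^esub> in2 b"
    unfolding eq[OF assms(1)] eq[OF F2.act_closed[OF assms(1) \<open>b \<in> carrier G2\<close>]] using assms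
    by (intro F2.value_act[OF group_P in_hom(2) syllable_value_closed])
      (auto simp: syllable_value_def)
  then show ?thesis by (simp add: Inr letter_act_def amalg_in2_def)
qed

lemma mult_class:
  assumes "u \<in> lists letters" "v \<in> lists letters"
  shows "word_class letters rules u \<otimes>\<^bsub>P\<^esub> word_class letters rules v = word_class letters rules (u @ v)"
  unfolding amalg_def by (rule mult_presented_monoid[OF rules_in_lists assms])

lemma carrier_P: "carrier P = word_class letters rules ` lists letters"
  by (simp add: amalg_def carrier_presented_monoid)

lemma form_value_run:
  assumes "\<omega> \<in> forms" "w \<in> lists letters"
  shows "form_value (foldl letter_act \<omega> w) = form_value \<omega> \<otimes>\<^bsub>P\<^esub> word_class letters rules w"
  using assms(2)
proof (induction w rule: rev_induct)
  interpret P: group P by (rule group_P)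
  case Nil
  have "word_class letters rules [] = \<one>\<^bsub>P\<^esub>" by (simp add: amalg_def one_presented_monoid)
  then show ?case using form_value_closed[OF assms(1)] by simp
next
  interpret P: group P by (rule group_P)
  case (snoc x w)
  then have xw: "x \<in> letters" "w \<in> lists letters" by auto
  have c: "form_value \<omega> \<in> carrier P" "word_class letters rules w \<in> carrier P"
     "word_class letters rules [x] \<in> carrier P"
    using form_value_closed[OF assms(1)] xw by (auto simp: carrier_P)
  show ?case
    using form_value_act[OF run_closed[OF assms(1) xw(2)] xw(1)] snoc xw mult_class[of w "[x]"] c
    by (simp add: P.m_assoc)
qed

text \<open>Running a word multiplies the value of a form by the element that the word represents,
  and the trivial form has value \<open>\<one>\<close>. Injectivity of \<open>nf\<close> is a
  consequence.\<close>

lemma form_value_nf: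
  assumes "x \<in> carrier P"
  shows "form_value (nf x) = x"
proof -
  interpret P: group P by (rule group_P)
  obtain w where w: "w \<in> lists letters" "x = word_class letters rules w"
    using assms by (auto simp: carrier_P)
  have "form_value ([], \<one>\<^bsub>C\<^esub>) = \<one>\<^bsub>P\<^esub>"
    using hom_one[OF d_hom(1) C.is_group G1.is_group] hom_one[OF in_hom(1) G1.is_group group_P]
    by (simp add: form_value_def syllable_value_def)
  then show ?thesis
    using form_value_run[OF initial_form w(1)] assms w by (simp add: nf_class)
qed

lemma nf_mult:
  assumes "x \<in> carrier P" "y \<in> letters"
  shows "nf (x \<otimes>\<^bsub>P\<^esub> word_class letters rules [y]) = letter_act (nf x) y"
proof -
  obtain w where w: "w \<in> lists letters" "x = word_class letters rules w"
    using assms by (auto simp: carrier_P)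
  then have "nf (x \<otimes>\<^bsub>P\<^esub> word_class letters rules [y]) = nf (word_class letters rules (w @ [y]))"
    using mult_class[of w "[y]"] assms by simp
  then show ?thesis using w assms by (simp add: nf_class)
qed

lemma nf_in:
  assumes "x \<in> carrier P"
  shows "nf x \<in> forms"
proof -
  obtain w where w: "w \<in> lists letters" "x = word_class letters rules w"
    using assms by (auto simp: carrier_P)
  then show ?thesis using run_closed[OF initial_form w(1)] by (simp only: nf_class)
qed

lemma nf_one: "nf \<one>\<^bsub>P\<^esub> = ([], \<one>\<^bsub>C\<^esub>)"
  using nf_class[of "[]"] by (simp add: amalg_def one_presented_monoid)

sublocale side1: amalgam_nf P G1 G2 C d1 d2 Inl Inr alternating in1 in2 nf
proof (intro amalgam_nf.intro amalgam_nf_axioms.intro)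
  show "inj_on nf (carrier P)" by (rule inj_on_inverseI) (rule form_value_nf)
  show "nf (x \<otimes>\<^bsub>P\<^esub> in1 a) = F1.act (nf x) a" if "x \<in> carrier P" "a \<in> carrier G1" for x a
    using nf_mult[of x "Inl a"] that by (simp add: amalg_in1_def letter_act_def InlI)
  show "nf (x \<otimes>\<^bsub>P\<^esub> in2 b) = F2.act (nf x) b" if "x \<in> carrier P" "b \<in> carrier G2" for x b
    using nf_mult[of x "Inr b"] that by (simp add: amalg_in2_def letter_act_def InrI)
qed (use in_hom nf_one nf_in group_P in \<open>simp_all add: F1.nf_factor_axioms F2.nf_factor_axioms\<close>)

text \<open>The definition of \<open>starts_in\<close> singles out the first factor; exchanging the
  roles provides the half tree of the other factor on the same normal forms.\<close>

sublocale side2: amalgam_nf P G2 G1 C d2 d1 Inr Inl alternating in2 in1 nf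
  using side1.nf_inj side1.nf_mult1 side1.nf_mult2 in_hom nf_one nf_in group_P
  by (intro amalgam_nf.intro amalgam_nf_axioms.intro)
    (simp_all add: F1.nf_factor_axioms F2.nf_factor_axioms)

end


section \<open>Separation by the edge groups\<close>

context group begin

lemma generate_right_induct [consumes 2, case_names one mult]:
  assumes x: "x \<in> generate G S" and S: "S \<subseteq> carrier G"
    and one: "P \<one>"
    and mult: "\<And>y s. y \<in> carrier G \<Longrightarrow> P y \<Longrightarrow> s \<in> S \<or> inv s \<in> S \<and> s \<in> carrier G \<Longrightarrow> P (y \<otimes> s)"
  shows "P x"
proof -
  \<comment> \<open>The rule for \<open>generate\<close> multiplies two arbitrary members.
    Quantifying over the starting point \<open>y\<close> turns this into concatenation of paths,
    which is what induction letter by letter needs.\<close>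
  have "\<forall>y\<in>carrier G. P y \<longrightarrow> P (y \<otimes> x)"
    using x
  proof induction
    case one
    then show ?case by simp
  next
    case (incl h)
    then show ?case using mult by blast
  next
    case (inv h)
    then have "inv (inv h) \<in> S" "inv h \<in> carrier G" using S by auto
    then show ?case using mult by blast
  next
    case (eng h1 h2)
    then have "h1 \<in> carrier G" "h2 \<in> carrier G" using generate_in_carrier[OF S] by auto
    then show ?case using eng by (simp add: m_assoc[symmetric])
  qed
  then have "P (\<one> \<otimes> x)" using one one_closed by blast
  then show ?thesis unfolding l_one[OF generate_in_carrier[OF S x]] .
qed

lemma mult_in_left_iff:
  assumes "subgroup H G" "x \<in> carrier G" "y \<in> carrier G" "y \<in> H"
  shows "x \<otimes> y \<in> H \<longleftrightarrow> x \<in> H"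
proof
  assume "x \<otimes> y \<in> H"
  then have "(x \<otimes> y) \<otimes> inv y \<in> H"
    using assms by (metis subgroup.m_closed subgroup.m_inv_closed)
  moreover have "(x \<otimes> y) \<otimes> inv y = x" using assms by (simp add: m_assoc)
  ultimately show "x \<in> H" by metis
qed (use assms in \<open>auto intro: subgroup.m_closed\<close>)

lemma mult_in_right_iff:
  assumes "subgroup H G" "x \<in> carrier G" "y \<in> carrier G" "x \<in> H"
  shows "x \<otimes> y \<in> H \<longleftrightarrow> y \<in> H"
proof
  assume "x \<otimes> y \<in> H"
  then have "inv x \<otimes> (x \<otimes> y) \<in> H"
    using assms by (metis subgroup.m_closed subgroup.m_inv_closed)
  moreover have "inv x \<otimes> (x \<otimes> y) = y" using assms by (simp add: m_assoc[symmetric])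
  ultimately show "y \<in> H" by metis
qed (use assms in \<open>auto intro: subgroup.m_closed\<close>)

end

text \<open>
  The splitting \<open>G = A\<^sub>1 *\<^bsub>B\<^sub>1\<^esub> K *\<^bsub>B\<^sub>2\<^esub> A\<^sub>2\<close> seen from the Cayley graph: deleting the subset \<open>B i\<close>
  separates \<open>N i\<close>, the side of \<open>A i\<close>, from \<open>M i\<close>, the side of \<open>K\<close>.
\<close>

locale tree_split = group G for G (structure) +
  fixes A B N :: "bool \<Rightarrow> 'a set"
  assumes A: "subgroup (A i) G" and B: "subgroup (B i) G" and B_A: "B i \<subseteq> A i"
    and A_inter: "A i \<inter> A (\<not> i) \<subseteq> B i"
    and gen: "generate G (A True \<union> A False) = carrier G"
    and N_carrier: "N i \<subseteq> carrier G"
    and N_step: "x \<in> N i \<Longrightarrow> s \<in> A j \<Longrightarrow> x \<otimes> s \<in> N i \<union> B i"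
    and N_leave: "x \<in> B i \<Longrightarrow> s \<in> A j \<Longrightarrow> x \<otimes> s \<in> N i \<longleftrightarrow> s \<in> A i - B i"
begin

definition K :: "'a set" where
  "K = generate G (B True \<union> B False)"

text \<open>Everything beyond \<open>B i\<close> as seen from \<open>A i\<close>. It contains
  \<open>K - B i\<close> and also \<open>A (\<not> i) - B i\<close>, so the far side is not the side
  of \<open>K\<close> alone.\<close>

definition M :: "bool \<Rightarrow> 'a set" where
  "M i = carrier G - (N i \<union> B i)"

lemma A_carrier: "A i \<subseteq> carrier G" and B_carrier: "B i \<subseteq> carrier G"
  using A B by (auto dest: subgroup.subset)

lemma A_inv_iff: "s \<in> carrier G \<Longrightarrow> inv s \<in> A i \<longleftrightarrow> s \<in> A i"
  and B_inv_iff: "s \<in> carrier G \<Longrightarrow> inv s \<in> B i \<longleftrightarrow> s \<in> B i"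
  using subgroup.m_inv_closed[OF A] subgroup.m_inv_closed[OF B] inv_inv by metis+

lemma A_inter': "x \<in> A i \<Longrightarrow> x \<in> A j \<Longrightarrow> i \<noteq> j \<Longrightarrow> x \<in> B i"
  using A_inter[of i] by (cases i; cases j) auto

lemma K_subgroup: "subgroup K G"
  unfolding K_def using B_carrier by (intro generate_is_subgroup) auto

lemma K_carrier: "K \<subseteq> carrier G"
  using K_subgroup by (auto dest: subgroup.subset)

lemma B_K: "B i \<subseteq> K"
  unfolding K_def using generate.incl[of _ "B True \<union> B False" G] by (cases i) auto

lemma gen_induct [consumes 1, case_names one mult]:
  assumes x: "x \<in> carrier G" and one: "P \<one>"
    and mult: "\<And>y s j. y \<in> carrier G \<Longrightarrow> P y \<Longrightarrow> s \<in> A j \<Longrightarrow> P (y \<otimes> s)"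
  shows "P x"
proof -
  have "x \<in> generate G (A True \<union> A False)" using x gen by simp
  moreover have "A True \<union> A False \<subseteq> carrier G" using A_carrier by auto
  ultimately show ?thesis
  proof (induction rule: generate_right_induct)
    case (mult y s)
    then show ?case using assms(3)[of y s] A_inv_iff[of s] by blast
  qed (rule one)
qed

lemma K_induct [consumes 1, case_names one mult]:
  assumes x: "x \<in> K" and one: "P \<one>"
    and mult: "\<And>y s j. y \<in> carrier G \<Longrightarrow> P y \<Longrightarrow> s \<in> B j \<Longrightarrow> P (y \<otimes> s)"
  shows "P x"
proof -
  have "x \<in> generate G (B True \<union> B False)" using x K_def by simp
  moreover have "B True \<union> B False \<subseteq> carrier G" using B_carrier by auto
  ultimately show ?thesis
  proof (induction rule: generate_right_induct)
    case (mult y s)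
    then show ?case using assms(3)[of y s] B_inv_iff[of s] by blast
  qed (rule one)
qed

lemma N_not_B: "x \<in> N i \<Longrightarrow> x \<notin> B i"
  using N_leave[of x i \<one> i] subgroup.one_closed[OF A] subgroup.one_closed[OF B] N_carrier by force

lemma back_step: "y \<in> carrier G \<Longrightarrow> s \<in> A j \<Longrightarrow> y \<otimes> s \<in> N i \<Longrightarrow> y \<in> N i \<union> B i"
  using N_step[of "y \<otimes> s" i "inv s" j] A_carrier[of j] subgroup.m_inv_closed[OF A, of s j]
  by (auto simp: m_assoc)

text \<open>A path with letters in the groups \<open>B j\<close> would have to enter
  \<open>N i\<close> from \<open>B i\<close> along a letter of \<open>A i - B i\<close>. No
  \<open>B j\<close> contains such a letter, since \<open>A i \<inter> A j \<subseteq> B i\<close>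
  for \<open>j \<noteq> i\<close>.\<close>

lemma N_not_K: "x \<in> N i \<Longrightarrow> x \<notin> K"
proof
  assume "x \<in> K" "x \<in> N i"
  have "x \<notin> N i" using \<open>x \<in> K\<close>
  proof (induction rule: K_induct)
    case one
    then show ?case using N_not_B subgroup.one_closed[OF B] by blast
  next
    case (mult y s j)
    show ?case
    proof
      assume ys: "y \<otimes> s \<in> N i"
      have s: "s \<in> A j" using mult B_A by blast
      then have "y \<in> B i" using back_step[OF mult.hyps(1) s ys] mult by blast
      then have "s \<in> A i - B i" using N_leave s ys by blast
      then show False using mult s A_inter' by blast
    qed
  qed
  then show False using \<open>x \<in> N i\<close> by blast
qed

lemma A_N_iff: "a \<in> A j \<Longrightarrow> a \<in> N i \<longleftrightarrow> a \<in> A i - B i"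
  using N_leave[OF subgroup.one_closed[OF B], of a j i] A_carrier[of j] l_one[of a] by auto

text \<open>Elements of \<open>A i - B i\<close> lie in \<open>N i\<close>, which misses
  \<open>K\<close>. Thus forming \<open>\<langle>K1, K2\<rangle>\<close> adds no element of a factor
  to its edge group.\<close>

lemma A_K: "a \<in> A i \<Longrightarrow> a \<in> K \<longleftrightarrow> a \<in> B i"
  using A_N_iff[of a i i] N_not_K B_K by blast

text \<open>A letter of \<open>K\<close> is itself a path of letters from the groups
  \<open>B j\<close>. Were this path to touch \<open>B i\<close>, then \<open>x\<close> would be a
  quotient of elements of \<open>K\<close>.\<close>

lemma N_step_K:
  assumes x: "x \<in> N i" and k: "k \<in> K"
  shows "x \<otimes> k \<in> N i"
  using k
proof (induction rule: K_induct)
  case one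
  have "x \<in> carrier G" using x N_carrier by blast
  then show ?case using x by simp
next
  case (mult y s j)
  have xc: "x \<in> carrier G" using x N_carrier by blast
  have "s \<in> A j" "s \<in> carrier G" "s \<in> K" using mult B_A B_carrier B_K by blast+
  then have "(x \<otimes> y) \<otimes> s \<in> N i \<union> B i" using mult N_step by blast
  moreover have "(x \<otimes> y) \<otimes> s \<notin> B i"
    using N_not_K[of "x \<otimes> y" i] mult \<open>s \<in> K\<close> \<open>s \<in> carrier G\<close> xc B_K[of i]
      mult_in_left_iff[OF K_subgroup, of "x \<otimes> y" s] by auto
  ultimately show ?case using mult xc \<open>s \<in> carrier G\<close> by (simp add: m_assoc)
qed

lemma step: "x \<in> N i \<Longrightarrow> s \<in> A j \<union> K \<Longrightarrow> x \<otimes> s \<in> N i \<union> B i"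
  using N_step N_step_K by blast

lemma step_carrier: "s \<in> A j \<union> K \<Longrightarrow> s \<in> carrier G"
  using A_carrier K_carrier by auto

lemma M_carrier: "M i \<subseteq> carrier G"
  by (auto simp: M_def)

lemma M_step: "x \<in> M i \<Longrightarrow> s \<in> A j \<union> K \<Longrightarrow> x \<otimes> s \<in> M i \<union> B i"
proof -
  assume x: "x \<in> M i" and s: "s \<in> A j \<union> K"
  have c: "x \<in> carrier G" "s \<in> carrier G" using x s step_carrier M_carrier by blast+
  have "inv s \<in> A j \<union> K"
    using s subgroup.m_inv_closed[OF A] subgroup.m_inv_closed[OF K_subgroup] by blast
  then have "x \<otimes> s \<notin> N i" using step[of "x \<otimes> s" i "inv s" j] x c by (auto simp: m_assoc M_def)
  then show ?thesis using c by (auto simp: M_def)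
qed

lemma M_outside_A: "s \<in> A j \<union> K \<Longrightarrow> s \<notin> A i \<Longrightarrow> s \<in> M i"
  using A_N_iff[of s j i] N_not_K[of s i] B_A step_carrier by (auto simp: M_def)

text \<open>The ping-pong step. Along every path the alternative \<open>x \<in> N i\<close> or
  \<open>g \<otimes> x \<in> N i\<close> persists: a point can leave \<open>N i\<close> only into
  \<open>B i\<close>, and at that moment the other point is in \<open>A i - B i\<close>, hence in
  \<open>N i\<close>.\<close>

lemma N_mult_A:
  assumes "g \<in> A i - B i" "x \<in> M i"
  shows "g \<otimes> x \<in> N i"
proof -
  have gc: "g \<in> carrier G" and xc: "x \<in> carrier G" using assms A_carrier M_carrier by blast+
  from xc have "x \<in> N i \<or> g \<otimes> x \<in> N i"
  proof (induction rule: gen_induct)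
    case one
    then show ?case using assms(1) gc A_N_iff[of g i i] by simp
  next
    case (mult y s j)
    have sc: "s \<in> carrier G" using mult A_carrier by blast
    have *: "g \<otimes> y \<otimes> s = g \<otimes> (y \<otimes> s)" using gc sc mult by (simp add: m_assoc)
    have inA: "y \<otimes> s \<in> A i - B i" if "g \<otimes> (y \<otimes> s) \<in> B i"
      using that assms(1) B_A[of i] mult_in_right_iff[OF A, of g "y \<otimes> s" i]
        mult_in_left_iff[OF B, of g "y \<otimes> s" i] gc sc mult by auto
    have inA': "g \<otimes> (y \<otimes> s) \<in> A i - B i" if "y \<otimes> s \<in> B i"
      using that assms(1) B_A[of i] subgroup.m_closed[OF A, of g i "y \<otimes> s"]
        mult_in_left_iff[OF B, of g "y \<otimes> s" i] gc sc mult by auto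
    from mult.IH show ?case
    proof
      assume "y \<in> N i"
      then have "y \<otimes> s \<in> N i \<union> B i" using N_step mult by blast
      then show ?case using inA' A_N_iff by blast
    next
      assume "g \<otimes> y \<in> N i"
      then have "g \<otimes> (y \<otimes> s) \<in> N i \<union> B i" using N_step mult * by metis
      then show ?case using inA A_N_iff by blast
    qed
  qed
  then show ?thesis using assms(2) by (simp add: M_def)
qed

text \<open>Take \<open>a\<close> where a path from \<open>\<one>\<close> to \<open>x\<close> leaves
  \<open>A i\<close> for the last time. From there on it stays in the translate of
  \<open>M i\<close> by \<open>a\<close>, whose only exit is a coset of \<open>B i\<close> inside
  \<open>A i\<close>.\<close>

lemma branch_A:
  assumes "x \<in> carrier G" "x \<notin> A i"
  shows "\<exists>a\<in>A i. inv a \<otimes> x \<in> M i"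
proof -
  from assms(1) have "x \<in> A i \<or> (\<exists>a\<in>A i. inv a \<otimes> x \<in> M i)"
  proof (induction rule: gen_induct)
    case one
    then show ?case using subgroup.one_closed[OF A] by blast
  next
    case (mult y s j)
    have sc: "s \<in> carrier G" using mult A_carrier by blast
    show ?case
    proof (cases "y \<in> A i")
      case True
      have "inv y \<otimes> (y \<otimes> s) = s" using mult sc by (simp add: m_assoc[symmetric])
      then have "inv y \<otimes> (y \<otimes> s) \<in> M i" if "s \<notin> A i" using M_outside_A[of s j i] that mult by simp
      then show ?thesis
        using True mult_in_right_iff[OF A _ sc True] mult by blast
    next
      case False
      then obtain a where a: "a \<in> A i" "inv a \<otimes> y \<in> M i" using mult by blast
      then have ac: "a \<in> carrier G" using A_carrier by blast
      have "inv a \<otimes> (y \<otimes> s) \<in> M i \<union> B i"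
        using M_step[OF a(2), of s j] mult sc ac by (simp add: m_assoc)
      moreover have "y \<otimes> s \<in> A i" if "inv a \<otimes> (y \<otimes> s) \<in> B i"
        using that B_A[of i] a subgroup.m_inv_closed[OF A a(1)] mult sc ac
          mult_in_right_iff[OF A, of "inv a" "y \<otimes> s" i] by auto
      ultimately show ?thesis using a by blast
    qed
  qed
  then show ?thesis using assms(2) by blast
qed

text \<open>Follow a path to \<open>x\<close> together with its translate by \<open>k\<close>. Both
  leave \<open>K\<close> at the same step and by the same letter. This letter lies in
  \<open>A i - B i\<close> and in \<open>A j - B j\<close>, which forces \<open>i = j\<close>; the
  two exit points in \<open>B i\<close> then give \<open>k \<in> B i\<close>.\<close>

lemma K_mult_N:
  assumes "x \<in> N i" "k \<in> K" "k \<otimes> x \<in> N j"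
  shows "i = j \<and> k \<in> B i"
proof -
  have xc: "x \<in> carrier G" and kc: "k \<in> carrier G" using assms N_carrier K_carrier by blast+
  from xc have "x \<in> N i \<longrightarrow> k \<otimes> x \<in> N j \<longrightarrow> i = j \<and> k \<in> B i"
  proof (induction rule: gen_induct)
    case one
    then show ?case using N_not_B subgroup.one_closed[OF B] by blast
  next
    case (mult y s l)
    have sc: "s \<in> carrier G" using mult A_carrier by blast
    show ?case
    proof (intro impI)
      assume 1: "y \<otimes> s \<in> N i" and 2: "k \<otimes> (y \<otimes> s) \<in> N j"
      then have 2: "(k \<otimes> y) \<otimes> s \<in> N j" using mult sc kc by (simp add: m_assoc)
      have y: "y \<in> N i \<union> B i" using back_step[OF mult.hyps 1] .
      have ky: "k \<otimes> y \<in> N j \<union> B j" using back_step[OF _ mult.hyps(2) 2] mult kc by simp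
      have iff: "k \<otimes> y \<in> K \<longleftrightarrow> y \<in> K"
        using mult_in_right_iff[OF K_subgroup kc mult.hyps(1) assms(2)] .
      show "i = j \<and> k \<in> B i"
      proof (cases "y \<in> N i")
        case True
        then have "k \<otimes> y \<in> N j" using ky iff N_not_K B_K by blast
        then show ?thesis using True mult.IH by blast
      next
        case False
        then have yB: "y \<in> B i" using y by blast
        then have kyB: "k \<otimes> y \<in> B j" using ky iff N_not_K B_K by blast
        have "s \<in> A i - B i" using N_leave[OF yB mult.hyps(2)] 1 by blast
        moreover have "s \<in> A j - B j" using N_leave[OF kyB mult.hyps(2)] 2 by blast
        ultimately have "i = j" using A_inter' by blast
        then show ?thesis using mult_in_left_iff[OF B kc mult.hyps(1) yB] kyB by blast
      qed
    qed
  qed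
  then show ?thesis using assms by blast
qed

text \<open>Conjugating \<open>g\<close> into the frame of a gate \<open>a\<close> of
  \<open>x\<close> gives \<open>h\<close> with \<open>h \<otimes> (inv a \<otimes> x) = (inv a
  \<otimes> x) \<otimes> q\<close>. The right side is a single letter away from \<open>M i\<close>
  and so not in \<open>N i\<close>; ping-pong would put it there if \<open>h\<close> were outside
  \<open>B i\<close>.\<close>

lemma conj_into_A:
  assumes g: "g \<in> A i" and x: "x \<in> carrier G" and q: "q \<in> A j \<union> K"
    and eq: "g = x \<otimes> q \<otimes> inv x" and out: "x \<notin> A i"
  shows "\<exists>b\<in>B i. \<exists>a\<in>A i. g = a \<otimes> b \<otimes> inv a"
proof -
  obtain a where a: "a \<in> A i" "inv a \<otimes> x \<in> M i" using branch_A[OF x out] by blast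
  have c: "a \<in> carrier G" "g \<in> carrier G" "q \<in> carrier G" using a g q A_carrier step_carrier by blast+
  let ?h = "inv a \<otimes> g \<otimes> a"
  have h: "?h \<in> A i" using a g by (meson A subgroup.m_closed subgroup.m_inv_closed)
  have "g \<otimes> x = x \<otimes> q" using eq x c by (simp add: m_assoc)
  then have "?h \<otimes> (inv a \<otimes> x) = (inv a \<otimes> x) \<otimes> q"
    using x c by (simp add: m_assoc inv_solve_left) (simp add: m_assoc[symmetric])
  moreover have "(inv a \<otimes> x) \<otimes> q \<notin> N i" using M_step[OF a(2) q] N_not_B by (auto simp: M_def)
  ultimately have "?h \<in> B i" using N_mult_A[OF _ a(2), of ?h] h by auto
  moreover have "g = a \<otimes> ?h \<otimes> inv a"
    using c by (simp add: m_assoc) (simp add: m_assoc[symmetric])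
  ultimately show ?thesis using a by blast
qed

lemma conj_into_factor_iff:
  fixes G0 :: "('h, 'n) monoid_scheme" and \<iota> :: "'h \<Rightarrow> 'a"
  assumes G0: "group G0" and \<iota>: "\<iota> \<in> hom G0 G" and inj: "inj_on \<iota> (carrier G0)"
    and A_eq: "\<iota> ` carrier G0 = A i" and B_eq: "\<iota> ` K0 = B i"
    and sub: "\<And>H. H \<in> insert K0 \<H>0 \<Longrightarrow> H \<subseteq> carrier G0"
    and \<H>: "\<And>H. H \<in> \<H>' \<Longrightarrow> H \<subseteq> A (\<not> i)"
    and g: "g \<in> carrier G0"
  shows "conj_into G0 (\<H>0 \<union> {K0}) g \<longleftrightarrow> conj_into G ((`) \<iota> ` \<H>0 \<union> \<H>' \<union> {K}) (\<iota> g)"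
proof -
  interpret G0: group G0 by fact
  interpret \<iota>: group_hom G0 G \<iota> by unfold_locales (rule \<iota>)
  show ?thesis
  proof
    assume "conj_into G0 (\<H>0 \<union> {K0}) g"
    then obtain Q q x where Q: "Q \<in> \<H>0 \<union> {K0}" "q \<in> Q" "x \<in> carrier G0" "g = x \<otimes>\<^bsub>G0\<^esub> q \<otimes>\<^bsub>G0\<^esub> inv\<^bsub>G0\<^esub> x"
      unfolding conj_into_def by blast
    then have "q \<in> carrier G0" using sub[of Q] by blast
    then have "\<iota> g = \<iota> x \<otimes> \<iota> q \<otimes> inv (\<iota> x)" "\<iota> x \<in> carrier G" using Q by auto
    moreover have "\<exists>Q'\<in>(`) \<iota> ` \<H>0 \<union> \<H>' \<union> {K}. \<iota> q \<in> Q'"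
      using Q B_eq B_K[of i] by blast
    ultimately show "conj_into G ((`) \<iota> ` \<H>0 \<union> \<H>' \<union> {K}) (\<iota> g)"
      unfolding conj_into_def by blast
  next
    assume "conj_into G ((`) \<iota> ` \<H>0 \<union> \<H>' \<union> {K}) (\<iota> g)"
    then obtain Q q x where Q: "Q \<in> (`) \<iota> ` \<H>0 \<union> \<H>' \<union> {K}" "q \<in> Q" and x: "x \<in> carrier G"
      and eq: "\<iota> g = x \<otimes> q \<otimes> inv x"
      unfolding conj_into_def by blast
    have gA: "\<iota> g \<in> A i" using g A_eq by blast
    have *: "conj_into G0 (\<H>0 \<union> {K0}) g"
      if "Q' \<in> \<H>0 \<union> {K0}" "q' \<in> Q'" "x' \<in> carrier G0" "\<iota> g = \<iota> x' \<otimes> \<iota> q' \<otimes> inv (\<iota> x')" for Q' q' x'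
    proof -
      have q': "q' \<in> carrier G0" using that sub[of Q'] by blast
      then have "\<iota> g = \<iota> (x' \<otimes>\<^bsub>G0\<^esub> q' \<otimes>\<^bsub>G0\<^esub> inv\<^bsub>G0\<^esub> x')" using that by simp
      then have "g = x' \<otimes>\<^bsub>G0\<^esub> q' \<otimes>\<^bsub>G0\<^esub> inv\<^bsub>G0\<^esub> x'"
        using inj_onD[OF inj _ g] g that(3) q' by auto
      then show ?thesis using that unfolding conj_into_def by blast
    qed
    have Q_or: "Q \<in> (`) \<iota> ` \<H>0 \<or> Q \<subseteq> A (\<not> i) \<or> Q = K" using Q \<H> by blast
    then have q: "q \<in> A i \<union> (A (\<not> i) \<union> K)"
      using Q(2) A_eq sub by blast
    show "conj_into G0 (\<H>0 \<union> {K0}) g"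
    proof (cases "x \<in> A i")
      case False
      have "\<exists>b\<in>B i. \<exists>a\<in>A i. \<iota> g = a \<otimes> b \<otimes> inv a"
        using q conj_into_A[OF gA x _ eq False] by blast
      then obtain k a where "k \<in> K0" "a \<in> carrier G0" "\<iota> g = \<iota> a \<otimes> \<iota> k \<otimes> inv (\<iota> a)"
        unfolding A_eq[symmetric] B_eq[symmetric] by blast
      then show ?thesis using *[of K0 k a] by blast
    next
      case True
      then obtain x0 where x0: "x0 \<in> carrier G0" "x = \<iota> x0" using A_eq by blast
      have qc: "q \<in> carrier G" using q step_carrier by blast
      have "q = inv x \<otimes> \<iota> g \<otimes> x"
        using eq x qc by (simp add: m_assoc) (simp add: m_assoc[symmetric])
      then have qA: "q \<in> A i" using True gA by (metis A subgroup.m_closed subgroup.m_inv_closed)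
      show ?thesis
      proof (cases "Q \<in> (`) \<iota> ` \<H>0")
        case True
        then obtain H h where "H \<in> \<H>0" "h \<in> H" "q = \<iota> h" using Q(2) by blast
        then show ?thesis using *[of H h x0] x0 eq by blast
      next
        case False
        \<comment> \<open>Here \<open>Q\<close> is \<open>K\<close> or lies in the other factor, and
          both meet \<open>A i\<close> inside \<open>B i\<close>.\<close>
        then have "q \<in> B i" using Q_or Q(2) qA A_K[OF qA] A_inter by blast
        then obtain k where "k \<in> K0" "q = \<iota> k" unfolding B_eq[symmetric] by blast
        then show ?thesis using *[of K0 k x0] x0 eq by blast
      qed
    qed
  qed
qed

end


section \<open>Relative Dehn functions\<close>

definition area_le :: "('a, 'm) monoid_scheme \<Rightarrow> 'a set \<Rightarrow> 'a \<Rightarrow> nat \<Rightarrow> bool" where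
  "area_le F R x m \<longleftrightarrow>
    (\<exists>ps\<in>lists (carrier F \<times> (R \<union> m_inv F ` R)). length ps \<le> m \<and> x = conj_prod F ps)"

lemma area_le_one: "area_le F R \<one>\<^bsub>F\<^esub> m"
  unfolding area_le_def by (intro bexI[of _ "[]"]) (auto simp: conj_prod_def)

lemma area_le_mono: "area_le F R x m \<Longrightarrow> R \<subseteq> R' \<Longrightarrow> m \<le> m' \<Longrightarrow> area_le F R' x m'"
  unfolding area_le_def
  using lists_mono[of "carrier F \<times> (R \<union> m_inv F ` R)" "carrier F \<times> (R' \<union> m_inv F ` R')"]
  by (blast intro: order_trans)

context group begin

lemma conj_prod_closed:
  assumes "R \<subseteq> carrier G" "ps \<in> lists (carrier G \<times> (R \<union> m_inv G ` R))"
  shows "conj_prod G ps \<in> carrier G"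
  using assms(2)
proof (induction ps)
  case (Cons p ps)
  then show ?case using assms(1) by (cases p) (auto simp: conj_prod_def)
qed (simp add: conj_prod_def)

lemma conj_prod_append:
  assumes "R \<subseteq> carrier G" "ps \<in> lists (carrier G \<times> (R \<union> m_inv G ` R))"
    and "qs \<in> lists (carrier G \<times> (R \<union> m_inv G ` R))"
  shows "conj_prod G (ps @ qs) = conj_prod G ps \<otimes> conj_prod G qs"
  using assms(2)
proof (induction ps)
  case Nil
  then show ?case using conj_prod_closed[OF assms(1,3)] by (simp add: conj_prod_def)
next
  case (Cons p ps)
  have "conj_prod G ps \<in> carrier G" "conj_prod G qs \<in> carrier G"
    using conj_prod_closed[OF assms(1)] Cons assms(3) by auto
  then show ?case using Cons assms(1) by (cases p) (auto simp: conj_prod_def m_assoc)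
qed

lemma area_le_mult:
  assumes "R \<subseteq> carrier G" "area_le G R x m" "area_le G R y n"
  shows "area_le G R (x \<otimes> y) (m + n)"
proof -
  obtain ps qs where ps: "ps \<in> lists (carrier G \<times> (R \<union> m_inv G ` R))" "length ps \<le> m" "x = conj_prod G ps"
    and qs: "qs \<in> lists (carrier G \<times> (R \<union> m_inv G ` R))" "length qs \<le> n" "y = conj_prod G qs"
    using assms(2,3) unfolding area_le_def by blast
  show ?thesis unfolding area_le_def
    using ps qs conj_prod_append[OF assms(1) ps(1) qs(1)] by (intro bexI[of _ "ps @ qs"]) auto
qed

text \<open>A product is conjugated factor by factor and \<open>f\<close> is absorbed into every
  conjugator, so the number of relators does not grow.\<close>

lemma area_le_conj:
  assumes "R \<subseteq> carrier G" "area_le G R x m" and f: "f \<in> carrier G"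
  shows "area_le G R (inv f \<otimes> x \<otimes> f) m"
proof -
  obtain ps where ps: "ps \<in> lists (carrier G \<times> (R \<union> m_inv G ` R))" "length ps \<le> m" "x = conj_prod G ps"
    using assms(2) unfolding area_le_def by blast
  let ?qs = "map (\<lambda>(g, r). (g \<otimes> f, r)) ps"
  have "conj_prod G ?qs = inv f \<otimes> conj_prod G ps \<otimes> f" using ps(1)
  proof (induction ps)
    case Nil
    then show ?case using f by (simp add: conj_prod_def)
  next
    case (Cons p ps)
    obtain g r where p: "p = (g, r)" by (cases p)
    have c: "g \<in> carrier G" "r \<in> carrier G" "conj_prod G ps \<in> carrier G"
      using conj_prod_closed[OF assms(1)] Cons p assms(1) by auto
    define z where "z = conj_prod G ps"
    have "conj_prod G (map (\<lambda>(g, r). (g \<otimes> f, r)) (p # ps)) =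
      (inv (g \<otimes> f) \<otimes> r \<otimes> (g \<otimes> f)) \<otimes> (inv f \<otimes> z \<otimes> f)"
      using Cons p by (simp add: conj_prod_def z_def)
    also have "\<dots> = inv f \<otimes> ((inv g \<otimes> r \<otimes> g) \<otimes> z) \<otimes> f"
    proof -
      have "f \<otimes> (inv f \<otimes> (z \<otimes> f)) = z \<otimes> f"
        using c f by (simp add: m_assoc[symmetric] z_def)
      then show ?thesis using c f by (simp add: inv_mult_group m_assoc z_def)
    qed
    finally show ?case using p by (simp add: conj_prod_def z_def)
  qed
  moreover have "?qs \<in> lists (carrier G \<times> (R \<union> m_inv G ` R))"
    using ps(1) f by fastforce
  ultimately show ?thesis unfolding area_le_def
    using ps by (intro bexI[of _ ?qs]) auto
qed

lemma area_le_normal_closure: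
  assumes R: "R \<subseteq> carrier G" and "area_le G R x m"
  shows "x \<in> normal_closure G R"
proof -
  let ?S = "{inv f \<otimes> r \<otimes> f | f r. f \<in> carrier G \<and> r \<in> R}"
  have S: "?S \<subseteq> carrier G" using R by auto
  have *: "inv f \<otimes> r \<otimes> f \<in> generate G ?S" if f: "f \<in> carrier G" and r: "r \<in> R \<union> m_inv G ` R" for f r
  proof (cases "r \<in> R")
    case True
    then show ?thesis using f by (intro generate.incl) blast
  next
    case False
    then obtain r' where r': "r' \<in> R" "r = inv r'" using r by blast
    then have c: "r' \<in> carrier G" using R by blast
    have "inv (inv f \<otimes> r' \<otimes> f) \<in> generate G ?S" using f r' by (intro generate.inv) blast
    then show ?thesis using f c r' by (simp add: inv_mult_group m_assoc)
  qed
  obtain ps where ps: "ps \<in> lists (carrier G \<times> (R \<union> m_inv G ` R))" "x = conj_prod G ps"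
    using assms(2) unfolding area_le_def by blast
  have "conj_prod G ps \<in> generate G ?S" using ps(1)
  proof (induction ps)
    case Nil
    then show ?case by (simp add: conj_prod_def generate.one)
  next
    case (Cons p ps)
    obtain f r where p: "p = (f, r)" by (cases p)
    then have "inv f \<otimes> r \<otimes> f \<in> generate G ?S" using * Cons.hyps by auto
    then show ?case using generate.eng Cons.IH p by (simp add: conj_prod_def)
  qed
  then show ?thesis using ps by (simp add: normal_closure_def)
qed

end

lemma area_le_hom:
  assumes "group F" "group F'" and \<phi>: "\<phi> \<in> hom F F'"
    and R: "R \<subseteq> carrier F" and R': "\<phi> ` R \<subseteq> R'" and "area_le F R x m"
  shows "area_le F' R' (\<phi> x) m"
proof -
  interpret F: group F by fact
  interpret F': group F' by fact
  interpret \<phi>: group_hom F F' \<phi> by unfold_locales (rule \<phi>)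
  obtain ps where ps: "ps \<in> lists (carrier F \<times> (R \<union> m_inv F ` R))" "length ps \<le> m" "x = conj_prod F ps"
    using assms unfolding area_le_def by blast
  let ?qs = "map (\<lambda>(g, r). (\<phi> g, \<phi> r)) ps"
  have "conj_prod F' ?qs = \<phi> (conj_prod F ps)" using ps(1)
  proof (induction ps)
    case Nil
    then show ?case by (simp add: conj_prod_def)
  next
    case (Cons p ps)
    obtain g r where p: "p = (g, r)" by (cases p)
    have "g \<in> carrier F" "r \<in> carrier F" "conj_prod F ps \<in> carrier F"
      using F.conj_prod_closed[OF R] Cons p R by auto
    then show ?case using Cons p by (simp add: conj_prod_def)
  qed
  moreover have "?qs \<in> lists (carrier F' \<times> (R' \<union> m_inv F' ` R'))"
  proof -
    have "\<phi> r \<in> R' \<union> m_inv F' ` R'" if "r \<in> R \<union> m_inv F ` R" for r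
    proof (cases "r \<in> R")
      case False
      then obtain r' where "r' \<in> R" "r = inv\<^bsub>F\<^esub> r'" using \<open>r \<in> _\<close> by blast
      then have "\<phi> r = inv\<^bsub>F'\<^esub> \<phi> r'" using R by auto
      then show ?thesis using \<open>r' \<in> R\<close> R' by blast
    qed (use R' in blast)
    then have "(\<lambda>(g, r). (\<phi> g, \<phi> r)) ` (carrier F \<times> (R \<union> m_inv F ` R)) \<subseteq> carrier F' \<times> (R' \<union> m_inv F' ` R')"
      by auto
    then show ?thesis using ps(1) by (simp only: in_lists_conv_set set_map) blast
  qed
  ultimately show ?thesis unfolding area_le_def
    using ps by (intro bexI[of _ ?qs]) auto
qed

section \<open>Words over a relative alphabet and their areas\<close>

locale rel_words = group G for G :: "('a, 'm) monoid_scheme" (structure) +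
  fixes S :: "'a set" and \<H> :: "'a set set"
  assumes pair: "group_pair G \<H>" and S_carrier: "S \<subseteq> carrier G"
begin

abbreviation "\<A> \<equiv> rel_alphabet G S \<H>"
abbreviation "F \<equiv> rel_free G S \<H>"
abbreviation "cls \<equiv> rel_class G S \<H>"

lemma letter_val_closed: "a \<in> \<A> \<Longrightarrow> letter_val G a \<in> carrier G"
  using S_carrier subgroup.mem_carrier[of _ G] pair
  by (cases a) (auto simp: rel_alphabet_iff group_pair_def)

lemma word_val_append: "u \<in> lists \<A> \<Longrightarrow> v \<in> lists \<A> \<Longrightarrow> word_val G (u @ v) = word_val G u \<otimes> word_val G v"
  unfolding word_val_def using letter_val_closed by (intro word_eval_append(2)[of _ _ \<A>]) auto

lemma word_val_closed: "u \<in> lists \<A> \<Longrightarrow> word_val G u \<in> carrier G"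
  unfolding word_val_def using letter_val_closed by (intro word_eval_append(1)[of _ _ \<A>]) auto

lemma word_val_Nil: "word_val G [] = \<one>"
  and word_val_Cons: "word_val G (a # w) = letter_val G a \<otimes> word_val G w"
  by (simp_all add: word_val_def word_eval_def)

lemma group_F: "group F"
  by (rule group_rel_free[OF pair S_carrier])

lemma carrier_F: "carrier F = cls ` lists \<A>"
  by (simp add: rel_free_def carrier_presented_monoid rel_class_def)

lemma cls_closed: "w \<in> lists \<A> \<Longrightarrow> cls w \<in> carrier F"
  by (simp add: carrier_F)

lemma cls_append: "u \<in> lists \<A> \<Longrightarrow> v \<in> lists \<A> \<Longrightarrow> cls (u @ v) = cls u \<otimes>\<^bsub>F\<^esub> cls v"
  by (simp add: rel_free_def rel_class_def mult_presented_monoid[OF rel_rules_in_lists[OF pair S_carrier]])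

lemma cls_Nil: "cls [] = \<one>\<^bsub>F\<^esub>"
  by (simp add: rel_free_def rel_class_def one_presented_monoid)

lemma cls_cong: "(u, v) \<in> word_cong \<A> (rel_rules G S \<H>) \<Longrightarrow> cls u = cls v"
  unfolding rel_class_def word_class_def
  using equiv_class_eq[OF equiv_word_cong[OF rel_rules_in_lists[OF pair S_carrier]]] by blast

lemma cls_rule: "(u, v) \<in> rel_rules G S \<H> \<Longrightarrow> cls u = cls v"
  using word_cong.rule[of u v "rel_rules G S \<H>" "[]" \<A> "[]"] by (intro cls_cong) simp

lemma rel_eval_cls: "w \<in> lists \<A> \<Longrightarrow> rel_eval G (cls w) = word_val G w"
  by (rule rel_eval_class[OF pair S_carrier])

lemma rel_eval_hom: "rel_eval G \<in> hom F G"
proof (rule homI)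
  fix x assume "x \<in> carrier F"
  then obtain u where u: "u \<in> lists \<A>" "x = cls u" unfolding carrier_F by blast
  then show "rel_eval G x \<in> carrier G" using word_val_closed rel_eval_cls by simp
  fix y assume "y \<in> carrier F"
  then obtain v where v: "v \<in> lists \<A>" "y = cls v" unfolding carrier_F by blast
  have "u @ v \<in> lists \<A>" using u v by simp
  then show "rel_eval G (x \<otimes>\<^bsub>F\<^esub> y) = rel_eval G x \<otimes> rel_eval G y"
    unfolding u(2) v(2) cls_append[OF u(1) v(1), symmetric]
    by (simp only: rel_eval_cls u(1) v(1) word_val_append)
qed

text \<open>Finiteness of a relative Dehn function in a form that can be restricted to the words
  over a subset \<open>L\<close> of the alphabet, such as the letters of one factor.\<close>

definition bounded_area :: "'a letter list set set \<Rightarrow> 'a letter set \<Rightarrow> bool" where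
  "bounded_area R L \<longleftrightarrow> (\<forall>n. \<exists>m. \<forall>w\<in>lists L. length w \<le> n \<longrightarrow> word_val G w = \<one> \<longrightarrow>
     area_le F R (cls w) m)"

text \<open>A bound on areas yields the presentation too: it writes each element of the kernel as a
  product of conjugates of relators, so \<open>R\<close> generates the kernel normally.\<close>

lemma dehn_classI:
  assumes S: "finite S" and surj: "carrier G \<subseteq> word_val G ` lists \<A>"
    and R: "finite R" "R \<subseteq> kernel F G (rel_eval G)" and bd: "bounded_area R \<A>"
  shows "dehn_class G \<H>"
proof -
  interpret F: group F by (rule group_F)
  interpret ev: group_hom F G "rel_eval G" by unfold_locales (rule rel_eval_hom)
  have Rc: "R \<subseteq> carrier F" using R by (auto simp: kernel_def)
  have "rel_eval G ` carrier F = carrier G"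
  proof -
    have "rel_eval G ` carrier F = word_val G ` lists \<A>"
      unfolding carrier_F image_image by (rule image_cong) (simp_all only: rel_eval_cls)
    moreover have "word_val G ` lists \<A> = carrier G"
      using surj word_val_closed by (intro equalityI image_subsetI)
    ultimately show ?thesis by simp
  qed
  moreover have "normal_closure F R = kernel F G (rel_eval G)"
  proof
    have "{inv\<^bsub>F\<^esub> f \<otimes>\<^bsub>F\<^esub> r \<otimes>\<^bsub>F\<^esub> f | f r. f \<in> carrier F \<and> r \<in> R} \<subseteq> kernel F G (rel_eval G)"
    proof clarify
      fix f r assume f: "f \<in> carrier F" and r: "r \<in> R"
      then have "r \<in> carrier F" "rel_eval G r = \<one>" using R by (auto simp: kernel_def)
      then show "inv\<^bsub>F\<^esub> f \<otimes>\<^bsub>F\<^esub> r \<otimes>\<^bsub>F\<^esub> f \<in> kernel F G (rel_eval G)"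
        using f by (simp add: kernel_def)
    qed
    then show "normal_closure F R \<subseteq> kernel F G (rel_eval G)"
      unfolding normal_closure_def by (intro F.generate_subgroup_incl ev.subgroup_kernel)
    show "kernel F G (rel_eval G) \<subseteq> normal_closure F R"
    proof
      fix x assume x: "x \<in> kernel F G (rel_eval G)"
      then obtain w where w: "w \<in> lists \<A>" "x = cls w" by (auto simp: kernel_def carrier_F)
      then have "word_val G w = \<one>" using x rel_eval_cls by (simp add: kernel_def)
      then obtain m where "area_le F R (cls w) m"
        using bd w unfolding bounded_area_def by blast
      then show "x \<in> normal_closure F R"
        using F.area_le_normal_closure[OF Rc] w by blast
    qed
  qed
  ultimately have pres: "finite_rel_presentation G \<H> S R"
    using S S_carrier R Rc by (simp add: finite_rel_presentation_def)
  obtain f where f: "\<forall>n. \<forall>w\<in>lists \<A>. length w \<le> n \<longrightarrow> word_val G w = \<one> \<longrightarrow> area_le F R (cls w) (f n)"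
    using bd unfolding bounded_area_def by metis
  have "rel_isoperimetric G \<H> S R (\<lambda>n. enat (f n))"
    unfolding rel_isoperimetric_def
  proof (intro allI ballI impI)
    fix n w assume "w \<in> lists \<A>" "length w \<le> n \<and> word_val G w = \<one>"
    then have "area_le F R (cls w) (f n)" using f by blast
    then show "\<exists>ps. ps \<in> lists (carrier F \<times> (R \<union> m_inv F ` R)) \<and> cls w = conj_prod F ps \<and> enat (length ps) \<le> enat (f n)"
      unfolding area_le_def by auto
  qed
  then have "rel_dehn G \<H> S R n \<le> enat (f n)" for n
    unfolding rel_dehn_def by (intro INF_lower2[of "\<lambda>n. enat (f n)"]) auto
  then have "rel_dehn G \<H> S R n \<noteq> \<infinity>" for n
    using enat_ord_simps(5) by (metis infinity_ileE)
  then show ?thesis unfolding dehn_class_def using pair pres by blast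
qed

end

lemma dehn_classE:
  assumes "dehn_class G \<H>"
  obtains S R where "rel_words G S \<H>" "finite S" "carrier G \<subseteq> word_val G ` lists (rel_alphabet G S \<H>)"
    "finite R" "R \<subseteq> kernel (rel_free G S \<H>) G (rel_eval G)"
    "rel_words.bounded_area G S \<H> R (rel_alphabet G S \<H>)"
proof -
  obtain S R where pair: "group_pair G \<H>" and pres: "finite_rel_presentation G \<H> S R"
    and dehn: "\<And>n. rel_dehn G \<H> S R n \<noteq> \<infinity>"
    using assms unfolding dehn_class_def by blast
  have "group G" using pair by (simp add: group_pair_def)
  then interpret rel_words G S \<H>
    using pair pres by (simp add: rel_words_def rel_words_axioms_def finite_rel_presentation_def)
  interpret F: group F by (rule group_F)
  have fin: "finite S" "finite R" and Rc: "R \<subseteq> carrier F"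
    and ev: "rel_eval G ` carrier F = carrier G"
    and nc: "normal_closure F R = kernel F G (rel_eval G)"
    using pres by (auto simp: finite_rel_presentation_def)
  have "R \<subseteq> normal_closure F R"
  proof
    fix r assume r: "r \<in> R"
    then have "r = inv\<^bsub>F\<^esub> \<one>\<^bsub>F\<^esub> \<otimes>\<^bsub>F\<^esub> r \<otimes>\<^bsub>F\<^esub> \<one>\<^bsub>F\<^esub>" using Rc by auto
    then show "r \<in> normal_closure F R"
      unfolding normal_closure_def using r by (intro generate.incl) blast
  qed
  then have R: "R \<subseteq> kernel F G (rel_eval G)" using nc by simp
  have surj: "carrier G \<subseteq> word_val G ` lists \<A>"
  proof
    fix g assume "g \<in> carrier G"
    then obtain w where "w \<in> lists \<A>" "g = rel_eval G (cls w)" using ev by (auto simp: carrier_F)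
    then show "g \<in> word_val G ` lists \<A>" using rel_eval_cls by blast
  qed
  have "bounded_area R \<A>" unfolding bounded_area_def
  proof
    fix n
    \<comment> \<open>The Dehn function is a pointwise infimum in \<open>enat\<close>. A finite
      value at \<open>n\<close> provides an isoperimetric function that is finite at this
      \<open>n\<close>, with no information about other arguments.\<close>
    have "\<exists>f. rel_isoperimetric G \<H> S R f \<and> f n \<noteq> \<infinity>"
    proof (rule ccontr)
      assume *: "\<not> ?thesis"
      have "\<infinity> \<le> rel_dehn G \<H> S R n" unfolding rel_dehn_def
        by (rule INF_greatest) (use * in auto)
      then show False using dehn[of n] by simp
    qed
    then obtain f where f: "rel_isoperimetric G \<H> S R f" "f n \<noteq> \<infinity>" by blast
    then obtain m where m: "f n = enat m" by auto
    have "area_le F R (cls w) m" if w: "w \<in> lists \<A>" "length w \<le> n" "word_val G w = \<one>\<^bsub>G\<^esub>" for w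
    proof -
      obtain ps where "ps \<in> lists (carrier F \<times> (R \<union> m_inv F ` R))" "cls w = conj_prod F ps"
        "enat (length ps) \<le> f n"
        using f(1)[unfolded rel_isoperimetric_def, rule_format, OF w(1) conjI[OF w(2,3)]]
        by (elim exE conjE) (rule that)
      then show ?thesis using m unfolding area_le_def by (intro bexI[of _ ps]) simp_all
    qed
    then show "\<exists>m. \<forall>w\<in>lists \<A>. length w \<le> n \<longrightarrow> word_val G w = \<one>\<^bsub>G\<^esub> \<longrightarrow> area_le F R (cls w) m" by blast
  qed
  then show ?thesis using that rel_words_axioms fin surj R by blast
qed

section \<open>Change of alphabet along an injective homomorphism\<close>

fun letter_map :: "('a \<Rightarrow> 'b) \<Rightarrow> ('a set \<Rightarrow> 'b set) \<Rightarrow> 'a letter \<Rightarrow> 'b letter" where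
  "letter_map \<iota> f (Gen s) = Gen (\<iota> s)"
| "letter_map \<iota> f (GenInv s) = GenInv (\<iota> s)"
| "letter_map \<iota> f (Sub H h) = Sub (f H) (\<iota> h)"

text \<open>The image of a peripheral subgroup may be smaller than the target \<open>f H\<close>;
  this is how \<open>K1\<close> and \<open>K2\<close> are both sent to \<open>K\<close>. Injectivity
  of \<open>\<iota>\<close> keeps letters nontrivial and preserves the case distinction in the
  multiplication rules.\<close>

locale rel_words_map = W0: rel_words G0 S0 \<H>0 + W: rel_words G S \<H>
  for G0 :: "('b, 'n) monoid_scheme" and S0 \<H>0 and G :: "('a, 'm) monoid_scheme" and S \<H> +
  fixes \<iota> :: "'b \<Rightarrow> 'a" and f :: "'b set \<Rightarrow> 'a set"
  assumes \<iota>: "\<iota> \<in> hom G0 G" and inj: "inj_on \<iota> (carrier G0)"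
    and S: "\<iota> ` S0 \<subseteq> S" and f: "H \<in> \<H>0 \<Longrightarrow> f H \<in> \<H>" "H \<in> \<H>0 \<Longrightarrow> \<iota> ` H \<subseteq> f H"
begin

sublocale \<iota>: group_hom G0 G \<iota>
  by unfold_locales (rule \<iota>)

abbreviation "\<mu> \<equiv> letter_map \<iota> f"

lemma \<H>0_carrier: "H \<in> \<H>0 \<Longrightarrow> h \<in> H \<Longrightarrow> h \<in> carrier G0"
  using W0.pair by (auto simp: group_pair_def dest: subgroup.mem_carrier)

lemma \<iota>_eq_one: "g \<in> carrier G0 \<Longrightarrow> \<iota> g = \<one>\<^bsub>G\<^esub> \<longleftrightarrow> g = \<one>\<^bsub>G0\<^esub>"
  using inj_onD[OF inj, of g "\<one>\<^bsub>G0\<^esub>"] by auto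

lemma f_mem: "H \<in> \<H>0 \<Longrightarrow> h \<in> H \<Longrightarrow> \<iota> h \<in> f H"
  using f(2) by blast

lemma map_letters: "a \<in> W0.\<A> \<Longrightarrow> \<mu> a \<in> W.\<A>"
  using S f(1) f_mem \<iota>_eq_one \<H>0_carrier by (cases a) (auto simp: rel_alphabet_iff)

lemma letter_val_map: "a \<in> W0.\<A> \<Longrightarrow> letter_val G (\<mu> a) = \<iota> (letter_val G0 a)"
  using W0.S_carrier by (cases a) (auto simp: rel_alphabet_iff)

lemma word_val_map: "w \<in> lists W0.\<A> \<Longrightarrow> word_val G (map \<mu> w) = \<iota> (word_val G0 w)"
proof (induction w)
  case (Cons a w)
  then show ?case
    using W0.letter_val_closed[of a] W0.word_val_closed[of w]
    by (simp add: W.word_val_Cons W0.word_val_Cons letter_val_map)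
qed (simp add: W.word_val_Nil W0.word_val_Nil)

lemma map_rule:
  assumes "(l, r) \<in> rel_rules G0 S0 \<H>0"
  shows "(map \<mu> l, map \<mu> r) \<in> rel_rules G S \<H>"
proof -
  consider s where "s \<in> S0" "(l, r) = ([Gen s, GenInv s], [])"
    | s where "s \<in> S0" "(l, r) = ([GenInv s, Gen s], [])"
    | H a b where "H \<in> \<H>0" "a \<in> H - {\<one>\<^bsub>G0\<^esub>}" "b \<in> H - {\<one>\<^bsub>G0\<^esub>}"
        "l = [Sub H a, Sub H b]" "r = (if a \<otimes>\<^bsub>G0\<^esub> b = \<one>\<^bsub>G0\<^esub> then [] else [Sub H (a \<otimes>\<^bsub>G0\<^esub> b)])"
    using assms unfolding rel_rules_def by blast
  then show ?thesis
  proof cases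
    case 3
    then have c: "a \<in> carrier G0" "b \<in> carrier G0" using \<H>0_carrier by auto
    have ab: "\<iota> a \<in> f H - {\<one>\<^bsub>G\<^esub>}" "\<iota> b \<in> f H - {\<one>\<^bsub>G\<^esub>}" "f H \<in> \<H>"
      using 3 f \<iota>_eq_one c by auto
    have eq: "map \<mu> l = [Sub (f H) (\<iota> a), Sub (f H) (\<iota> b)]"
      "map \<mu> r = (if \<iota> a \<otimes>\<^bsub>G\<^esub> \<iota> b = \<one>\<^bsub>G\<^esub> then [] else [Sub (f H) (\<iota> a \<otimes>\<^bsub>G\<^esub> \<iota> b)])"
      using 3 c \<iota>_eq_one[of "a \<otimes>\<^bsub>G0\<^esub> b"] by auto
    show ?thesis unfolding eq rel_rules_def using ab by blast
  qed (use S in \<open>auto simp: rel_rules_def\<close>)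
qed

lemma map_cong:
  assumes "(u, v) \<in> word_cong W0.\<A> (rel_rules G0 S0 \<H>0)"
  shows "(map \<mu> u, map \<mu> v) \<in> word_cong W.\<A> (rel_rules G S \<H>)"
  using assms
proof induction
  case (rule l r u v)
  then have "map \<mu> u \<in> lists W.\<A>" "map \<mu> v \<in> lists W.\<A>" using map_letters by auto
  then show ?case using word_cong.rule[OF map_rule[OF rule(1)]] by simp
next
  case (refl w)
  then show ?case using map_letters by (intro word_cong.refl) auto
qed (blast intro: word_cong.sym word_cong.trans)+

definition free_map :: "'b letter list set \<Rightarrow> 'a letter list set" where
  "free_map c = W.cls (map \<mu> (SOME w. w \<in> c))"

lemma free_map_cls:
  assumes "w \<in> lists W0.\<A>"
  shows "free_map (W0.cls w) = W.cls (map \<mu> w)"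
proof -
  have "w \<in> W0.cls w"
    using assms by (auto simp: rel_class_def word_class_def intro: word_cong.refl)
  then have "(SOME v. v \<in> W0.cls w) \<in> W0.cls w" by (rule someI)
  then have "(w, SOME v. v \<in> W0.cls w) \<in> word_cong W0.\<A> (rel_rules G0 S0 \<H>0)"
    by (simp add: rel_class_def word_class_def)
  from W.cls_cong[OF map_cong[OF this]] show ?thesis by (simp add: free_map_def)
qed

lemma map_lists: "w \<in> lists W0.\<A> \<Longrightarrow> map \<mu> w \<in> lists W.\<A>"
  using map_letters by auto

lemma free_map_hom: "free_map \<in> hom W0.F W.F"
proof (rule homI)
  fix x assume "x \<in> carrier W0.F"
  then obtain u where u: "u \<in> lists W0.\<A>" "x = W0.cls u" unfolding W0.carrier_F by blast
  show "free_map x \<in> carrier W.F"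
    unfolding u(2) free_map_cls[OF u(1)] by (rule W.cls_closed[OF map_lists[OF u(1)]])
  fix y assume "y \<in> carrier W0.F"
  then obtain v where v: "v \<in> lists W0.\<A>" "y = W0.cls v" unfolding W0.carrier_F by blast
  have "u @ v \<in> lists W0.\<A>" using u v by simp
  then show "free_map (x \<otimes>\<^bsub>W0.F\<^esub> y) = free_map x \<otimes>\<^bsub>W.F\<^esub> free_map y"
    unfolding u(2) v(2) W0.cls_append[OF u(1) v(1), symmetric]
    by (simp only: free_map_cls u(1) v(1) map_append W.cls_append[OF map_lists[OF u(1)] map_lists[OF v(1)]])
qed

lemma free_map_kernel:
  assumes "R \<subseteq> kernel W0.F G0 (rel_eval G0)"
  shows "free_map ` R \<subseteq> kernel W.F G (rel_eval G)"
proof clarify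
  fix r assume "r \<in> R"
  then have r: "r \<in> carrier W0.F" "rel_eval G0 r = \<one>\<^bsub>G0\<^esub>" using assms by (auto simp: kernel_def)
  then obtain w where w: "w \<in> lists W0.\<A>" "r = W0.cls w" unfolding W0.carrier_F by blast
  then have "rel_eval G (W.cls (map \<mu> w)) = \<one>\<^bsub>G\<^esub>"
    using W.rel_eval_cls[OF map_lists] word_val_map r W0.rel_eval_cls by simp
  then show "free_map r \<in> kernel W.F G (rel_eval G)"
    unfolding w(2) free_map_cls[OF w(1)] kernel_def using W.cls_closed[OF map_lists[OF w(1)]] by simp
qed

lemma bounded_area_map:
  assumes R: "R \<subseteq> carrier W0.F" and bd: "W0.bounded_area R W0.\<A>"
  shows "W.bounded_area (free_map ` R) (\<mu> ` W0.\<A>)"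
  unfolding W.bounded_area_def
proof
  fix n
  obtain m where m: "\<And>w. w \<in> lists W0.\<A> \<Longrightarrow> length w \<le> n \<Longrightarrow> word_val G0 w = \<one>\<^bsub>G0\<^esub> \<Longrightarrow> area_le W0.F R (W0.cls w) m"
    using bd unfolding W0.bounded_area_def by blast
  have "area_le W.F (free_map ` R) (W.cls w) m"
    if w: "w \<in> lists (\<mu> ` W0.\<A>)" "length w \<le> n" "word_val G w = \<one>\<^bsub>G\<^esub>" for w
  proof -
    obtain v where v: "v \<in> lists W0.\<A>" "w = map \<mu> v" using w(1) unfolding lists_image by blast
    then have "word_val G0 v = \<one>\<^bsub>G0\<^esub>"
      using w(3) word_val_map \<iota>_eq_one W0.word_val_closed by simp
    then have "area_le W0.F R (W0.cls v) m" using m v w(2) by simp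
    from area_le_hom[OF W0.group_F W.group_F free_map_hom R order_refl this]
    show ?thesis unfolding v(2) free_map_cls[OF v(1)] .
  qed
  then show "\<exists>m. \<forall>w\<in>lists (\<mu> ` W0.\<A>). length w \<le> n \<longrightarrow> word_val G w = \<one>\<^bsub>G\<^esub> \<longrightarrow> area_le W.F (free_map ` R) (W.cls w) m"
    by blast
qed

lemma word_val_map_surj:
  assumes "carrier G0 \<subseteq> word_val G0 ` lists W0.\<A>"
  shows "\<iota> ` carrier G0 \<subseteq> word_val G ` lists W.\<A>"
proof clarify
  fix g assume "g \<in> carrier G0"
  then obtain w where "w \<in> lists W0.\<A>" "g = word_val G0 w" using assms by blast
  then show "\<iota> g \<in> word_val G ` lists W.\<A>" using word_val_map map_lists by (metis image_eqI)
qed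

end

section \<open>Rewriting words of the amalgam whose value lies in \<open>K\<close>\<close>

locale tree_words = tree_split G A B N + W: rel_words G S \<H>
  for G :: "('a, 'm) monoid_scheme" (structure) and A B N S \<H> +
  fixes L :: "bool \<Rightarrow> 'a letter set"
  assumes K_in: "K \<in> \<H>"
    and L_alph: "L i \<subseteq> rel_alphabet G S \<H>"
    and alph_L: "rel_alphabet G S \<H> \<subseteq> L True \<union> L False \<union> range (Sub K)"
    and L_val: "a \<in> L i \<Longrightarrow> letter_val G a \<in> A i"
    and B_L: "k \<in> B i \<Longrightarrow> k \<noteq> \<one> \<Longrightarrow> Sub K k \<in> L i"
begin

text \<open>A redex is replaced by at most one letter of \<open>K\<close>. Demanding some letter
  outside the copy of \<open>K\<close> in the second clause prevents a single letter of
  \<open>B i\<close> from being replaced by itself.\<close>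

definition redex :: "'a letter list \<Rightarrow> bool" where
  "redex u \<longleftrightarrow> (\<exists>a b. u = [Sub K a, Sub K b]) \<or>
    (\<exists>i. u \<in> lists (L i) \<and> word_val G u \<in> B i \<and> \<not> set u \<subseteq> range (Sub K))"

definition reducible :: "'a letter list \<Rightarrow> bool" where
  "reducible w \<longleftrightarrow> (\<exists>p u q. w = p @ u @ q \<and> redex u)"

lemma reducible_context: "reducible w \<Longrightarrow> reducible (p @ w @ q)"
  unfolding reducible_def by (metis append.assoc)

lemma redex_reducible: "redex u \<Longrightarrow> reducible (p @ u @ q)"
  unfolding reducible_def by blast

lemma letter_cases:
  assumes "a \<in> W.\<A>"
  obtains k where "a = Sub K k" "k \<in> K" "k \<noteq> \<one>" | i where "a \<in> L i" "a \<notin> range (Sub K)"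
proof (cases "a \<in> range (Sub K)")
  case True
  then show ?thesis using that(1) assms by (auto simp: rel_alphabet_iff)
next
  case False
  then have "a \<in> L True \<or> a \<in> L False" using assms alph_L by blast
  then show ?thesis using that(2) False by blast
qed

lemma L_lists: "u \<in> lists (L i) \<Longrightarrow> u \<in> lists W.\<A>"
  using L_alph lists_mono by blast

lemma L_word_val:
  assumes "u \<in> lists (L i)"
  shows "word_val G u \<in> A i"
  using assms
proof (induction u)
  case Nil
  then show ?case using subgroup.one_closed[OF A] by (simp add: W.word_val_Nil)
next
  case (Cons a u)
  then show ?case using subgroup.m_closed[OF A] L_val by (simp add: W.word_val_Cons)
qed

lemma letter_val_AK:
  assumes "a \<in> W.\<A>"
  obtains j where "letter_val G a \<in> A j \<union> K"
  using assms
proof (cases rule: letter_cases)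
  case (1 k)
  then show ?thesis using that[of True] by simp
next
  case (2 i)
  then show ?thesis using that[of i] L_val by blast
qed

lemma first_return:
  assumes "x \<in> M i" "w \<in> lists W.\<A>"
  shows "x \<otimes> word_val G w \<in> M i \<or> (\<exists>p q. w = p @ q \<and> x \<otimes> word_val G p \<in> B i)"
  using assms
proof (induction w arbitrary: x)
  case Nil
  then have "x \<in> carrier G" using M_carrier by blast
  then show ?case using Nil by (simp add: W.word_val_Nil)
next
  case (Cons a w)
  let ?s = "letter_val G a"
  have aw: "a \<in> W.\<A>" "w \<in> lists W.\<A>" using Cons.prems by auto
  have c: "x \<in> carrier G" "?s \<in> carrier G" using Cons.prems M_carrier W.letter_val_closed by auto
  have eq: "x \<otimes> word_val G (a # p) = x \<otimes> ?s \<otimes> word_val G p" if "p \<in> lists W.\<A>" for p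
    using that c W.word_val_closed[of p] by (simp add: W.word_val_Cons m_assoc)
  obtain j where "?s \<in> A j \<union> K" by (rule letter_val_AK[OF aw(1)])
  then consider "x \<otimes> ?s \<in> M i" | "x \<otimes> ?s \<in> B i" using M_step[OF Cons.prems(1)] by blast
  then show ?case
  proof cases
    case 1
    then consider "x \<otimes> ?s \<otimes> word_val G w \<in> M i"
      | p q where "w = p @ q" "x \<otimes> ?s \<otimes> word_val G p \<in> B i"
      using Cons.IH aw by blast
    then show ?thesis
    proof cases
      case 1
      then show ?thesis using eq[OF aw(2)] by simp
    next
      case 2
      then have "a # w = (a # p) @ q" "x \<otimes> word_val G (a # p) \<in> B i" using eq[of p] aw by auto
      then show ?thesis by blast
    qed
  next
    case 2
    then have "a # w = [a] @ w" "x \<otimes> word_val G [a] \<in> B i" using c by (auto simp: W.word_val_Cons W.word_val_Nil)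
    then show ?thesis by blast
  qed
qed

text \<open>
  If a path leaves a coset of \<open>A i\<close>, it has to come back through the coset of \<open>B i\<close> where it left, and
  the excursion is a shorter word with value in \<open>B i\<close>.
\<close>

lemma reducible_extend:
  assumes IH: "\<And>w'. length w' < n \<Longrightarrow> w' \<in> lists W.\<A> \<Longrightarrow> w' \<noteq> [] \<Longrightarrow> word_val G w' \<in> K \<Longrightarrow>
      (\<exists>k. w' = [Sub K k]) \<or> reducible w'"
    and v: "v \<in> lists (L i)" "\<not> set v \<subseteq> range (Sub K)" "word_val G v \<in> A i - B i"
    and w: "w \<in> lists W.\<A>" "length (v @ w) \<le> n" "word_val G v \<otimes> word_val G w \<in> K"
  shows "reducible (v @ w)"
  using v w
proof (induction w arbitrary: v)
  case Nil
  then show ?case using A_K A_carrier[of i] by (auto simp: W.word_val_Nil)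
next
  case (Cons b w)
  let ?s = "letter_val G b"
  have bw: "b \<in> W.\<A>" "w \<in> lists W.\<A>" and vA: "v \<in> lists W.\<A>" using Cons.prems L_lists by auto
  have sc: "?s \<in> carrier G" using bw W.letter_val_closed by blast
  show ?case
  proof (cases "b \<in> L i")
    case True
    then have vb: "v @ [b] \<in> lists (L i)" "\<not> set (v @ [b]) \<subseteq> range (Sub K)" using Cons.prems by auto
    show ?thesis
    proof (cases "word_val G (v @ [b]) \<in> B i")
      case True
      then have "redex (v @ [b])" using vb unfolding redex_def by blast
      then show ?thesis using redex_reducible[of "v @ [b]" "[]" w] by simp
    next
      case False
      have "word_val G (v @ [b]) \<otimes> word_val G w = word_val G v \<otimes> word_val G (b # w)"
        using W.word_val_append[of v "[b]"] W.word_val_append[of "v @ [b]" w] W.word_val_append[of v "b # w"] vA bw by simp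
      then have "reducible ((v @ [b]) @ w)"
        using Cons.IH[of "v @ [b]"] vb False L_word_val[OF vb(1)] Cons.prems bw by simp
      then show ?thesis by simp
    qed
  next
    case False
    show ?thesis
    proof (cases "?s \<in> A i")
      case True
      from bw(1) show ?thesis
      proof (cases rule: letter_cases)
        case (1 k)
        then show ?thesis using True False A_K[of k i] B_L by auto
      next
        case (2 j)
        then have "i \<noteq> j" using False by blast
        \<comment> \<open>The label belongs to the other factor but the value lies in both, hence in
          an edge group, and the letter alone is a redex.\<close>
        then have "?s \<in> B j" using A_inter'[of ?s j i] True 2 L_val by blast
        then have "redex [b]" using 2 sc unfolding redex_def by (auto simp: W.word_val_Cons W.word_val_Nil)
        then show ?thesis using redex_reducible[of "[b]" v w] by simp
      qed
    next
      case out: False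
      obtain j where "?s \<in> A j \<union> K" by (rule letter_val_AK[OF bw(1)])
      then have sM: "?s \<in> M i" using M_outside_A out by blast
      \<comment> \<open>Otherwise ping-pong with the value of \<open>v\<close> would put the value
        of the whole word in \<open>N i\<close>, which is disjoint from \<open>K\<close>.\<close>
      have "word_val G (b # w) \<notin> M i"
        using N_mult_A[OF Cons.prems(3)] Cons.prems(6) N_not_K by blast
      then obtain p q where pq: "w = p @ q" "?s \<otimes> word_val G p \<in> B i"
        using first_return[OF sM bw(2)] by (auto simp: W.word_val_Cons)
      \<comment> \<open>Strictness holds because \<open>v\<close> is nonempty: it has a letter
        outside the copy of \<open>K\<close>.\<close>
      have "length (b # p) < n" using pq Cons.prems(2,5) by (cases v) auto
      moreover have "b # p \<in> lists W.\<A>" using bw pq by auto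
      ultimately have "(\<exists>k. b # p = [Sub K k]) \<or> reducible (b # p)"
        using IH[of "b # p"] pq(2) B_K by (auto simp: W.word_val_Cons)
      moreover have "b # p \<noteq> [Sub K k]" for k
        using pq(2) out B_A[of i] sc by (auto simp: W.word_val_Nil)
      ultimately have "reducible (v @ (b # p) @ q)" using reducible_context by blast
      then show ?thesis using pq by simp
    qed
  qed
qed

lemma reducible_or_letter:
  assumes "w \<in> lists W.\<A>" "w \<noteq> []" "word_val G w \<in> K"
  shows "(\<exists>k. w = [Sub K k]) \<or> reducible w"
  using assms
proof (induction "length w" arbitrary: w rule: less_induct)
  case less
  then obtain a w' where w: "w = a # w'" by (cases w) auto
  have aw: "a \<in> W.\<A>" "w' \<in> lists W.\<A>" using less.prems w by auto
  have sc: "letter_val G a \<in> carrier G" using aw W.letter_val_closed by blast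
  from aw(1) show ?case
  proof (cases rule: letter_cases)
    case (1 k)
    show ?thesis
    proof (cases "w' = []")
      case True
      then show ?thesis using w 1 by simp
    next
      case False
      have "word_val G w' \<in> K"
        using mult_in_right_iff[OF K_subgroup, of k "word_val G w'"] 1 sc w W.word_val_closed[OF aw(2)] less.prems(3)
        by (simp add: W.word_val_Cons)
      then consider k' where "w' = [Sub K k']" | "reducible w'"
        using less.hyps[of w'] w aw False by auto
      then show ?thesis
      proof cases
        case (1 k')
        then have "redex w" using w \<open>a = Sub K k\<close> by (simp add: redex_def)
        then show ?thesis using redex_reducible[of w "[]" "[]"] by simp
      next
        case 2
        then show ?thesis using reducible_context[of w' "[a]" "[]"] w by simp
      qed
    qed
  next
    case (2 i)
    have val: "word_val G [a] = letter_val G a" using sc by (simp add: W.word_val_Cons W.word_val_Nil)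
    show ?thesis
    proof (cases "letter_val G a \<in> B i")
      case True
      then have "redex [a]" using 2 val unfolding redex_def by auto
      then show ?thesis using redex_reducible[of "[a]" "[]" w'] w by simp
    next
      case False
      have "reducible ([a] @ w')"
        by (rule reducible_extend[of "length w" "[a]" i])
          (use less 2 False L_val w val aw in \<open>auto simp: W.word_val_Cons\<close>)
      then show ?thesis using w by simp
    qed
  qed
qed

text \<open>Merging two letters of \<open>K\<close> must lower the weight, so they weigh something;
  replacing one other letter by a letter of \<open>K\<close> must lower it too, so they weigh less.
  The values 1 and 2 are the smallest possible.\<close>

definition weight :: "'a letter list \<Rightarrow> nat" where
  "weight w = (\<Sum>a\<leftarrow>w. if a \<in> range (Sub K) then 1 else 2)"

lemma weight_append: "weight (u @ v) = weight u + weight v"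
  by (simp add: weight_def)

lemma weight_le: "weight w \<le> 2 * length w"
  by (induction w) (auto simp: weight_def)

lemma length_le_weight: "length w \<le> weight w"
  by (induction w) (auto simp: weight_def)

lemma weight_ge: "\<not> set w \<subseteq> range (Sub K) \<Longrightarrow> 2 \<le> weight w"
proof -
  assume "\<not> set w \<subseteq> range (Sub K)"
  then obtain a where "a \<in> set w" "a \<notin> range (Sub K)" by blast
  then show ?thesis by (auto simp: weight_def dest!: split_list)
qed

definition K_word :: "'a \<Rightarrow> 'a letter list" where
  "K_word k = (if k = \<one> then [] else [Sub K k])"

lemma K_word: "k \<in> K \<Longrightarrow> K_word k \<in> lists W.\<A>" "k \<in> B i \<Longrightarrow> K_word k \<in> lists (L i)"
  "k \<in> K \<Longrightarrow> word_val G (K_word k) = k" "weight (K_word k) \<le> 1" "length (K_word k) \<le> 1"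
  using K_in B_L K_carrier
  by (auto simp: K_word_def rel_alphabet_iff W.word_val_Nil W.word_val_Cons weight_def)

lemma cls_K_word_inv:
  assumes "k \<in> K"
  shows "W.cls (K_word (inv k)) \<otimes>\<^bsub>W.F\<^esub> W.cls (K_word k) = \<one>\<^bsub>W.F\<^esub>"
proof -
  have kc: "k \<in> carrier G" using assms K_carrier by blast
  have ik: "inv k \<in> K" using assms subgroup.m_inv_closed[OF K_subgroup] by blast
  have "W.cls (K_word (inv k) @ K_word k) = W.cls []"
  proof (cases "k = \<one>")
    case False
    then have "([Sub K (inv k), Sub K k], []) \<in> rel_rules G S \<H>"
      unfolding rel_rules_def using K_in assms ik kc by force
    then show ?thesis using False kc by (simp add: K_word_def W.cls_rule)
  qed (simp add: K_word_def)
  then show ?thesis using W.cls_append[OF K_word(1)[OF ik] K_word(1)[OF assms]] by (simp add: W.cls_Nil)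
qed

text \<open>For a redex over a factor, \<open>z\<close> is the class of \<open>u\<close> followed by
  the inverse of its value, a relation over \<open>L i\<close>; the appended letter accounts for
  \<open>Suc n\<close>. Merging two letters of \<open>K\<close> holds already in the relative free
  group, so there \<open>z\<close> is trivial.\<close>

lemma redex_reduct:
  assumes R: "R \<subseteq> carrier W.F"
    and c: "\<forall>i. \<forall>u\<in>lists (L i). length u \<le> Suc n \<longrightarrow> word_val G u = \<one> \<longrightarrow> area_le W.F R (W.cls u) c"
    and u: "redex u" "u \<in> lists W.\<A>" "length u \<le> n"
  shows "\<exists>k\<in>K. word_val G u = k \<and> weight (K_word k) < weight u \<and>
    (\<exists>z\<in>carrier W.F. area_le W.F R z c \<and> W.cls u = z \<otimes>\<^bsub>W.F\<^esub> W.cls (K_word k))"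
proof -
  interpret F: group W.F by (rule W.group_F)
  from u(1) consider a b where "u = [Sub K a, Sub K b]"
    | i where "u \<in> lists (L i)" "word_val G u \<in> B i" "\<not> set u \<subseteq> range (Sub K)"
    unfolding redex_def by blast
  then show ?thesis
  proof cases
    case 1
    then have ab: "a \<in> K" "b \<in> K" "a \<noteq> \<one>" "b \<noteq> \<one>" using u(2) by (auto simp: rel_alphabet_iff)
    then have k: "a \<otimes> b \<in> K" using subgroup.m_closed[OF K_subgroup] by blast
    have "(u, K_word (a \<otimes> b)) \<in> rel_rules G S \<H>"
      unfolding rel_rules_def K_word_def 1 using ab K_in by blast
    then have "W.cls u = \<one>\<^bsub>W.F\<^esub> \<otimes>\<^bsub>W.F\<^esub> W.cls (K_word (a \<otimes> b))"
      using W.cls_rule W.cls_closed[OF K_word(1)[OF k]] by simp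
    moreover have "word_val G u = a \<otimes> b"
      using 1 ab K_carrier by (auto simp: W.word_val_Cons W.word_val_Nil)
    moreover have "weight (K_word (a \<otimes> b)) < weight u"
      using K_word(4)[of "a \<otimes> b"] 1 by (simp add: weight_def)
    ultimately show ?thesis using k area_le_one F.one_closed by metis
  next
    case 2
    let ?k = "word_val G u"
    have k: "?k \<in> K" "inv ?k \<in> B i" "inv ?k \<in> K" "?k \<in> carrier G"
      using 2 B_K subgroup.m_inv_closed[OF B] B_carrier by blast+
    let ?v = "u @ K_word (inv ?k)"
    have v: "?v \<in> lists (L i)" "length ?v \<le> Suc n"
      using 2 K_word(2)[OF k(2)] K_word(5)[of "inv ?k"] u(3) by auto
    have "word_val G ?v = ?k \<otimes> inv ?k"
      using W.word_val_append[OF u(2) K_word(1)[OF k(3)]] K_word(3)[OF k(3)] by simp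
    then have "area_le W.F R (W.cls ?v) c" using c v k by simp
    moreover have "W.cls ?v \<otimes>\<^bsub>W.F\<^esub> W.cls (K_word ?k) = W.cls u"
      using W.cls_append[OF u(2) K_word(1)[OF k(3)]] cls_K_word_inv[OF k(1)]
        W.cls_closed[OF u(2)] W.cls_closed[OF K_word(1)[OF k(3)]] W.cls_closed[OF K_word(1)[OF k(1)]]
      by (simp add: F.m_assoc)
    moreover have "W.cls ?v \<in> carrier W.F" using L_lists[OF v(1)] by (rule W.cls_closed)
    ultimately show ?thesis using k K_word(4)[of ?k] weight_ge[OF 2(3)] by force
  qed
qed

text \<open>Every replacement costs at most \<open>c\<close> and lowers the weight by at least 1.
  One constant \<open>c\<close> serves throughout because length is bounded by weight, which never
  exceeds \<open>n\<close>.\<close>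

lemma area_le_weight:
  assumes R: "R \<subseteq> carrier W.F"
    and c: "\<forall>i. \<forall>u\<in>lists (L i). length u \<le> Suc n \<longrightarrow> word_val G u = \<one> \<longrightarrow> area_le W.F R (W.cls u) c"
    and w: "w \<in> lists W.\<A>" "word_val G w = \<one>" "weight w \<le> n"
  shows "area_le W.F R (W.cls w) (weight w * c)"
  using w
proof (induction "weight w" arbitrary: w rule: less_induct)
  case less
  interpret F: group W.F by (rule W.group_F)
  show ?case
  proof (cases "w = []")
    case True
    then show ?thesis by (simp add: W.cls_Nil area_le_one)
  next
    case False
    have "w \<noteq> [Sub K k]" for k
      using less.prems K_carrier by (auto simp: rel_alphabet_iff W.word_val_Cons W.word_val_Nil)
    then have "reducible w"
      using reducible_or_letter[OF less.prems(1) False] less.prems(2) subgroup.one_closed[OF K_subgroup] by auto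
    then obtain p u q where w: "w = p @ u @ q" and u: "redex u" unfolding reducible_def by blast
    have l: "p \<in> lists W.\<A>" "u \<in> lists W.\<A>" "q \<in> lists W.\<A>" using w less.prems by auto
    have "length u \<le> n" using length_le_weight[of w] less.prems(3) w by simp
    from redex_reduct[OF R c u l(2) this] obtain k z where kz: "k \<in> K" "word_val G u = k"
      "weight (K_word k) < weight u" "z \<in> carrier W.F" "area_le W.F R z c"
      "W.cls u = z \<otimes>\<^bsub>W.F\<^esub> W.cls (K_word k)" by blast
    let ?w = "p @ K_word k @ q"
    note lk = K_word(1)[OF kz(1)]
    have lw: "?w \<in> lists W.\<A>" "u @ q \<in> lists W.\<A>" "K_word k @ q \<in> lists W.\<A>" using l lk by auto
    have val: "word_val G ?w = \<one>"
      using less.prems(2) W.word_val_append[OF l(1) lw(2)] W.word_val_append[OF l(2,3)]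
        W.word_val_append[OF l(1) lw(3)] W.word_val_append[OF lk l(3)] K_word(3)[OF kz(1)] kz(2) w by simp
    have wt: "Suc (weight ?w) \<le> weight w" using kz(3) w by (simp add: weight_append)
    then have area: "area_le W.F R (W.cls ?w) (weight ?w * c)"
      using less.hyps[of ?w] lw val less.prems(3) by simp
    have cl: "W.cls p \<in> carrier W.F" "W.cls q \<in> carrier W.F" "W.cls (K_word k) \<in> carrier W.F"
      using W.cls_closed l lk by blast+
    \<comment> \<open>The correction term conjugated by the prefix. The double inverse fits the
      shape of \<open>area_le_conj\<close>, whose conjugator stands on the right.\<close>
    let ?z = "inv\<^bsub>W.F\<^esub> (inv\<^bsub>W.F\<^esub> W.cls p) \<otimes>\<^bsub>W.F\<^esub> z \<otimes>\<^bsub>W.F\<^esub> inv\<^bsub>W.F\<^esub> W.cls p"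
    have "W.cls w = W.cls p \<otimes>\<^bsub>W.F\<^esub> (z \<otimes>\<^bsub>W.F\<^esub> W.cls (K_word k)) \<otimes>\<^bsub>W.F\<^esub> W.cls q"
      using W.cls_append[OF l(1) lw(2)] W.cls_append[OF l(2,3)] w kz(4,6) cl by (simp add: F.m_assoc)
    also have "\<dots> = ?z \<otimes>\<^bsub>W.F\<^esub> W.cls ?w"
    proof -
      have "W.cls ?w = W.cls p \<otimes>\<^bsub>W.F\<^esub> (W.cls (K_word k) \<otimes>\<^bsub>W.F\<^esub> W.cls q)"
        using W.cls_append[OF l(1) lw(3)] W.cls_append[OF lk l(3)] by simp
      moreover have "inv\<^bsub>W.F\<^esub> W.cls p \<otimes>\<^bsub>W.F\<^esub> (W.cls p \<otimes>\<^bsub>W.F\<^esub> y) = y" if "y \<in> carrier W.F" for y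
        using cl that by (simp add: F.m_assoc[symmetric])
      ultimately show ?thesis using cl kz(4) by (simp add: F.m_assoc)
    qed
    finally have "W.cls w = ?z \<otimes>\<^bsub>W.F\<^esub> W.cls ?w" .
    moreover have "area_le W.F R ?z c"
      using F.area_le_conj[OF R kz(5), of "inv\<^bsub>W.F\<^esub> W.cls p"] cl by simp
    ultimately have "area_le W.F R (W.cls w) (c + weight ?w * c)"
      using F.area_le_mult[OF R _ area] by simp
    moreover have "c + weight ?w * c \<le> weight w * c"
      using mult_le_mono1[OF wt, of c] by simp
    ultimately show ?thesis by (rule area_le_mono[OF _ order_refl])
  qed
qed

lemma bounded_area_combination:
  assumes R: "\<And>i. R i \<subseteq> carrier W.F"
    and bd: "\<And>i. W.bounded_area (R i) (L i)"
  shows "W.bounded_area (R True \<union> R False) W.\<A>"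
  unfolding W.bounded_area_def
proof
  fix n
  have Rc: "R True \<union> R False \<subseteq> carrier W.F" using R by blast
  \<comment> \<open>The weight is at most \<open>2 * n\<close> for words of length \<open>n\<close>;
    one more letter is the inverse appended to a redex.\<close>
  have "\<forall>i. \<exists>m. \<forall>u\<in>lists (L i). length u \<le> Suc (2 * n) \<longrightarrow> word_val G u = \<one> \<longrightarrow> area_le W.F (R i) (W.cls u) m"
    using bd unfolding W.bounded_area_def by blast
  then obtain m where m: "\<And>i u. u \<in> lists (L i) \<Longrightarrow> length u \<le> Suc (2 * n) \<Longrightarrow> word_val G u = \<one> \<Longrightarrow>
      area_le W.F (R i) (W.cls u) (m i)" by metis
  let ?c = "m True + m False"
  have "area_le W.F (R True \<union> R False) (W.cls u) ?c"
    if "u \<in> lists (L i)" "length u \<le> Suc (2 * n)" "word_val G u = \<one>" for i u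
    using area_le_mono[OF m[OF that], of "R True \<union> R False" ?c] by (cases i) auto
  then have c: "\<forall>i. \<forall>u\<in>lists (L i). length u \<le> Suc (2 * n) \<longrightarrow> word_val G u = \<one> \<longrightarrow>
      area_le W.F (R True \<union> R False) (W.cls u) ?c" by blast
  have "area_le W.F (R True \<union> R False) (W.cls w) (2 * n * ?c)"
    if w: "w \<in> lists W.\<A>" "length w \<le> n" "word_val G w = \<one>" for w
  proof -
    have "weight w \<le> 2 * n" using weight_le[of w] w(2) by simp
    then have "weight w * ?c \<le> 2 * n * ?c" by (rule mult_le_mono1)
    then show ?thesis
      by (rule area_le_mono[OF area_le_weight[OF Rc c w(1,3) \<open>weight w \<le> 2 * n\<close>] order_refl])
  qed
  then show "\<exists>m. \<forall>w\<in>lists W.\<A>. length w \<le> n \<longrightarrow> word_val G w = \<one> \<longrightarrow> area_le W.F (R True \<union> R False) (W.cls w) m"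
    by blast
qed

lemma word_val_surj:
  assumes "\<And>i. A i \<subseteq> word_val G ` lists W.\<A>"
  shows "carrier G \<subseteq> word_val G ` lists W.\<A>"
proof
  fix x assume "x \<in> carrier G"
  then show "x \<in> word_val G ` lists W.\<A>"
  proof (induction rule: gen_induct)
    case one
    have "word_val G [] \<in> word_val G ` lists W.\<A>" by (rule imageI) simp
    then show ?case by (simp add: W.word_val_Nil)
  next
    case (mult y s j)
    then obtain u v where "u \<in> lists W.\<A>" "v \<in> lists W.\<A>" "y = word_val G u" "s = word_val G v"
      using assms[of j] by blast
    then have "y \<otimes> s = word_val G (u @ v)" "u @ v \<in> lists W.\<A>" using W.word_val_append by auto
    then show ?case by blast
  qed
qed

end


section \<open>Hyperbolic graphs with gated pieces\<close>

lemma relpow_refl_mono: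
  assumes "Id \<subseteq> W" "m \<le> n" "(x, y) \<in> W ^^ m"
  shows "(x, y) \<in> W ^^ n"
  using assms(2,3)
proof (induction n rule: dec_induct)
  case (step n)
  then show ?case using assms(1) by (auto intro: relpow_Suc_I)
qed

lemma relpow_image:
  assumes "(x, y) \<in> W ^^ n" "x \<in> V"
    and "\<And>u v. u \<in> V \<Longrightarrow> (u, v) \<in> W \<Longrightarrow> v \<in> V \<and> (f u, f v) \<in> W'"
  shows "(f x, f y) \<in> W' ^^ n \<and> y \<in> V"
  using assms(1)
proof (induction n arbitrary: y)
  case 0
  then show ?case using assms(2) by simp
next
  case (Suc n)
  then show ?case using assms(3) by (meson relpow_Suc_E relpow_Suc_I)
qed

lemma relpow_sym: "sym W \<Longrightarrow> (x, y) \<in> W ^^ n \<Longrightarrow> (y, x) \<in> W ^^ n"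
proof (induction n arbitrary: y)
  case (Suc n)
  then show ?case by (meson relpow_Suc_E relpow_Suc_I2 symD)
qed simp

lemma relpow_subset:
  fixes R S :: "('v \<times> 'v) set"
  shows "R \<subseteq> S \<Longrightarrow> R ^^ n \<subseteq> S ^^ n"
  by (induction n) auto

lemma relpow_reflcl_iff: "(x, y) \<in> (E\<^sup>=) ^^ n \<longleftrightarrow> (\<exists>m\<le>n. (x, y) \<in> E ^^ m)"
proof
  show "\<exists>m\<le>n. (x, y) \<in> E ^^ m" if "(x, y) \<in> (E\<^sup>=) ^^ n" using that
  proof (induction n arbitrary: y)
    case (Suc n)
    then obtain z where z: "(x, z) \<in> (E\<^sup>=) ^^ n" "(z, y) \<in> E \<or> z = y" by auto
    then obtain m where "m \<le> n" "(x, z) \<in> E ^^ m" using Suc.IH by blast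
    then show ?case using z(2) by (metis Suc_le_mono le_SucI relpow_Suc_I)
  qed auto
  show "(x, y) \<in> (E\<^sup>=) ^^ n" if "\<exists>m\<le>n. (x, y) \<in> E ^^ m"
  proof -
    obtain m where "m \<le> n" "(x, y) \<in> E ^^ m" using \<open>\<exists>m\<le>n. _ m\<close> by blast
    moreover have "E ^^ m \<subseteq> (E\<^sup>=) ^^ m" by (rule relpow_subset) auto
    ultimately show ?thesis using relpow_refl_mono[of "E\<^sup>="] by blast
  qed
qed

lemma graph_dist_le_iff: "graph_dist E x y \<le> enat n \<longleftrightarrow> (x, y) \<in> (E\<^sup>=) ^^ n"
  unfolding relpow_reflcl_iff
proof
  assume le: "graph_dist E x y \<le> enat n"
  have "\<exists>m. (x, y) \<in> E ^^ m \<and> m \<le> n"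
  proof (rule ccontr)
    assume "\<not> ?thesis"
    then have "enat (Suc n) \<le> graph_dist E x y"
      unfolding graph_dist_def by (intro INF_greatest) (auto simp: not_le)
    then show False using le by (meson enat_ord_simps(1) not_less_eq_eq order_refl order_trans)
  qed
  then show "\<exists>m\<le>n. (x, y) \<in> E ^^ m" by blast
next
  assume "\<exists>m\<le>n. (x, y) \<in> E ^^ m"
  then obtain m where "m \<le> n" "(x, y) \<in> E ^^ m" by blast
  then show "graph_dist E x y \<le> enat n"
    unfolding graph_dist_def by (intro INF_lower2[of m]) auto
qed

text \<open>
  Adding loops to a graph changes neither distances nor geodesics, so all graphs are made reflexive
  below; then powers of the adjacency relation are the relations of having bounded distance.
\<close>

definition geo :: "('v \<times> 'v) set \<Rightarrow> (nat \<Rightarrow> 'v) \<Rightarrow> nat \<Rightarrow> bool" where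
  "geo W f n \<longleftrightarrow> (\<forall>i<n. (f i, f (Suc i)) \<in> W) \<and> (\<forall>m<n. (f 0, f n) \<notin> W ^^ m)"

text \<open>Geodesics are functions on \<open>nat\<close> together with a length, so that subpaths
  and reversals are mere reindexing; values beyond the length do not matter.\<close>

definition slim :: "nat \<Rightarrow> 'v set \<Rightarrow> ('v \<times> 'v) set \<Rightarrow> bool" where
  "slim \<delta> V W \<longleftrightarrow> (\<forall>f a g b h c. geo W f a \<longrightarrow> geo W g b \<longrightarrow> geo W h c \<longrightarrow>
     f a = g 0 \<longrightarrow> g b = h 0 \<longrightarrow> h c = f 0 \<longrightarrow> f 0 \<in> V \<longrightarrow> g 0 \<in> V \<longrightarrow> h 0 \<in> V \<longrightarrow>
     (\<forall>i\<le>a. \<exists>v\<in>g ` {..b} \<union> h ` {..c}. (f i, v) \<in> W ^^ \<delta>))"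

lemma path_relpow:
  assumes "\<forall>i<n. (f i, f (Suc i)) \<in> W" "i \<le> j" "j \<le> n"
  shows "(f i, f j) \<in> W ^^ (j - i)"
  using assms(2,3)
proof (induction j rule: dec_induct)
  case (step j)
  then show ?case using assms(1) by (auto simp: Suc_diff_le intro: relpow_Suc_I)
qed simp

text \<open>A shortcut between two points of a geodesic would shorten the whole geodesic.\<close>

lemma geo_far:
  assumes "geo W f n" "i \<le> j" "j \<le> n" "m < j - i"
  shows "(f i, f j) \<notin> W ^^ m"
proof
  assume a: "(f i, f j) \<in> W ^^ m"
  have p: "\<forall>i<n. (f i, f (Suc i)) \<in> W" using assms(1) by (simp add: geo_def)
  have "(f 0, f i) \<in> W ^^ i" "(f j, f n) \<in> W ^^ (n - j)"
    using path_relpow[OF p, of 0 i] path_relpow[OF p, of j n] assms by auto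
  then have "(f 0, f n) \<in> W ^^ (i + m + (n - j))"
    using a unfolding relpow_add by blast
  moreover have "i + m + (n - j) < n" using assms by linarith
  ultimately show False using assms(1) by (auto simp: geo_def)
qed

lemma geo_sub:
  assumes "geo W f n" "i + k \<le> n"
  shows "geo W (\<lambda>j. f (i + j)) k"
  using assms geo_far[OF assms(1), of i "i + k"] by (auto simp: geo_def)

lemma geo_rev:
  assumes "geo W f n" "sym W"
  shows "geo W (\<lambda>j. f (n - j)) n"
  unfolding geo_def
proof (intro conjI allI impI)
  fix i assume "i < n"
  then have "(f (n - Suc i), f (Suc (n - Suc i))) \<in> W" using assms by (auto simp: geo_def)
  then show "(f (n - i), f (n - Suc i)) \<in> W"
    using assms(2) \<open>i < n\<close> by (auto simp: sym_def Suc_diff_Suc)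
next
  fix m assume "m < n"
  then have "(f 0, f n) \<notin> W ^^ m" using assms by (auto simp: geo_def)
  then show "(f (n - 0), f (n - n)) \<notin> W ^^ m" using relpow_sym[OF assms(2), of "f n" "f 0"] by auto
qed

lemma geo_exists:
  assumes "(x, y) \<in> W ^^ n"
  obtains f m where "geo W f m" "f 0 = x" "f m = y" "m \<le> n"
proof -
  define m where "m = (LEAST m. (x, y) \<in> W ^^ m)"
  have m: "(x, y) \<in> W ^^ m" "m \<le> n" "\<And>k. k < m \<Longrightarrow> (x, y) \<notin> W ^^ k"
    unfolding m_def using assms by (auto intro: LeastI Least_le dest: not_less_Least)
  then obtain f where "f 0 = x" "f m = y" "\<forall>i<m. (f i, f (Suc i)) \<in> W"
    unfolding relpow_fun_conv by blast
  then show ?thesis using that m by (auto simp: geo_def)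
qed

lemma geo_reflcl: "geo E f n \<longleftrightarrow> (\<forall>i<n. (f i, f (Suc i)) \<in> E) \<and> (\<forall>m<n. (f 0, f n) \<notin> (E\<^sup>=) ^^ m)"
proof -
  have "(\<forall>m<n. (f 0, f n) \<notin> E ^^ m) \<longleftrightarrow> (\<forall>m<n. (f 0, f n) \<notin> (E\<^sup>=) ^^ m)"
    unfolding relpow_reflcl_iff by (meson le_less_trans order_refl)
  then show ?thesis by (auto simp: geo_def)
qed

lemma geo_step_neq: "geo W f n \<Longrightarrow> i < n \<Longrightarrow> f i \<noteq> f (Suc i)"
  using geo_far[of W f n i "Suc i" 0] by auto

text \<open>A geodesic never stays at a vertex, so none of the added loops occurs on it.\<close>

lemma geo_reflcl_iff: "geo (E\<^sup>=) f n \<longleftrightarrow> geo E f n"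
proof
  assume g: "geo (E\<^sup>=) f n"
  then show "geo E f n" using geo_step_neq[OF g] by (auto simp: geo_reflcl geo_def)
qed (simp add: geo_reflcl geo_def[of "E\<^sup>="])

lemma geodesic_geo:
  "geodesic E x y p \<longleftrightarrow> p \<noteq> [] \<and> p ! 0 = x \<and> p ! (length p - 1) = y \<and> geo (E\<^sup>=) (\<lambda>i. p ! i) (length p - 1)"
proof (cases "p = []")
  case False
  let ?n = "length p - 1"
  have s: "successively (\<lambda>u v. (u, v) \<in> E) p \<longleftrightarrow> (\<forall>i<?n. (p ! i, p ! Suc i) \<in> E)"
    by (auto simp: successively_conv_nth)
  have d: "enat ?n = graph_dist E (p ! 0) (p ! ?n) \<longleftrightarrow> (\<forall>m<?n. (p ! 0, p ! ?n) \<notin> (E\<^sup>=) ^^ m)"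
    if "\<forall>i<?n. (p ! i, p ! Suc i) \<in> E"
  proof -
    have "(p ! 0, p ! ?n) \<in> (E\<^sup>=) ^^ ?n"
      using path_relpow[of ?n "(!) p" "E\<^sup>=" 0 ?n] that by simp
    then have le: "graph_dist E (p ! 0) (p ! ?n) \<le> enat ?n" unfolding graph_dist_le_iff .
    have "enat ?n \<le> graph_dist E (p ! 0) (p ! ?n) \<longleftrightarrow> (\<forall>m<?n. \<not> graph_dist E (p ! 0) (p ! ?n) \<le> enat m)"
    proof (cases "graph_dist E (p ! 0) (p ! ?n)")
      case (enat k)
      then show ?thesis by (auto simp: not_le) (meson not_le order_refl)
    qed auto
    moreover have "enat ?n = graph_dist E (p ! 0) (p ! ?n) \<longleftrightarrow> enat ?n \<le> graph_dist E (p ! 0) (p ! ?n)"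
      using le by (auto intro: antisym)
    ultimately show ?thesis unfolding graph_dist_le_iff by simp
  qed
  show ?thesis
    unfolding geo_reflcl_iff geodesic_def s
    using False d by (auto simp: hd_conv_nth last_conv_nth geo_reflcl)
qed (simp add: geodesic_def)

lemma geodesic_of_geo: "geo (E\<^sup>=) f n \<Longrightarrow> geodesic E (f 0) (f n) (map f [0..<Suc n])"
  unfolding geodesic_geo by (auto simp: geo_def nth_append simp del: upt_Suc)

lemma hyperbolic_graph_iff_slim: "hyperbolic_graph V E \<longleftrightarrow> (\<exists>\<delta>. slim \<delta> V (E\<^sup>=))"
proof
  assume "hyperbolic_graph V E"
  then obtain \<delta> where \<delta>: "\<And>x y z p q r u. x \<in> V \<Longrightarrow> y \<in> V \<Longrightarrow> z \<in> V \<Longrightarrow>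
       geodesic E x y p \<Longrightarrow> geodesic E y z q \<Longrightarrow> geodesic E z x r \<Longrightarrow> u \<in> set p \<Longrightarrow>
       (\<exists>v\<in>set q \<union> set r. (u, v) \<in> (E\<^sup>=) ^^ \<delta>)"
    unfolding hyperbolic_graph_def graph_dist_le_iff by blast
  have "slim \<delta> V (E\<^sup>=)"
    unfolding slim_def
  proof (intro allI impI)
    fix f a g b h c i
    assume geo: "geo (E\<^sup>=) f a" "geo (E\<^sup>=) g b" "geo (E\<^sup>=) h c" and eq: "f a = g 0" "g b = h 0" "h c = f 0"
      and V: "f 0 \<in> V" "g 0 \<in> V" "h 0 \<in> V" and i: "i \<le> a"
    have "f i \<in> set (map f [0..<Suc a])" using i by (auto simp: less_Suc_eq_le simp del: upt_Suc)
    then have "\<exists>v\<in>set (map g [0..<Suc b]) \<union> set (map h [0..<Suc c]). (f i, v) \<in> (E\<^sup>=) ^^ \<delta>"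
      using \<delta>[OF V] geodesic_of_geo[OF geo(1)] geodesic_of_geo[OF geo(2)] geodesic_of_geo[OF geo(3)] eq by metis
    moreover have "set [0..<Suc k] = {..k}" for k by auto
    ultimately show "\<exists>v\<in>g ` {..b} \<union> h ` {..c}. (f i, v) \<in> (E\<^sup>=) ^^ \<delta>"
      by (simp only: set_map)
  qed
  then show "\<exists>\<delta>. slim \<delta> V (E\<^sup>=)" by blast
next
  assume "\<exists>\<delta>. slim \<delta> V (E\<^sup>=)"
  then obtain \<delta> where \<delta>: "slim \<delta> V (E\<^sup>=)" by blast
  have "\<exists>v\<in>set q \<union> set r. graph_dist E u v \<le> enat \<delta>"
    if V: "x \<in> V" "y \<in> V" "z \<in> V" and geo: "geodesic E x y p" "geodesic E y z q" "geodesic E z x r"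
      and u: "u \<in> set p" for x y z p q r u
  proof -
    obtain i where i: "u = p ! i" "i \<le> length p - 1" using u by (fastforce simp: in_set_conv_nth)
    have "\<exists>v\<in>(!) q ` {..length q - 1} \<union> (!) r ` {..length r - 1}. (p ! i, v) \<in> (E\<^sup>=) ^^ \<delta>"
      using \<delta>[unfolded slim_def, rule_format, of "(!) p" "length p - 1" "(!) q" "length q - 1" "(!) r" "length r - 1" i]
        geo V i(2) unfolding geodesic_geo by simp
    moreover have "(!) s ` {..length s - 1} \<subseteq> set s" if "s \<noteq> []" for s
    proof clarify
      fix k assume "k \<le> length s - 1"
      then have "k < length s" using that by (cases s) auto
      then show "s ! k \<in> set s" by (rule nth_mem)
    qed
    ultimately show ?thesis
      using geo i unfolding graph_dist_le_iff geodesic_geo by blast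
  qed
  then show "hyperbolic_graph V E" unfolding hyperbolic_graph_def by blast
qed

lemma slim_image:
  assumes sl: "slim \<delta> V (E\<^sup>=)" and E: "E \<subseteq> V \<times> V" and inj: "inj_on f V"
  shows "slim \<delta> (f ` V) ((map_prod f f ` E)\<^sup>=)"
proof -
  let ?E = "map_prod f f ` E" and ?g = "inv_into V f"
  have pull: "(?g u, ?g v) \<in> E\<^sup>= \<and> v \<in> f ` V" if "u \<in> f ` V" "(u, v) \<in> ?E\<^sup>=" for u v
  proof (cases "u = v")
    case False
    then obtain a b where "(a, b) \<in> E" "u = f a" "v = f b" using \<open>(u, v) \<in> _\<close> by auto
    then show ?thesis using E inj by auto
  qed (use that in auto)
  have forth: "b \<in> V \<and> (f a, f b) \<in> ?E\<^sup>=" if "a \<in> V" "(a, b) \<in> E\<^sup>=" for a b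
    using that E by auto
  have inV: "p i \<in> f ` V" if "geo (?E\<^sup>=) p n" "p 0 \<in> f ` V" "i \<le> n" for p n i
    using that(3)
  proof (induction i)
    case 0
    then show ?case using that by simp
  next
    case (Suc i)
    then show ?case using that(1) pull[of "p i" "p (Suc i)"] by (auto simp: geo_def)
  qed
  have geo: "geo (E\<^sup>=) (\<lambda>i. ?g (p i)) n" if p: "geo (?E\<^sup>=) p n" "p 0 \<in> f ` V" for p n
    unfolding geo_def
  proof (intro conjI allI impI)
    fix i assume "i < n"
    then show "(?g (p i), ?g (p (Suc i))) \<in> E\<^sup>="
      using p pull[of "p i"] inV[OF p, of i] by (auto simp: geo_def)
  next
    fix m assume m: "m < n"
    have pn: "p n \<in> f ` V" using inV[OF p] by simp
    show "(?g (p 0), ?g (p n)) \<notin> (E\<^sup>=) ^^ m"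
    proof
      assume "(?g (p 0), ?g (p n)) \<in> (E\<^sup>=) ^^ m"
      then have "(f (?g (p 0)), f (?g (p n))) \<in> (?E\<^sup>=) ^^ m"
        using relpow_image[where V = V and f = f and W' = "?E\<^sup>="] forth inv_into_into[OF p(2)] by blast
      then show False using p pn m by (auto simp: geo_def f_inv_into_f)
    qed
  qed
  show ?thesis unfolding slim_def
  proof (intro allI impI)
    fix p a q b r c i
    assume g: "geo (?E\<^sup>=) p a" "geo (?E\<^sup>=) q b" "geo (?E\<^sup>=) r c"
      and eq: "p a = q 0" "q b = r 0" "r c = p 0"
      and V: "p 0 \<in> f ` V" "q 0 \<in> f ` V" "r 0 \<in> f ` V" and i: "i \<le> a"
    have "\<exists>v\<in>(\<lambda>i. ?g (q i)) ` {..b} \<union> (\<lambda>i. ?g (r i)) ` {..c}. (?g (p i), v) \<in> (E\<^sup>=) ^^ \<delta>"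
      using sl[unfolded slim_def, rule_format, OF geo[OF g(1) V(1)] geo[OF g(2) V(2)] geo[OF g(3) V(3)], of i]
        eq V i by (simp add: inv_into_into)
    then obtain w where w: "w \<in> q ` {..b} \<union> r ` {..c}" "(?g (p i), ?g w) \<in> (E\<^sup>=) ^^ \<delta>" by blast
    have c: "p i \<in> f ` V" "w \<in> f ` V"
      using inV[OF g(1) V(1) i] inV[OF g(2) V(2)] inV[OF g(3) V(3)] w(1) by auto
    have "(f (?g (p i)), f (?g w)) \<in> (?E\<^sup>=) ^^ \<delta>"
      using relpow_image[OF w(2), where V = V and f = f and W' = "?E\<^sup>="] forth inv_into_into[OF c(1)] by blast
    then show "\<exists>v\<in>q ` {..b} \<union> r ` {..c}. (p i, v) \<in> (?E\<^sup>=) ^^ \<delta>"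
      using w c by (auto simp: f_inv_into_f)
  qed
qed

text \<open>Close up with a third side of length at most 1 between the two starting points. If
  slimness points to that side, the point found is one of its two ends, and \<open>f 0\<close> is
  one step away from \<open>g 0\<close>; hence \<open>Suc \<delta>\<close>.\<close>

lemma slim_fellow:
  assumes sl: "slim \<delta> V W" and W: "Id \<subseteq> W" "sym W"
    and f: "geo W f n" and g: "geo W g m" and start: "(f 0, g 0) \<in> W" and finish: "f n = g m"
    and V: "f 0 \<in> V" "g 0 \<in> V" "f n \<in> V" and i: "i \<le> n"
  shows "\<exists>j\<le>m. (f i, g j) \<in> W ^^ Suc \<delta>"
proof -
  have "(g 0, f 0) \<in> W ^^ 1" using start W(2) by (auto simp: sym_def)
  from geo_exists[OF this] obtain e k where e: "geo W e k" "e 0 = g 0" "e k = f 0" "k \<le> 1" by blast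
  have "\<exists>v\<in>(\<lambda>j. g (m - j)) ` {..m} \<union> e ` {..k}. (f i, v) \<in> W ^^ \<delta>"
    using sl[unfolded slim_def, rule_format, OF f geo_rev[OF g W(2)] e(1), of i] e finish V i by simp
  then obtain v where v: "v \<in> (\<lambda>j. g (m - j)) ` {..m} \<union> e ` {..k}" "(f i, v) \<in> W ^^ \<delta>" by blast
  from v(1) consider j where "j \<le> m" "v = g (m - j)" | "v = g 0" | "v = f 0"
  proof
    assume "v \<in> e ` {..k}"
    then obtain l where "l \<le> k" "v = e l" by blast
    then have "l = 0 \<or> l = k" using e(4) by linarith
    then show ?thesis using e \<open>v = e l\<close> that by auto
  qed blast
  then show ?thesis
  proof cases
    case 1
    then show ?thesis using relpow_refl_mono[OF W(1), of \<delta> "Suc \<delta>" "f i" v] v(2)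
      by (intro exI[of _ "m - j"]) simp
  next
    case 2
    then show ?thesis using relpow_refl_mono[OF W(1), of \<delta> "Suc \<delta>" "f i" v] v(2)
      by (intro exI[of _ 0]) simp
  next
    case 3
    then show ?thesis using v(2) start by (intro exI[of _ 0]) auto
  qed
qed

text \<open>The triangle with sides \<open>f\<close>, \<open>g'\<close> and \<open>h'\<close> costs
  \<open>\<delta>\<close>. Passing from \<open>g'\<close> to \<open>g\<close> costs
  \<open>\<delta> + 1\<close> by \<open>slim_fellow\<close>; passing from \<open>h'\<close> to
  \<open>h\<close> goes through the diagonal \<open>e\<close> from \<open>h 0\<close> to
  \<open>f 0\<close> and costs this twice. The worse case is
  \<open>\<delta> + 2 * (\<delta> + 1) = 3 * \<delta> + 2\<close>.\<close>

lemma slim_hexagon: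
  assumes sl: "slim \<delta> V W" and W: "Id \<subseteq> W" "sym W"
    and f: "geo W f a" and g: "geo W g b" and h: "geo W h c"
    and adj: "(f a, g 0) \<in> W" "(g b, h 0) \<in> W" "(h c, f 0) \<in> W"
    and V: "f 0 \<in> V" "f a \<in> V" "g 0 \<in> V" "g b \<in> V" "h 0 \<in> V" "h c \<in> V" and i: "i \<le> a"
  shows "\<exists>v\<in>g ` {..b} \<union> h ` {..c}. (f i, v) \<in> W ^^ (3 * \<delta> + 2)"
proof -
  have path: "(p 0, p n) \<in> W ^^ n" if "geo W p n" for p n
    using path_relpow[of n p W 0 n] that by (auto simp: geo_def)
  have "(f a, g b) \<in> W ^^ Suc b" using path[OF g] adj(1) by (rule relpow_Suc_I2[rotated])
  from geo_exists[OF this] obtain g' b' where g': "geo W g' b'" "g' 0 = f a" "g' b' = g b" by blast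
  have hf: "(h 0, f 0) \<in> W ^^ Suc c" using path[OF h] adj(3) by (rule relpow_Suc_I)
  from geo_exists[OF this] obtain e k where e: "geo W e k" "e 0 = h 0" "e k = f 0" by blast
  have "(g b, f 0) \<in> W ^^ Suc (Suc c)" using adj(2) hf by (rule relpow_Suc_I2)
  from geo_exists[OF this] obtain h' c' where h': "geo W h' c'" "h' 0 = g b" "h' c' = f 0" by blast
  obtain v where v: "v \<in> g' ` {..b'} \<union> h' ` {..c'}" "(f i, v) \<in> W ^^ \<delta>"
    using sl[unfolded slim_def, rule_format, OF f g'(1) h'(1), of i] g' h' V i by auto
  have far: "(f i, y) \<in> W ^^ (3 * \<delta> + 2)" if "(v, y) \<in> W ^^ (Suc \<delta> + Suc \<delta>)" for y
  proof -
    have "(f i, y) \<in> W ^^ (\<delta> + (Suc \<delta> + Suc \<delta>))" using v(2) that unfolding relpow_add by blast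
    moreover have "\<delta> + (Suc \<delta> + Suc \<delta>) = 3 * \<delta> + 2" by simp
    ultimately show ?thesis by metis
  qed
  from v(1) show ?thesis
  proof
    assume "v \<in> g' ` {..b'}"
    then obtain j where j: "j \<le> b'" "v = g' j" by blast
    then obtain l where "l \<le> b" "(v, g l) \<in> W ^^ Suc \<delta>"
      using slim_fellow[OF sl W g'(1) g, of j] g' adj(1) V by auto
    then show ?thesis
      using far[of "g l"] relpow_refl_mono[OF W(1), of "Suc \<delta>" "Suc \<delta> + Suc \<delta>"]
      by (intro bexI[of _ "g l"]) auto
  next
    assume "v \<in> h' ` {..c'}"
    then obtain j where j: "j \<le> c'" "v = h' j" by blast
    then obtain l where l: "l \<le> k" "(v, e l) \<in> W ^^ Suc \<delta>"
      using slim_fellow[OF sl W h'(1) e(1), of j] h' e adj(2) V by auto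
    have "(f 0, h c) \<in> W" using adj(3) W(2) by (auto simp: sym_def)
    then obtain l' where l': "l' \<le> c" "(e (k - (k - l)), h (c - l')) \<in> W ^^ Suc \<delta>"
      using slim_fellow[OF sl W geo_rev[OF e(1) W(2)] geo_rev[OF h W(2)], of "k - l"] e V by auto
    then have "(v, h (c - l')) \<in> W ^^ (Suc \<delta> + Suc \<delta>)"
      using l unfolding relpow_add by auto
    then show ?thesis using far by (intro bexI[of _ "h (c - l')"]) auto
  qed
qed

text \<open>
  A piece \<open>P\<close> of the graph such that each component of the complement is attached to \<open>P\<close> along a gate of
  diameter at most 1.
\<close>

locale gated_piece =
  fixes W :: "('v \<times> 'v) set" and P :: "'v set" and \<pi> :: "'v \<Rightarrow> 'v set"
  assumes W_refl: "Id \<subseteq> W" and W_sym: "sym W"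
    and out: "(u, v) \<in> W \<Longrightarrow> u \<notin> P \<Longrightarrow> v \<notin> P \<Longrightarrow> \<pi> u = \<pi> v"
    and leave: "(u, v) \<in> W \<Longrightarrow> u \<in> P \<Longrightarrow> v \<notin> P \<Longrightarrow> u \<in> \<pi> v"
    and gate: "v \<notin> P \<Longrightarrow> a \<in> \<pi> v \<Longrightarrow> b \<in> \<pi> v \<Longrightarrow> (a, b) \<in> W"
    and gate_P: "v \<notin> P \<Longrightarrow> \<pi> v \<subseteq> P"
begin

text \<open>Extending \<open>\<pi>\<close> by singletons over \<open>P\<close> treats corners inside
  and outside the piece alike.\<close>

definition gates :: "'v \<Rightarrow> 'v set" where
  "gates v = (if v \<in> P then {v} else \<pi> v)"

definition WP :: "('v \<times> 'v) set" where
  "WP = (W \<inter> P \<times> P) \<union> Id"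

lemma WP_refl: "Id \<subseteq> WP" and WP_sym: "sym WP" and WP_W: "WP \<subseteq> W"
  using W_sym W_refl by (auto simp: WP_def sym_def)

lemma gates_adj: "a \<in> gates v \<Longrightarrow> b \<in> gates v \<Longrightarrow> (a, b) \<in> WP"
  using gate gate_P[of v] by (auto simp: gates_def WP_def split: if_splits)

lemma outside_path:
  assumes "\<forall>i<n. (f i, f (Suc i)) \<in> W" "\<And>i. i \<le> n \<Longrightarrow> f i \<notin> P" "i \<le> n"
  shows "\<pi> (f i) = \<pi> (f 0)"
  using assms(3)
proof (induction i)
  case (Suc i)
  then show ?case using out[of "f i" "f (Suc i)"] assms(1,2) by simp
qed simp

lemma first_hit:
  assumes p: "\<forall>i<n. (f i, f (Suc i)) \<in> W" and k: "k \<le> n" "f k \<in> P"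
  shows "\<exists>i\<le>k. f i \<in> P \<and> f i \<in> gates (f 0) \<and> (\<forall>j<i. f j \<notin> P)"
proof -
  define i where "i = (LEAST i. f i \<in> P)"
  have i: "f i \<in> P" "i \<le> k" "\<And>j. j < i \<Longrightarrow> f j \<notin> P"
    unfolding i_def using k by (auto intro: LeastI Least_le dest: not_less_Least)
  have "f i \<in> gates (f 0)"
  proof (cases i)
    case (Suc l)
    have "\<pi> (f l) = \<pi> (f 0)" using outside_path[of l f l] p i(3) k i(2) Suc by auto
    moreover have "(f (Suc l), f l) \<in> W" using p i(2) k Suc W_sym by (auto simp: sym_def)
    ultimately show ?thesis using leave[of "f (Suc l)" "f l"] i Suc by (auto simp: gates_def)
  qed (use i in \<open>auto simp: gates_def\<close>)
  then show ?thesis using i by blast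
qed

text \<open>An excursion leaves and re-enters through one gate. The two gate points are at distance
  at most 1, yet at least 2 apart on the geodesic because a point outside \<open>P\<close> lies
  strictly between them.\<close>

lemma geo_convex:
  assumes f: "geo W f n" and ik: "i \<le> j" "j \<le> k" "k \<le> n" "f i \<in> P" "f k \<in> P"
  shows "f j \<in> P"
proof (rule ccontr)
  assume j: "f j \<notin> P"
  have p: "\<forall>i<n. (f i, f (Suc i)) \<in> W" using f by (simp add: geo_def)
  have "\<forall>i<n - j. (f (j + i), f (j + Suc i)) \<in> W" using p by auto
  then obtain t where t: "t \<le> k - j" "f (j + t) \<in> gates (f j)" "f (j + t) \<in> P"
    using first_hit[of "n - j" "\<lambda>i. f (j + i)" "k - j"] ik diff_le_mono[OF ik(3), of j] by auto
  have rev: "(f (j - i'), f (j - Suc i')) \<in> W" if "i' < j" for i'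
  proof -
    have "(f (j - Suc i'), f (Suc (j - Suc i'))) \<in> W" using p that ik by auto
    then show ?thesis using W_sym that by (auto simp: sym_def Suc_diff_Suc)
  qed
  then obtain s where s: "s \<le> j - i" "f (j - s) \<in> gates (f j)" "f (j - s) \<in> P"
    using first_hit[of j "\<lambda>i. f (j - i)" "j - i"] ik by auto
  have "t \<noteq> 0" "s \<noteq> 0" using t s j by (auto intro: ccontr)
  have adj: "(f (j - s), f (j + t)) \<in> W ^^ 1" using gates_adj[OF s(2) t(2)] WP_W by auto
  have "1 < (j + t) - (j - s)" using \<open>t \<noteq> 0\<close> \<open>s \<noteq> 0\<close> s ik by linarith
  then show False using geo_far[OF f, of "j - s" "j + t" 1] adj t(1) ik by auto
qed

lemma geo_piece:
  assumes f: "geo W f n" and hit: "k0 \<le> n" "f k0 \<in> P"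
  obtains i j where "i \<le> j" "j \<le> n" "\<And>k. k \<le> n \<Longrightarrow> f k \<in> P \<longleftrightarrow> i \<le> k \<and> k \<le> j"
    "f i \<in> gates (f 0)" "f j \<in> gates (f n)" "geo WP (\<lambda>k. f (i + k)) (j - i)"
proof -
  have p: "\<forall>i<n. (f i, f (Suc i)) \<in> W" using f by (simp add: geo_def)
  obtain i where i: "i \<le> k0" "f i \<in> P" "f i \<in> gates (f 0)" "\<And>j. j < i \<Longrightarrow> f j \<notin> P"
    using first_hit[OF p hit] by blast
  have "\<forall>i<n. (f (n - i), f (n - Suc i)) \<in> W"
    using geo_rev[OF f W_sym] by (simp add: geo_def)
  then obtain l where l: "l \<le> n - k0" "f (n - l) \<in> P" "f (n - l) \<in> gates (f n)"
    "\<And>j. j < l \<Longrightarrow> f (n - j) \<notin> P"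
    using first_hit[of n "\<lambda>i. f (n - i)" "n - k0"] hit by auto
  let ?j = "n - l"
  have ij: "i \<le> ?j" "?j \<le> n" using i l hit by auto
  have iff: "f k \<in> P \<longleftrightarrow> i \<le> k \<and> k \<le> ?j" if "k \<le> n" for k
  proof
    assume k: "f k \<in> P"
    then have "\<not> k < i" using i(4) by blast
    moreover have "\<not> n - k < l" using l(4)[of "n - k"] k that by auto
    ultimately show "i \<le> k \<and> k \<le> ?j" using that by auto
  next
    assume "i \<le> k \<and> k \<le> ?j"
    then show "f k \<in> P" using geo_convex[OF f _ _ ij(2) i(2) l(2)] by blast
  qed
  have sub: "geo W (\<lambda>k. f (i + k)) (?j - i)" using geo_sub[OF f] ij by simp
  have inP: "f (i + k) \<in> P" if "k \<le> ?j - i" for k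
    using that ij iff[of "i + k"] by auto
  have sub: "geo WP (\<lambda>k. f (i + k)) (?j - i)"
    unfolding geo_def
  proof (intro conjI allI impI)
    fix k assume "k < ?j - i"
    then show "(f (i + k), f (i + Suc k)) \<in> WP"
      using sub inP[of "Suc k"]
        inP[of k] by (auto simp: geo_def WP_def)
  next
    fix m assume "m < ?j - i"
    then show "(f (i + 0), f (i + (?j - i))) \<notin> WP ^^ m"
      using sub relpow_subset[OF WP_W, of m] by (auto simp: geo_def)
  qed
  then show ?thesis using that ij iff i l by blast
qed

lemma geo_miss:
  assumes "geo W f n" "\<And>i. i \<le> n \<Longrightarrow> f i \<notin> P"
  shows "\<pi> (f n) = \<pi> (f 0)" "gates (f n) = gates (f 0)"
  using outside_path[of n f n] assms by (auto simp: geo_def gates_def)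

lemma geo_const: "geo WP (\<lambda>_. x) 0"
  by (simp add: geo_def)

text \<open>The parts of the sides inside \<open>P\<close> form a hexagon. A side that misses
  \<open>P\<close> has the same gate at both ends and is replaced by a constant path at an end of
  the part of the other side. If both other sides miss \<open>P\<close>, then \<open>f\<close>
  enters and leaves through the gate of \<open>f 0\<close>; its part is the single edge at
  \<open>i\<close> with both ends in that gate, which is what \<open>no\<close> excludes.\<close>

lemma slim_near_piece:
  assumes sl: "slim \<delta> P WP"
    and f: "geo W f a" and g: "geo W g b" and h: "geo W h c"
    and eq: "f a = g 0" "g b = h 0" "h c = f 0"
    and i: "i < a" "f i \<in> P" "f (Suc i) \<in> P"
    and no: "\<not> (f 0 \<notin> P \<and> f i \<in> \<pi> (f 0) \<and> f (Suc i) \<in> \<pi> (f 0))"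
  shows "\<exists>v\<in>g ` {..b} \<union> h ` {..c}. (f i, v) \<in> W ^^ (3 * \<delta> + 2)"
proof -
  have inW: "(x, y) \<in> W ^^ m" if "(x, y) \<in> WP ^^ m" for x y m
    using relpow_subset[OF WP_W] that by blast
  obtain i0 j0 where F: "i0 \<le> j0" "j0 \<le> a" "\<And>k. k \<le> a \<Longrightarrow> f k \<in> P \<longleftrightarrow> i0 \<le> k \<and> k \<le> j0"
    "f i0 \<in> gates (f 0)" "f j0 \<in> gates (f a)" "geo WP (\<lambda>k. f (i0 + k)) (j0 - i0)"
    using geo_piece[OF f _ i(2)] i(1) by auto
  have i0: "i0 \<le> i" "Suc i \<le> j0" using F(3)[of i] F(3)[of "Suc i"] i by auto
  have PF: "f i0 \<in> P" "f j0 \<in> P" using F by auto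
  note hex = slim_hexagon[OF sl WP_refl WP_sym F(6)]
  have sub: "\<exists>v\<in>p ` {..b'} \<union> q ` {..c'}. (f i, v) \<in> WP ^^ (3 * \<delta> + 2)"
    if "geo WP p b'" "geo WP q c'" "(f j0, p 0) \<in> WP" "(p b', q 0) \<in> WP" "(q c', f i0) \<in> WP"
      "p 0 \<in> P" "p b' \<in> P" "q 0 \<in> P" "q c' \<in> P" for p b' q c'
    using hex[OF that(1,2), of "i - i0"] that F(1) PF i0 by auto
  have refl: "(x, x) \<in> WP" for x using WP_refl by auto
  have part: "(\<lambda>k. p (i + k)) ` {..j - i} \<subseteq> p ` {..n}" if "i \<le> j" "j \<le> n" for p :: "nat \<Rightarrow> 'v" and i j n
    using that by auto
  show ?thesis
  proof (cases "\<exists>k\<le>b. g k \<in> P")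
    case True
    then obtain i1 j1 where B: "i1 \<le> j1" "j1 \<le> b" "\<And>k. k \<le> b \<Longrightarrow> g k \<in> P \<longleftrightarrow> i1 \<le> k \<and> k \<le> j1"
      "g i1 \<in> gates (g 0)" "g j1 \<in> gates (g b)" "geo WP (\<lambda>k. g (i1 + k)) (j1 - i1)"
      using geo_piece[OF g] by metis
    have PB: "g i1 \<in> P" "g j1 \<in> P" using B by auto
    show ?thesis
    proof (cases "\<exists>k\<le>c. h k \<in> P")
      case True
      then obtain i2 j2 where C: "i2 \<le> j2" "j2 \<le> c" "\<And>k. k \<le> c \<Longrightarrow> h k \<in> P \<longleftrightarrow> i2 \<le> k \<and> k \<le> j2"
        "h i2 \<in> gates (h 0)" "h j2 \<in> gates (h c)" "geo WP (\<lambda>k. h (i2 + k)) (j2 - i2)"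
        using geo_piece[OF h] by metis
      have "h i2 \<in> P" "h j2 \<in> P" using C by auto
      then have "\<exists>v\<in>(\<lambda>k. g (i1 + k)) ` {..j1 - i1} \<union> (\<lambda>k. h (i2 + k)) ` {..j2 - i2}. (f i, v) \<in> WP ^^ (3 * \<delta> + 2)"
        using sub[OF B(6) C(6)] gates_adj[OF F(5)] B gates_adj[OF B(5)] C gates_adj[OF C(5)] F eq PB by simp
      then show ?thesis using inW part[OF B(1,2), of g] part[OF C(1,2), of h] by blast
    next
      case False
      then have "gates (h c) = gates (h 0)" using geo_miss(2)[OF h] by blast
      then have "\<exists>v\<in>(\<lambda>k. g (i1 + k)) ` {..j1 - i1} \<union> (\<lambda>_. g j1) ` {..0::nat}. (f i, v) \<in> WP ^^ (3 * \<delta> + 2)"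
        using sub[OF B(6) geo_const[of "g j1"]] gates_adj[OF F(5)] B gates_adj[OF B(5)] F eq PB refl by simp
      moreover have "g j1 \<in> g ` {..b}" using B(2) by blast
      ultimately show ?thesis using inW part[OF B(1,2), of g] by blast
    qed
  next
    case gF: False
    then have g_eq: "gates (g b) = gates (g 0)" "\<pi> (g b) = \<pi> (g 0)" using geo_miss[OF g] by blast+
    show ?thesis
    proof (cases "\<exists>k\<le>c. h k \<in> P")
      case True
      then obtain i2 j2 where C: "i2 \<le> j2" "j2 \<le> c" "\<And>k. k \<le> c \<Longrightarrow> h k \<in> P \<longleftrightarrow> i2 \<le> k \<and> k \<le> j2"
        "h i2 \<in> gates (h 0)" "h j2 \<in> gates (h c)" "geo WP (\<lambda>k. h (i2 + k)) (j2 - i2)"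
        using geo_piece[OF h] by metis
      have "h i2 \<in> P" "h j2 \<in> P" using C by auto
      then have "\<exists>v\<in>(\<lambda>_. h i2) ` {..0::nat} \<union> (\<lambda>k. h (i2 + k)) ` {..j2 - i2}. (f i, v) \<in> WP ^^ (3 * \<delta> + 2)"
        using sub[OF geo_const[of "h i2"] C(6)] gates_adj[OF F(5)] g_eq C gates_adj[OF C(5)] F eq refl \<open>h i2 \<in> P\<close> \<open>h j2 \<in> P\<close> by simp
      moreover have "h i2 \<in> h ` {..c}" using C(1,2) by auto
      ultimately show ?thesis using inW part[OF C(1,2), of h] by blast
    next
      case False
      then have "\<pi> (h c) = \<pi> (h 0)" using geo_miss(1)[OF h] by blast
      then have \<pi>: "\<pi> (f a) = \<pi> (f 0)" using g_eq eq by simp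
      have outs: "f 0 \<notin> P" "f a \<notin> P" using False eq gF by (metis order_refl le0)+
      then have m: "f i0 \<in> \<pi> (f 0)" "f j0 \<in> \<pi> (f 0)" using F \<pi> by (auto simp: gates_def)
      then have "(f i0, f j0) \<in> W ^^ 1" using gate[OF outs(1)] by auto
      then have "\<not> 1 < j0 - i0" using geo_far[OF f F(1,2), of 1] by blast
      then have "i = i0" "Suc i = j0" using i0 by auto
      then show ?thesis using no outs(1) m by metis
    qed
  qed
qed

end

lemma slim_complete: "slim 0 V (V \<times> V \<union> Id)"
  unfolding slim_def
proof (intro allI impI)
  let ?W = "V \<times> V \<union> Id"
  fix f :: "nat \<Rightarrow> 'a" and a g b h and c i :: nat
  assume f: "geo ?W f a" and eq: "f a = g (0::nat)" "h c = f 0" and V: "f 0 \<in> V" "g 0 \<in> V" and i: "i \<le> a"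
  have "\<not> 1 < a" using f V eq by (auto simp: geo_def)
  then have "i = 0 \<or> i = a" using i by linarith
  moreover have "f 0 \<in> h ` {..c}" "f a \<in> g ` {..b}"
    unfolding eq(1) eq(2)[symmetric] by auto
  ultimately show "\<exists>v\<in>g ` {..b} \<union> h ` {..c}. (f i, v) \<in> ?W ^^ 0" by auto
qed

section \<open>Gates of the factors and of \<open>K\<close>\<close>

context tree_split begin

lemma B_mult_N:
  assumes "x \<in> N i" "b \<in> B i"
  shows "b \<otimes> x \<in> N i"
proof -
  have bc: "b \<in> carrier G" and xc: "x \<in> carrier G" using assms B_carrier N_carrier by blast+
  from xc have "x \<in> N i \<longrightarrow> b \<otimes> x \<in> N i"
  proof (induction rule: gen_induct)
    case one
    then show ?case using N_not_B subgroup.one_closed[OF B] by blast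
  next
    case (mult y s j)
    have sc: "s \<in> carrier G" using mult A_carrier by blast
    show ?case
    proof
      assume ys: "y \<otimes> s \<in> N i"
      have eq: "b \<otimes> (y \<otimes> s) = b \<otimes> y \<otimes> s" using bc sc mult by (simp add: m_assoc)
      from back_step[OF mult.hyps ys] show "b \<otimes> (y \<otimes> s) \<in> N i"
      proof
        assume "y \<in> N i"
        then have "b \<otimes> (y \<otimes> s) \<in> N i \<union> B i" using mult N_step unfolding eq by blast
        moreover have "b \<otimes> (y \<otimes> s) \<notin> B i"
          using mult_in_right_iff[OF B bc _ assms(2)] N_not_B[OF ys] mult sc by simp
        ultimately show ?thesis by blast
      next
        assume y: "y \<in> B i"
        then have "b \<otimes> y \<in> B i" using subgroup.m_closed[OF B assms(2)] by blast
        then show ?thesis using N_leave[OF _ mult.hyps(2)] y ys unfolding eq by blast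
      qed
    qed
  qed
  then show ?thesis using assms by blast
qed

text \<open>The points \<open>a\<close> of the factor such that \<open>x\<close> is beyond
  \<open>a \<otimes> B i\<close>. By \<open>gate_A_diff\<close> they lie in a single left coset of
  \<open>B i\<close>.\<close>

definition gate_A :: "bool \<Rightarrow> 'a \<Rightarrow> 'a set" where
  "gate_A i x = {a \<in> A i. x \<in> carrier G \<and> inv a \<otimes> x \<in> M i}"

definition gate_K :: "'a \<Rightarrow> 'a set" where
  "gate_K x = {k \<in> K. \<exists>i. inv k \<otimes> x \<in> N i}"

text \<open>The translate of \<open>M i\<close> by \<open>a\<close> can be left only through a coset
  of \<open>B i\<close> inside \<open>A i\<close>, so a step that ends outside \<open>A i\<close>
  loses no gate. The opposite inclusion comes from the reversed edge.\<close>

lemma gate_A_subset_step: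
  assumes u: "u \<in> carrier G" and s: "s \<in> A j \<union> K" and out: "u \<otimes> s \<notin> A i"
  shows "gate_A i u \<subseteq> gate_A i (u \<otimes> s)"
proof
  fix a assume "a \<in> gate_A i u"
  then have a: "a \<in> A i" "inv a \<otimes> u \<in> M i" by (auto simp: gate_A_def)
  have c: "a \<in> carrier G" "s \<in> carrier G" using a A_carrier s step_carrier by blast+
  then have eq: "inv a \<otimes> (u \<otimes> s) = inv a \<otimes> u \<otimes> s" using u by (simp add: m_assoc)
  have "inv a \<otimes> (u \<otimes> s) \<notin> B i"
    using mult_in_right_iff[OF A, of "inv a" "u \<otimes> s" i] B_A[of i] out a c u
      subgroup.m_inv_closed[OF A a(1)] by auto
  then have "inv a \<otimes> (u \<otimes> s) \<in> M i" using M_step[OF a(2) s] eq by auto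
  then show "a \<in> gate_A i (u \<otimes> s)" using a u c by (simp add: gate_A_def)
qed

lemma gate_K_subset_step:
  assumes u: "u \<in> carrier G" and s: "s \<in> A j \<union> K" and out: "u \<otimes> s \<notin> K"
  shows "gate_K u \<subseteq> gate_K (u \<otimes> s)"
proof
  fix k assume "k \<in> gate_K u"
  then obtain i where k: "k \<in> K" "inv k \<otimes> u \<in> N i" by (auto simp: gate_K_def)
  have c: "k \<in> carrier G" "s \<in> carrier G" using k K_carrier s step_carrier by blast+
  then have eq: "inv k \<otimes> (u \<otimes> s) = inv k \<otimes> u \<otimes> s" using u by (simp add: m_assoc)
  have "inv k \<otimes> (u \<otimes> s) \<notin> B i"
    using mult_in_right_iff[OF K_subgroup, of "inv k" "u \<otimes> s"] B_K[of i] out k c u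
      subgroup.m_inv_closed[OF K_subgroup k(1)] by auto
  then have "inv k \<otimes> (u \<otimes> s) \<in> N i" using step[OF k(2) s] eq by auto
  then show "k \<in> gate_K (u \<otimes> s)" using k by (auto simp: gate_K_def)
qed

lemma gate_A_leave:
  assumes "u \<in> A i" "s \<in> A j \<union> K" "u \<otimes> s \<notin> A i"
  shows "u \<in> gate_A i (u \<otimes> s)"
proof -
  have c: "u \<in> carrier G" "s \<in> carrier G" using assms A_carrier step_carrier by blast+
  then have "s \<notin> A i" using assms mult_in_right_iff[OF A] by blast
  then have "s \<in> M i" using assms(2) M_outside_A by blast
  moreover have "inv u \<otimes> (u \<otimes> s) = s" using c by (simp add: m_assoc[symmetric])
  ultimately show ?thesis using assms(1) c by (simp add: gate_A_def)
qed

lemma gate_K_leave: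
  assumes "u \<in> K" "s \<in> A j \<union> K" "u \<otimes> s \<notin> K"
  shows "u \<in> gate_K (u \<otimes> s)"
proof -
  have c: "u \<in> carrier G" "s \<in> carrier G" using assms K_carrier step_carrier by blast+
  then have "s \<notin> K" using assms mult_in_right_iff[OF K_subgroup] by blast
  then have "s \<in> N j" using assms(2) A_K A_N_iff by blast
  moreover have "inv u \<otimes> (u \<otimes> s) = s" using c by (simp add: m_assoc[symmetric])
  ultimately show ?thesis using assms(1) by (auto simp: gate_K_def)
qed

text \<open>If \<open>a\<close> and \<open>b\<close> lay in different cosets of \<open>B i\<close>,
  ping-pong with \<open>inv a \<otimes> b\<close> would move \<open>inv b \<otimes> x\<close> to
  \<open>inv a \<otimes> x\<close> in \<open>N i\<close>, but this point is in
  \<open>M i\<close>.\<close>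

lemma gate_A_diff:
  assumes "a \<in> gate_A i x" "b \<in> gate_A i x"
  shows "inv a \<otimes> b \<in> B i"
proof (rule ccontr)
  assume n: "inv a \<otimes> b \<notin> B i"
  have ab: "a \<in> A i" "b \<in> A i" and x: "x \<in> carrier G" using assms by (auto simp: gate_A_def)
  then have c: "a \<in> carrier G" "b \<in> carrier G" using A_carrier by blast+
  have "inv a \<otimes> b \<in> A i" using ab by (meson A subgroup.m_closed subgroup.m_inv_closed)
  then have "(inv a \<otimes> b) \<otimes> (inv b \<otimes> x) \<in> N i"
    using N_mult_A[of "inv a \<otimes> b" i "inv b \<otimes> x"] n assms by (auto simp: gate_A_def)
  moreover have "b \<otimes> (inv b \<otimes> x) = x" using c x by (simp add: m_assoc[symmetric])
  then have "(inv a \<otimes> b) \<otimes> (inv b \<otimes> x) = inv a \<otimes> x" using c x by (simp add: m_assoc)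
  ultimately show False using assms(1) by (auto simp: gate_A_def M_def)
qed

text \<open>
  An edge can lie in two pieces at once; the gate condition rules out the piece on whose far side \<open>x\<close> lies.
\<close>

lemma gate_cases:
  assumes s: "s \<in> A j \<union> K" and x: "x \<in> carrier G"
  shows "(\<exists>i. s \<in> A i \<and> \<not> (\<one> \<in> gate_A i x \<and> s \<in> gate_A i x)) \<or>
    (s \<in> K \<and> \<not> (\<one> \<in> gate_K x \<and> s \<in> gate_K x))"
proof (cases "s \<in> K")
  case False
  then have sA: "s \<in> A j" using s by blast
  have "\<not> (\<one> \<in> gate_A j x \<and> s \<in> gate_A j x)"
    using gate_A_diff[of \<one> j x s] B_K[of j] False step_carrier[OF s] by auto
  then show ?thesis using sA by blast
next
  case True
  show ?thesis
  proof (cases "\<one> \<in> gate_K x \<and> s \<in> gate_K x")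
    case both: True
    then obtain i l where il: "x \<in> N i" "inv s \<otimes> x \<in> N l" using x by (auto simp: gate_K_def)
    have "inv s \<in> K" using True subgroup.m_inv_closed[OF K_subgroup] by blast
    then have "inv s \<in> B i" using K_mult_N[OF il(1) _ il(2)] by blast
    then have "s \<in> B i" using True K_carrier B_inv_iff by blast
    \<comment> \<open>The far side of the gate of \<open>K\<close> at this edge is the near side for
      \<open>A i\<close>, so the edge can be charged to the factor.\<close>
    moreover have "\<one> \<notin> gate_A i x" using il x by (auto simp: gate_A_def M_def)
    ultimately show ?thesis using B_A by blast
  qed (use True in blast)
qed

end

section \<open>Slim triangles in the relative Cayley graph of the amalgam\<close>

context tree_words begin

abbreviation adj :: "('a \<times> 'a) set" where
  "adj \<equiv> (cayley_adj G S \<H>)\<^sup>="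

definition factor_adj :: "bool \<Rightarrow> ('a \<times> 'a) set" where
  "factor_adj i = {(u, u \<otimes> letter_val G a) | u a. u \<in> A i \<and> a \<in> L i}"

text \<open>Vertices and labels of the deleted edges are separate arguments: in a factor, the edge
  group \<open>B i\<close> carries labels \<open>Sub K\<close>. For the other members of the
  collection both arguments are \<open>H\<close>.\<close>

definition factor_hat :: "bool \<Rightarrow> 'a set \<Rightarrow> 'a set \<Rightarrow> ('a \<times> 'a) set" where
  "factor_hat i Q H = {(u, u \<otimes> letter_val G a) | u a. u \<in> A i \<and> a \<in> L i \<and>
     \<not> (u \<in> Q \<and> u \<otimes> letter_val G a \<in> Q \<and> a \<in> range (Sub H))}"

lemma inverse_letter:
  assumes "a \<in> W.\<A>"
  obtains b where "b \<in> W.\<A>" "letter_val G b = inv (letter_val G a)" "\<And>H. b \<in> range (Sub H) \<longleftrightarrow> a \<in> range (Sub H)"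
proof (cases a)
  case (Gen s)
  then show ?thesis using that[of "GenInv s"] assms by (auto simp: rel_alphabet_iff)
next
  case (GenInv s)
  then have "s \<in> carrier G" using assms W.S_carrier by (auto simp: rel_alphabet_iff)
  then show ?thesis using that[of "Gen s"] GenInv assms by (auto simp: rel_alphabet_iff)
next
  case (Sub H h)
  then have h: "H \<in> \<H>" "h \<in> H" "h \<noteq> \<one>" "subgroup H G" using assms W.pair by (auto simp: rel_alphabet_iff group_pair_def)
  then have "h \<in> carrier G" by (auto dest: subgroup.mem_carrier)
  then have "Sub H (inv h) \<in> W.\<A>" using h by (auto simp: rel_alphabet_iff subgroup.m_inv_closed)
  then show ?thesis using that[of "Sub H (inv h)"] Sub by auto
qed

lemma adj_sym: "sym adj"
proof (rule symI)
  fix u v assume uv: "(u, v) \<in> adj"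
  show "(v, u) \<in> adj"
  proof (cases "u = v")
    case False
    then obtain a where a: "u \<in> carrier G" "a \<in> W.\<A>" "v = u \<otimes> letter_val G a"
      using uv by (auto simp: cayley_adj_def)
    note c = W.letter_val_closed[OF a(2)]
    obtain b where b: "b \<in> W.\<A>" "letter_val G b = inv (letter_val G a)" by (rule inverse_letter[OF a(2)])
    have "u = v \<otimes> letter_val G b" "v \<in> carrier G" using a b c by (auto simp: m_assoc)
    then show ?thesis using b(1) by (auto simp: cayley_adj_def)
  qed simp
qed

lemma adjE:
  assumes "(u, v) \<in> adj" "u \<noteq> v"
  obtains a j where "u \<in> carrier G" "a \<in> W.\<A>" "v = u \<otimes> letter_val G a" "letter_val G a \<in> A j \<union> K" "v \<in> carrier G"
proof -
  obtain a where a: "u \<in> carrier G" "a \<in> W.\<A>" "v = u \<otimes> letter_val G a"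
    using assms by (auto simp: cayley_adj_def)
  obtain j where j: "letter_val G a \<in> A j \<union> K" by (rule letter_val_AK[OF a(2)])
  have "v \<in> carrier G" using a W.letter_val_closed[OF a(2)] by simp
  then show ?thesis using that[OF a j] by blast
qed

lemma K_adj: "k \<in> K \<Longrightarrow> u \<in> carrier G \<Longrightarrow> (u, u \<otimes> k) \<in> adj"
proof (cases "k = \<one>")
  case False
  assume "k \<in> K" "u \<in> carrier G"
  then have "Sub K k \<in> W.\<A>" using False K_in by (simp add: rel_alphabet_iff)
  then show ?thesis using \<open>u \<in> carrier G\<close> by (force simp: cayley_adj_def)
qed simp

lemma gated_A: "gated_piece adj (A i) (gate_A i)"
proof
  show "gate_A i u = gate_A i v" if "(u, v) \<in> adj" "u \<notin> A i" "v \<notin> A i" for u v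
  proof -
    have *: "gate_A i u \<subseteq> gate_A i v" if "(u, v) \<in> adj" "v \<notin> A i" for u v
    proof (cases "u = v")
      case False
      show ?thesis using adjE[OF that(1) False] gate_A_subset_step that(2) by metis
    qed simp
    show ?thesis using *[of u v] *[of v u] that adj_sym by (auto dest: symD)
  qed
  show "u \<in> gate_A i v" if "(u, v) \<in> adj" "u \<in> A i" "v \<notin> A i" for u v
  proof -
    have "u \<noteq> v" using that by blast
    then show ?thesis using adjE[OF that(1)] gate_A_leave that by metis
  qed
  show "(a, b) \<in> adj" if "a \<in> gate_A i v" "b \<in> gate_A i v" for a b v
  proof -
    have c: "a \<in> carrier G" "b \<in> carrier G" using that A_carrier by (auto simp: gate_A_def)
    have "inv a \<otimes> b \<in> K" using gate_A_diff[OF that] B_K by blast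
    moreover have "b = a \<otimes> (inv a \<otimes> b)" using c by (simp add: m_assoc[symmetric])
    ultimately show ?thesis using K_adj[of "inv a \<otimes> b" a] c by simp
  qed
qed (use adj_sym in \<open>auto simp: gate_A_def\<close>)

end


section \<open>Hyperbolically embedded collections\<close>

lemma slim_mono: "slim \<delta> V W \<Longrightarrow> Id \<subseteq> W \<Longrightarrow> \<delta> \<le> \<delta>' \<Longrightarrow> slim \<delta>' V W"
  unfolding slim_def by (meson relpow_refl_mono)

lemma hyp_embeddedE:
  assumes "\<H> \<hookrightarrow>\<^sub>h G"
  obtains X where "X \<subseteq> carrier G" "generate G (X \<union> \<Union>\<H>) = carrier G"
    "hyperbolic_graph (carrier G) (cayley_adj G X \<H>)"
    "\<forall>H\<in>\<H>. \<forall>h\<in>H. \<forall>n::nat. finite {h' \<in> H. hat_dist G X \<H> H h h' \<le> enat n}"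
proof -
  from assms[unfolded hyp_embedded_def, THEN conjunct2] obtain X where X: "X \<subseteq> carrier G \<and>
    generate G (X \<union> \<Union>\<H>) = carrier G \<and> hyperbolic_graph (carrier G) (cayley_adj G X \<H>) \<and>
    (\<forall>H\<in>\<H>. \<forall>h\<in>H. \<forall>n::nat. finite {h' \<in> H. hat_dist G X \<H> H h h' \<le> enat n})"
    by (rule exE)
  show ?thesis by (rule that[of X]) (simp_all add: X)
qed

context tree_words begin

lemma gated_K: "gated_piece adj K gate_K"
proof
  show "gate_K u = gate_K v" if "(u, v) \<in> adj" "u \<notin> K" "v \<notin> K" for u v
  proof -
    have *: "gate_K u \<subseteq> gate_K v" if "(u, v) \<in> adj" "v \<notin> K" for u v
    proof (cases "u = v")
      case False
      show ?thesis using adjE[OF that(1) False] gate_K_subset_step that(2) by metis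
    qed simp
    show ?thesis using *[of u v] *[of v u] that adj_sym by (auto dest: symD)
  qed
  show "u \<in> gate_K v" if "(u, v) \<in> adj" "u \<in> K" "v \<notin> K" for u v
  proof -
    have "u \<noteq> v" using that by blast
    then show ?thesis using adjE[OF that(1)] gate_K_leave that by metis
  qed
  show "(a, b) \<in> adj" if "a \<in> gate_K v" "b \<in> gate_K v" for a b v
  proof -
    have ab: "a \<in> K" "b \<in> K" using that by (auto simp: gate_K_def)
    then have c: "a \<in> carrier G" "b \<in> carrier G" using K_carrier by blast+
    have "inv a \<otimes> b \<in> K" using ab by (meson K_subgroup subgroup.m_closed subgroup.m_inv_closed)
    moreover have "b = a \<otimes> (inv a \<otimes> b)" using c by (simp add: m_assoc[symmetric])
    ultimately show ?thesis using K_adj[of "inv a \<otimes> b" a] c by simp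
  qed
qed (use adj_sym in \<open>auto simp: gate_K_def\<close>)

lemma adj_translate:
  assumes "(u, v) \<in> adj" "t \<in> carrier G"
  shows "(t \<otimes> u, t \<otimes> v) \<in> adj"
proof (cases "u = v")
  case False
  then obtain a where a: "u \<in> carrier G" "a \<in> W.\<A>" "v = u \<otimes> letter_val G a"
    using assms(1) by (auto simp: cayley_adj_def)
  then have "t \<otimes> v = t \<otimes> u \<otimes> letter_val G a" "t \<otimes> u \<in> carrier G"
    using assms(2) W.letter_val_closed[OF a(2)] by (auto simp: m_assoc)
  then show ?thesis using a by (auto simp: cayley_adj_def)
qed simp

lemma adj_relpow_translate:
  assumes "(u, v) \<in> adj ^^ n" "t \<in> carrier G"
  shows "(t \<otimes> u, t \<otimes> v) \<in> adj ^^ n"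
  using relpow_image[OF assms(1), where V = UNIV and f = "\<lambda>x. t \<otimes> x" and W' = adj]
    adj_translate assms(2) by blast

lemma geo_carrier:
  assumes "geo adj f n" "f 0 \<in> carrier G" "i \<le> n"
  shows "f i \<in> carrier G"
  using assms(3)
proof (induction i)
  case (Suc i)
  then have "(f i, f (Suc i)) \<in> adj" using assms(1) by (simp add: geo_def)
  then show ?case using Suc adjE by (metis Suc_leD)
qed (use assms in simp)

lemma geo_translate:
  assumes "geo adj f n" "f 0 \<in> carrier G" and t: "t \<in> carrier G"
  shows "geo adj (\<lambda>i. t \<otimes> f i) n"
  unfolding geo_def
proof (intro conjI allI impI)
  fix i assume "i < n"
  then show "(t \<otimes> f i, t \<otimes> f (Suc i)) \<in> adj" using assms by (intro adj_translate) (auto simp: geo_def)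
next
  fix m assume m: "m < n"
  show "(t \<otimes> f 0, t \<otimes> f n) \<notin> adj ^^ m"
  proof
    assume "(t \<otimes> f 0, t \<otimes> f n) \<in> adj ^^ m"
    then have "(inv t \<otimes> (t \<otimes> f 0), inv t \<otimes> (t \<otimes> f n)) \<in> adj ^^ m" using adj_relpow_translate t by blast
    moreover have "inv t \<otimes> (t \<otimes> x) = x" if "x \<in> carrier G" for x
      using t that by (simp add: m_assoc[symmetric])
    ultimately have "(f 0, f n) \<in> adj ^^ m" using geo_carrier[OF assms(1,2)] assms(2) by simp
    then show False using assms(1) m by (auto simp: geo_def)
  qed
qed

lemma in_factor:
  assumes "a \<in> W.\<A>" "letter_val G a \<in> A i"
  shows "a \<in> L i \<or> letter_val G a \<in> B i"
  using assms(1)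
proof (cases rule: letter_cases)
  case (1 k)
  then show ?thesis using A_K[of k i] assms(2) by simp
next
  case (2 j)
  then show ?thesis using A_inter'[OF assms(2), of j] L_val[of a j] by blast
qed

text \<open>A letter that joins two points of \<open>A i\<close> without being in \<open>L i\<close>
  has its value in \<open>B i\<close>. The edge is then parallel to one labelled by a letter of
  \<open>K\<close> that does belong to \<open>L i\<close>.\<close>

lemma WP_factor: "gated_piece.WP adj (A i) = (factor_adj i)\<^sup>="
proof -
  interpret gated_piece adj "A i" "gate_A i" by (rule gated_A)
  have "(u, v) \<in> (factor_adj i)\<^sup>=" if uv: "(u, v) \<in> adj" "u \<in> A i" "v \<in> A i" for u v
  proof (cases "u = v")
    case False
    then obtain a where a: "u \<in> carrier G" "a \<in> W.\<A>" "v = u \<otimes> letter_val G a"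
      using uv(1) by (auto simp: cayley_adj_def)
    note c = W.letter_val_closed[OF a(2)]
    have "letter_val G a \<in> A i" using mult_in_right_iff[OF A a(1) c uv(2)] uv(3) a(3) by simp
    from in_factor[OF a(2) this] show ?thesis
    proof
      assume "a \<in> L i"
      then show ?thesis using a uv(2) by (auto simp: factor_adj_def)
    next
      assume b: "letter_val G a \<in> B i"
      have "letter_val G a \<noteq> \<one>" using False a by auto
      then have "Sub K (letter_val G a) \<in> L i" using B_L b by blast
      then show ?thesis using a(3) uv(2) by (force simp: factor_adj_def)
    qed
  qed simp
  moreover have "(u, v) \<in> adj \<inter> A i \<times> A i" if e: "(u, v) \<in> factor_adj i" for u v
  proof -
    obtain a where a: "u \<in> A i" "a \<in> L i" "v = u \<otimes> letter_val G a" using e by (auto simp: factor_adj_def)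
    then have "v \<in> A i" using L_val subgroup.m_closed[OF A] by blast
    moreover have "u \<in> carrier G" "a \<in> W.\<A>" using a A_carrier L_alph by blast+
    ultimately show ?thesis using a by (auto simp: cayley_adj_def)
  qed
  ultimately have "adj \<inter> A i \<times> A i \<subseteq> factor_adj i \<union> Id" "factor_adj i \<subseteq> adj \<inter> A i \<times> A i" by auto
  moreover have "X \<union> Id = Y \<union> Id" if "X \<subseteq> Y \<union> Id" "Y \<subseteq> X" for X Y :: "('a \<times> 'a) set"
    using that by blast
  ultimately show ?thesis unfolding WP_def by blast
qed

text \<open>The graph has infinitely many pieces in general, but translating \<open>f i\<close> to
  \<open>\<one>\<close> puts the next edge into one of \<open>A True\<close>, \<open>A False\<close>
  and \<open>K\<close>. Which of them is used depends on the translated corner \<open>f 0\<close>,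
  through \<open>gate_cases\<close>.\<close>

lemma slim_adj:
  assumes sl: "\<And>i. slim \<delta> (A i) ((factor_adj i)\<^sup>=)"
  shows "slim (3 * \<delta> + 2) (carrier G) adj"
  unfolding slim_def
proof (intro allI impI)
  fix f a g b h c i
  assume geo: "geo adj f a" "geo adj g b" "geo adj h c" and eq: "f a = g 0" "g b = h 0" "h c = f 0"
    and V: "f 0 \<in> carrier G" "g 0 \<in> carrier G" "h 0 \<in> carrier G" and i: "i \<le> a"
  show "\<exists>v\<in>g ` {..b} \<union> h ` {..c}. (f i, v) \<in> adj ^^ (3 * \<delta> + 2)"
  proof (cases "i = a")
    case True
    have "(f i, f i) \<in> adj ^^ (3 * \<delta> + 2)" using relpow_refl_mono[of adj 0 "3 * \<delta> + 2"] by auto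
    then show ?thesis using True eq(1) by (intro bexI[of _ "g 0"]) auto
  next
    case False
    then have ia: "i < a" using i by simp
    have fi: "f i \<in> carrier G" using geo_carrier[OF geo(1) V(1) i] .
    let ?t = "inv (f i)"
    have t: "?t \<in> carrier G" using fi by simp
    have "(f i, f (Suc i)) \<in> adj" using geo(1) ia by (simp add: geo_def)
    then obtain s j where s: "f (Suc i) = f i \<otimes> s" "s \<in> A j \<union> K"
      using adjE geo_step_neq[OF geo(1) ia] by metis
    have sc: "s \<in> carrier G" using step_carrier[OF s(2)] .
    let ?f = "\<lambda>k. ?t \<otimes> f k" and ?g = "\<lambda>k. ?t \<otimes> g k" and ?h = "\<lambda>k. ?t \<otimes> h k"
    note geo' = geo_translate[OF geo(1) V(1) t] geo_translate[OF geo(2) V(2) t] geo_translate[OF geo(3) V(3) t]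
    have f1: "?f i = \<one>" "?f (Suc i) = s" using fi sc s by (auto simp: m_assoc[symmetric])
    have eq': "?f a = ?g 0" "?g b = ?h 0" "?h c = ?f 0" using eq by auto
    have one: "\<one> \<in> A l" "\<one> \<in> K" for l
      using subgroup.one_closed[OF A] subgroup.one_closed[OF K_subgroup] by auto
    have "\<exists>v\<in>?g ` {..b} \<union> ?h ` {..c}. (?f i, v) \<in> adj ^^ (3 * \<delta> + 2)"
      using gate_cases[OF s(2), of "?f 0", OF m_closed[OF t V(1)]]
    proof (elim disjE exE conjE)
      show ?thesis if l: "s \<in> A l" "\<not> (\<one> \<in> gate_A l (?f 0) \<and> s \<in> gate_A l (?f 0))" for l
        by (rule gated_piece.slim_near_piece[OF gated_A _ geo' eq' ia])
          (use l sl f1 one in \<open>auto simp: WP_factor\<close>)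
      show ?thesis if l: "s \<in> K" "\<not> (\<one> \<in> gate_K (?f 0) \<and> s \<in> gate_K (?f 0))"
      proof (rule gated_piece.slim_near_piece[OF gated_K _ geo' eq' ia])
        have "gated_piece.WP adj K = K \<times> K \<union> Id"
        proof -
          have "(x, y) \<in> adj" if "x \<in> K" "y \<in> K" for x y
          proof -
            have c: "x \<in> carrier G" "y \<in> carrier G" using that K_carrier by blast+
            have "inv x \<otimes> y \<in> K" using that by (meson K_subgroup subgroup.m_closed subgroup.m_inv_closed)
            moreover have "y = x \<otimes> (inv x \<otimes> y)" using c by (simp add: m_assoc[symmetric])
            ultimately show ?thesis using K_adj[of "inv x \<otimes> y" x] c by simp
          qed
          then show ?thesis unfolding gated_piece.WP_def[OF gated_K] by blast
        qed
        then show "slim \<delta> K (gated_piece.WP adj K)" using slim_mono[OF slim_complete[of K]] by auto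
      qed (use l f1 one in simp_all)
    qed
    then obtain w where w: "w \<in> g ` {..b} \<union> h ` {..c}" "(?f i, ?t \<otimes> w) \<in> adj ^^ (3 * \<delta> + 2)" by blast
    have "w \<in> carrier G" using w(1) geo_carrier[OF geo(2) V(2)] geo_carrier[OF geo(3) V(3)] by auto
    then have "f i \<otimes> (?t \<otimes> w) = w" "f i \<otimes> ?f i = f i" using fi by (auto simp: m_assoc[symmetric])
    then show ?thesis using adj_relpow_translate[OF w(2) fi] w(1) by auto
  qed
qed

text \<open>A gate has no preferred point, so one is chosen. The choice is a function of the gate as
  a set, hence constant where the gate is constant.\<close>

definition retract :: "bool \<Rightarrow> 'a \<Rightarrow> 'a" where
  "retract i x = (if x \<in> A i then x else SOME a. a \<in> gate_A i x)"

lemma retract_gate: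
  assumes "x \<in> carrier G" "x \<notin> A i"
  shows "retract i x \<in> gate_A i x"
proof -
  have "gate_A i x \<noteq> {}" using branch_A[OF assms] assms(1) by (auto simp: gate_A_def)
  then show ?thesis using assms(2) by (auto simp: retract_def intro: someI_ex)
qed

lemma retract_A: "x \<in> carrier G \<Longrightarrow> retract i x \<in> A i"
  using retract_gate[of x i] by (cases "x \<in> A i") (auto simp: gate_A_def retract_def)

text \<open>Edges outside \<open>A i\<close> keep the gate and collapse. When an edge enters or
  leaves \<open>A i\<close>, both images lie in one gate and differ by an element of
  \<open>B i\<close>, so distances do not grow.\<close>

lemma retract_edge:
  assumes u: "u \<in> carrier G" and a: "a \<in> W.\<A>" and v: "v = u \<otimes> letter_val G a"
  shows "retract i u = retract i v \<or> (a \<in> L i \<and> u \<in> A i \<and> v \<in> A i) \<or>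
    (\<exists>b\<in>B i. b \<noteq> \<one> \<and> retract i v = retract i u \<otimes> b)"
proof -
  let ?s = "letter_val G a"
  note sc = W.letter_val_closed[OF a]
  have vc: "v \<in> carrier G" using u sc v by simp
  have uv: "(u, v) \<in> adj" using u a v by (auto simp: cayley_adj_def)
  have via: ?thesis if x: "retract i u \<in> gate_A i x" "retract i v \<in> gate_A i x" for x
  proof -
    let ?b = "inv (retract i u) \<otimes> retract i v"
    have b: "?b \<in> B i" using gate_A_diff[OF x] .
    have c: "retract i u \<in> carrier G" "retract i v \<in> carrier G" using retract_A u vc A_carrier by blast+
    then have "retract i v = retract i u \<otimes> ?b" by (simp add: m_assoc[symmetric])
    then show ?thesis using b c by (cases "?b = \<one>") auto
  qed
  interpret gated_piece adj "A i" "gate_A i" by (rule gated_A)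
  show ?thesis
  proof (cases "u \<in> A i")
    case uA: True
    show ?thesis
    proof (cases "v \<in> A i")
      case True
      have "?s \<in> A i" using mult_in_right_iff[OF A u sc uA] True v by simp
      then have "a \<in> L i \<or> ?s \<in> B i" using in_factor a by blast
      moreover have r: "retract i u = u" "retract i v = v" using uA True by (auto simp: retract_def)
      moreover have ?thesis if "?s = \<one>" using that v u r by simp
      ultimately show ?thesis unfolding r using uA True v by blast
    next
      case False
      then show ?thesis using via[of v] leave[OF uv uA] retract_gate[OF vc] uA by (simp add: retract_def)
    qed
  next
    case uA: False
    show ?thesis
    proof (cases "v \<in> A i")
      case True
      have "(v, u) \<in> adj" using uv adj_sym by (auto dest: symD)
      then show ?thesis using via[of u] leave[of v u] True retract_gate[OF u] uA by (simp add: retract_def)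
    next
      case False
      then show ?thesis using out[OF uv] uA by (simp add: retract_def)
    qed
  qed
qed

text \<open>Edges created by the choice of gate points carry labels of \<open>K\<close>; such edges
  are not deleted in the graph for \<open>H \<noteq> K\<close>.\<close>

lemma retract_hat:
  assumes uv: "(u, v) \<in> hat_adj G S \<H> H" and H: "H \<noteq> K"
  shows "(retract i u, retract i v) \<in> (factor_hat i H H)\<^sup>= \<and> v \<in> carrier G"
proof -
  obtain a where a: "u \<in> carrier G" "a \<in> W.\<A>" "v = u \<otimes> letter_val G a"
    "\<not> (u \<in> H \<and> v \<in> H \<and> a \<in> range (Sub H))"
    using uv by (auto simp: hat_adj_def)
  have "v \<in> carrier G" using a W.letter_val_closed by simp
  moreover have "(retract i u, retract i v) \<in> (factor_hat i H H)\<^sup>="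
    using retract_edge[OF a(1-3), of i]
  proof (elim disjE bexE conjE)
    assume *: "a \<in> L i" "u \<in> A i" "v \<in> A i"
    then have "retract i u = u" "retract i v = v" by (auto simp: retract_def)
    then show ?thesis using * a by (auto simp: factor_hat_def)
  next
    fix b assume b: "b \<in> B i" "b \<noteq> \<one>" "retract i v = retract i u \<otimes> b"
    then have "Sub K b \<in> L i" "Sub K b \<notin> range (Sub H)" using B_L H by auto
    then have "(retract i u, retract i u \<otimes> letter_val G (Sub K b)) \<in> factor_hat i H H"
      using retract_A[OF a(1), of i] unfolding factor_hat_def by blast
    then show ?thesis using b(3) by simp
  qed simp
  ultimately show ?thesis by blast
qed

lemma finite_hat_ball:
  assumes H: "H \<noteq> K" "H \<subseteq> A i" and h: "h \<in> H"
    and fin: "finite {h' \<in> H. (h, h') \<in> ((factor_hat i H H)\<^sup>=) ^^ n}"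
  shows "finite {h' \<in> H. hat_dist G S \<H> H h h' \<le> enat n}"
proof (rule finite_subset[OF _ fin])
  have "(h, h') \<in> ((factor_hat i H H)\<^sup>=) ^^ n"
    if h': "h' \<in> H" "(h, h') \<in> ((hat_adj G S \<H> H)\<^sup>=) ^^ n" for h'
  proof -
    have "(retract i h, retract i h') \<in> ((factor_hat i H H)\<^sup>=) ^^ n"
      using relpow_image[OF h'(2), where V = "carrier G" and f = "retract i" and W' = "(factor_hat i H H)\<^sup>="]
        retract_hat[OF _ H(1)] h H(2) A_carrier by blast
    then show ?thesis using h h' H by (simp add: retract_def subset_iff)
  qed
  then show "{h' \<in> H. hat_dist G S \<H> H h h' \<le> enat n} \<subseteq> {h' \<in> H. (h, h') \<in> ((factor_hat i H H)\<^sup>=) ^^ n}"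
    unfolding hat_dist_def graph_dist_le_iff by blast
qed

text \<open>Left multiplication by \<open>B i\<close> preserves \<open>N i\<close>. A point of
  \<open>N i\<close> outside \<open>A i\<close> with retract in \<open>B i\<close> would thus stay
  in \<open>N i\<close> after translation by the inverse of its retract, although it must land in
  \<open>M i\<close>. Consequently edges outside \<open>B i\<close> are not retracted to deleted
  ones.\<close>

lemma retract_B:
  assumes "u \<in> N i \<union> B i" "retract i u \<in> B i"
  shows "u \<in> B i"
proof (cases "u \<in> A i")
  case False
  then have u: "u \<in> N i" "u \<in> carrier G" using assms(1) B_A N_carrier by blast+
  then have "inv (retract i u) \<otimes> u \<in> M i" using retract_gate False by (simp add: gate_A_def)
  moreover have "inv (retract i u) \<otimes> u \<in> N i"
    using B_mult_N u assms(2) subgroup.m_inv_closed[OF B] by blast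
  ultimately show ?thesis by (simp add: M_def)
qed (use assms in \<open>simp add: retract_def\<close>)

lemma retract_hat_K:
  assumes uv: "(u, v) \<in> hat_adj G S \<H> K" "u \<in> N i \<union> B i" "v \<in> N i \<union> B i" "\<not> (u \<in> B i \<and> v \<in> B i)"
  shows "(retract i u, retract i v) \<in> (factor_hat i (B i) K)\<^sup>="
proof -
  obtain a where a: "u \<in> carrier G" "a \<in> W.\<A>" "v = u \<otimes> letter_val G a"
    using uv by (auto simp: hat_adj_def)
  have nB: "\<not> (retract i u \<in> B i \<and> retract i v \<in> B i)" using retract_B uv by blast
  show ?thesis using retract_edge[OF a, of i]
  proof (elim disjE bexE conjE)
    assume *: "a \<in> L i" "u \<in> A i" "v \<in> A i"
    then have "retract i u = u" "retract i v = v" by (auto simp: retract_def)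
    then show ?thesis using * a nB by (auto simp: factor_hat_def)
  next
    fix b assume b: "b \<in> B i" "b \<noteq> \<one>" "retract i v = retract i u \<otimes> b"
    then have "Sub K b \<in> L i" using B_L by blast
    moreover have "\<not> (retract i u \<in> B i \<and> retract i u \<otimes> letter_val G (Sub K b) \<in> B i)" using nB b(3) by simp
    ultimately have "(retract i u, retract i u \<otimes> letter_val G (Sub K b)) \<in> factor_hat i (B i) K"
      using retract_A[OF a(1), of i] unfolding factor_hat_def by blast
    then show ?thesis using b(3) by simp
  qed simp
qed

section \<open>Excursions from \<open>K\<close>\<close>

abbreviation hatK :: "('a \<times> 'a) set" where
  "hatK \<equiv> (hat_adj G S \<H> K)\<^sup>="

lemma hatK_adj: "hatK \<subseteq> adj"
  by (auto simp: hat_adj_def cayley_adj_def)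

definition returns :: "nat \<Rightarrow> 'a set" where
  "returns m = {k \<in> K. \<exists>f. f 0 = \<one> \<and> f m = k \<and> (\<forall>j<m. (f j, f (Suc j)) \<in> hatK) \<and>
     (\<forall>j. 0 < j \<and> j < m \<longrightarrow> f j \<notin> K)}"

text \<open>A label of \<open>K\<close> would keep the edge inside \<open>K\<close>, where it has
  been deleted; so the label belongs to a factor, and the edge stays in \<open>B i\<close> or enters
  \<open>N i\<close>.\<close>

lemma first_step:
  assumes "(\<one>, v) \<in> hat_adj G S \<H> K"
  obtains i where "v \<in> K" "v \<in> B i" "(\<one>, v) \<in> factor_hat i (B i) K" | i where "v \<notin> K" "v \<in> N i"
proof -
  obtain a where a: "a \<in> W.\<A>" "v = \<one> \<otimes> letter_val G a" "\<not> (\<one> \<in> K \<and> v \<in> K \<and> a \<in> range (Sub K))"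
    using assms by (auto simp: hat_adj_def)
  have v: "v = letter_val G a" using a W.letter_val_closed by simp
  have nK: "a \<notin> range (Sub K)"
    using a v subgroup.one_closed[OF K_subgroup] by (auto simp: rel_alphabet_iff)
  from a(1) show ?thesis
  proof (cases rule: letter_cases)
    case (1 k)
    then show ?thesis using nK by blast
  next
    case (2 i)
    then have vA: "v \<in> A i" using L_val v by blast
    show ?thesis
    proof (cases "v \<in> K")
      case True
      then have "v \<in> B i" using A_K vA by blast
      moreover have "(\<one>, v) \<in> factor_hat i (B i) K"
        using 2 a(2) subgroup.one_closed[OF A] by (auto simp: factor_hat_def)
      ultimately show ?thesis using that(1) True by blast
    next
      case False
      then show ?thesis using that(2) A_N_iff vA A_K by blast
    qed
  qed
qed

text \<open>Once in \<open>N i\<close>, an excursion can meet \<open>K\<close> again only in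
  \<open>B i\<close>. No proper step has both ends in \<open>B i\<close>, so the retraction is a
  path in the factor that avoids deleted edges. The extra element \<open>\<one>\<close> is the
  excursion made of one stationary step.\<close>

lemma returns_subset:
  assumes "0 < m"
  shows "returns m \<subseteq> insert \<one> (\<Union>i. {k \<in> B i. (\<one>, k) \<in> ((factor_hat i (B i) K)\<^sup>=) ^^ m})"
proof
  fix k assume "k \<in> returns m"
  then obtain f where f: "k \<in> K" "f 0 = \<one>" "f m = k" "\<And>j. j < m \<Longrightarrow> (f j, f (Suc j)) \<in> hatK"
    "\<And>j. 0 < j \<Longrightarrow> j < m \<Longrightarrow> f j \<notin> K"
    unfolding returns_def by blast
  show "k \<in> insert \<one> (\<Union>i. {k \<in> B i. (\<one>, k) \<in> ((factor_hat i (B i) K)\<^sup>=) ^^ m})"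
  proof (cases "f 1 = \<one>")
    case True
    then have "\<not> 1 < m" using f(5)[of 1] subgroup.one_closed[OF K_subgroup] by auto
    then have "m = 1" using assms by simp
    then show ?thesis using True f by simp
  next
    case False
    then have "(\<one>, f 1) \<in> hat_adj G S \<H> K" using f(4)[of 0] f(2) assms by simp
    then show ?thesis
    proof (cases rule: first_step)
      case (1 i)
      then have "\<not> 1 < m" using f(5)[of 1] by auto
      then have "m = 1" using assms by simp
      then show ?thesis using 1 f by auto
    next
      case (2 i)
      have "m \<noteq> 1" using f 2 by auto
      then have m: "1 < m" using assms by simp
      have stepN: "f (Suc j) \<in> N i \<union> B i" if "f j \<in> N i" "j < m" for j
      proof (cases "f j = f (Suc j)")
        case False
        then have "(f j, f (Suc j)) \<in> adj" using f(4)[OF that(2)] hatK_adj by blast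
        from adjE[OF this False] step[OF that(1)] show ?thesis by metis
      qed (use that in auto)
      have inN: "Suc j < m \<Longrightarrow> f (Suc j) \<in> N i" for j
      proof (induction j)
        case 0
        then show ?case using 2 by simp
      next
        case (Suc j)
        then show ?case using stepN[of "Suc j"] f(5)[of "Suc (Suc j)"] B_K by auto
      qed
      have inN': "f j \<in> N i" if "0 < j" "j < m" for j
        using inN[of "j - 1"] that by simp
      have "f (Suc (m - 1)) \<in> N i \<union> B i" using stepN[of "m - 1"] inN'[of "m - 1"] m by simp
      then have kB: "k \<in> B i" using f(1,3) m N_not_K by auto
      have one: "\<one> \<in> B i" using subgroup.one_closed[OF B] .
      have NB: "f j \<in> N i \<union> B i" if "j \<le> m" for j
        using inN'[of j] kB f(2,3) one that by (cases "j = 0"; cases "j = m") auto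
      have "(retract i (f j), retract i (f (Suc j))) \<in> (factor_hat i (B i) K)\<^sup>=" if j: "j < m" for j
      proof (cases "f j = f (Suc j)")
        case False
        then have "(f j, f (Suc j)) \<in> hat_adj G S \<H> K" using f(4)[OF j] by blast
        moreover have "\<not> (f j \<in> B i \<and> f (Suc j) \<in> B i)"
          using inN'[of j] inN'[of "Suc j"] N_not_B m j by (cases "j = 0") auto
        ultimately show ?thesis using retract_hat_K NB j by (meson Suc_leI less_imp_le)
      qed simp
      then have "(retract i (f 0), retract i (f m)) \<in> ((factor_hat i (B i) K)\<^sup>=) ^^ (m - 0)"
        using path_relpow[of m "\<lambda>j. retract i (f j)" _ 0 m] by blast
      moreover have "retract i (f 0) = \<one>" "retract i (f m) = k"
        using f one kB B_A by (auto simp: retract_def)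
      ultimately show ?thesis using kB by auto
    qed
  qed
qed

lemma hatK_translate:
  assumes "(u, v) \<in> hatK ^^ n" "t \<in> K"
  shows "(t \<otimes> u, t \<otimes> v) \<in> hatK ^^ n"
proof -
  have tc: "t \<in> carrier G" using assms(2) K_carrier by blast
  have "(t \<otimes> x, t \<otimes> y) \<in> hatK" if xy: "(x, y) \<in> hatK" for x y
  proof (cases "x = y")
    case False
    then obtain a where a: "x \<in> carrier G" "a \<in> W.\<A>" "y = x \<otimes> letter_val G a"
      "\<not> (x \<in> K \<and> y \<in> K \<and> a \<in> range (Sub K))" using xy by (auto simp: hat_adj_def)
    note c = W.letter_val_closed[OF a(2)]
    have yc: "y \<in> carrier G" using a c by simp
    have ty: "t \<otimes> y = t \<otimes> x \<otimes> letter_val G a" using a c tc by (simp add: m_assoc)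
    have "\<not> (t \<otimes> x \<in> K \<and> t \<otimes> y \<in> K \<and> a \<in> range (Sub K))"
      using a(4) mult_in_right_iff[OF K_subgroup tc _ assms(2)] a(1) yc by blast
    then have "(t \<otimes> x, t \<otimes> y) \<in> hat_adj G S \<H> K"
      unfolding hat_adj_def ty using a(1,2) tc by blast
    then show ?thesis by blast
  qed simp
  then show ?thesis
    using relpow_image[OF assms(1), where V = UNIV and f = "\<lambda>x. t \<otimes> x" and W' = hatK] by blast
qed

lemma finite_hatK_ball:
  assumes fin: "\<And>i n. finite {k \<in> B i. (\<one>, k) \<in> ((factor_hat i (B i) K)\<^sup>=) ^^ n}"
  shows "finite {k \<in> K. (\<one>, k) \<in> hatK ^^ n}"
proof (induction n rule: less_induct)
  case (less n)
  let ?F = "\<lambda>n. {k \<in> K. (\<one>, k) \<in> hatK ^^ n}"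
  have fr: "finite (returns m)" if "0 < m" for m
    using finite_subset[OF returns_subset[OF that]] fin by simp
  have "?F n \<subseteq> insert \<one> (\<Union>m\<in>{1..n}. (\<lambda>(r, k). r \<otimes> k) ` (returns m \<times> ?F (n - m)))"
  proof
    fix k assume k: "k \<in> ?F n"
    show "k \<in> insert \<one> (\<Union>m\<in>{1..n}. (\<lambda>(r, k). r \<otimes> k) ` (returns m \<times> ?F (n - m)))"
    proof (cases "n = 0")
      case False
      obtain f where f: "f 0 = \<one>" "f n = k" "\<forall>i<n. (f i, f (Suc i)) \<in> hatK"
        using k unfolding relpow_fun_conv by blast
      \<comment> \<open>The start itself lies in \<open>K\<close>; requiring \<open>0 < m\<close>
        makes the remaining path shorter than \<open>n\<close>.\<close>
      define m where "m = (LEAST m. 0 < m \<and> f m \<in> K)"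
      have ex: "0 < n \<and> f n \<in> K" using False f k by simp
      have m: "0 < m" "f m \<in> K" "m \<le> n" "\<And>j. 0 < j \<Longrightarrow> j < m \<Longrightarrow> f j \<notin> K"
        using LeastI[of "\<lambda>m. 0 < m \<and> f m \<in> K", OF ex] Least_le[of "\<lambda>m. 0 < m \<and> f m \<in> K", OF ex]
          not_less_Least[of _ "\<lambda>m. 0 < m \<and> f m \<in> K"] unfolding m_def by blast+
      have r: "f m \<in> returns m" unfolding returns_def
        using m f by (intro CollectI conjI exI[of _ f]) auto
      let ?k = "inv (f m) \<otimes> k"
      have mk: "inv (f m) \<in> K" using m(2) subgroup.m_inv_closed[OF K_subgroup] by blast
      have c: "f m \<in> carrier G" "k \<in> carrier G" using m(2) k K_carrier by auto
      have "(f m, k) \<in> hatK ^^ (n - m)" using path_relpow[OF f(3) m(3) order_refl] f(2) by simp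
      then have "(inv (f m) \<otimes> f m, ?k) \<in> hatK ^^ (n - m)" using hatK_translate mk by blast
      moreover have "?k \<in> K" using subgroup.m_closed[OF K_subgroup mk] k by blast
      ultimately have "?k \<in> ?F (n - m)" using c by simp
      moreover have "k = f m \<otimes> ?k" using c by (simp add: m_assoc[symmetric])
      ultimately have "k \<in> (\<lambda>(r, k). r \<otimes> k) ` (returns m \<times> ?F (n - m))"
        using r by (intro image_eqI[of _ _ "(f m, ?k)"]) auto
      then show ?thesis using m by auto
    qed (use k in auto)
  qed
  moreover have "finite (insert \<one> (\<Union>m\<in>{1..n}. (\<lambda>(r, k). r \<otimes> k) ` (returns m \<times> ?F (n - m))))"
    using fr less.IH by (intro finite.insertI finite_UN_I finite_imageI finite_cartesian_product) auto
  ultimately show ?case by (rule finite_subset)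
qed

theorem hyp_embedded_combination:
  assumes gen: "generate G (S \<union> \<Union>\<H>) = carrier G"
    and hyp: "\<And>i. hyperbolic_graph (A i) (factor_adj i)"
    and fin: "\<And>H. H \<in> \<H> \<Longrightarrow> H \<noteq> K \<Longrightarrow> \<exists>i. H \<subseteq> A i \<and>
      (\<forall>h\<in>H. \<forall>n. finite {h' \<in> H. (h, h') \<in> ((factor_hat i H H)\<^sup>=) ^^ n})"
    and finK: "\<And>i n. finite {k \<in> B i. (\<one>, k) \<in> ((factor_hat i (B i) K)\<^sup>=) ^^ n}"
  shows "\<H> \<hookrightarrow>\<^sub>h G"
  unfolding hyp_embedded_def
proof (intro conjI exI ballI allI)
  show "group_pair G \<H>" by (rule W.pair)
  show "S \<subseteq> carrier G" by (rule W.S_carrier)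
  show "generate G (S \<union> \<Union>\<H>) = carrier G" by (rule gen)
  obtain \<delta> where \<delta>: "\<And>i. slim (\<delta> i) (A i) ((factor_adj i)\<^sup>=)"
    using hyp unfolding hyperbolic_graph_iff_slim by metis
  have "slim (\<delta> True + \<delta> False) (A i) ((factor_adj i)\<^sup>=)" for i
    using slim_mono[OF \<delta>[of i], of "\<delta> True + \<delta> False"] by (cases i) auto
  then show "hyperbolic_graph (carrier G) (cayley_adj G S \<H>)"
    unfolding hyperbolic_graph_iff_slim using slim_adj by blast
  fix H h n assume H: "H \<in> \<H>" "h \<in> H"
  show "finite {h' \<in> H. hat_dist G S \<H> H h h' \<le> enat n}"
  proof (cases "H = K")
    case True
    have hc: "h \<in> carrier G" and ih: "inv h \<in> K"
      using H True K_carrier subgroup.m_inv_closed[OF K_subgroup] by auto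
    \<comment> \<open>Left translation by \<open>K\<close> preserves the deleted edges, so a ball
      around \<open>h\<close> is a translate of the ball around \<open>\<one>\<close>.\<close>
    have "{k \<in> K. hat_dist G S \<H> K h k \<le> enat n} \<subseteq> (\<lambda>k. h \<otimes> k) ` {k \<in> K. (\<one>, k) \<in> hatK ^^ n}"
    proof
      fix k assume "k \<in> {k \<in> K. hat_dist G S \<H> K h k \<le> enat n}"
      then have k: "k \<in> K" "(h, k) \<in> hatK ^^ n" unfolding hat_dist_def graph_dist_le_iff by auto
      have kc: "k \<in> carrier G" using k K_carrier by blast
      have "(inv h \<otimes> h, inv h \<otimes> k) \<in> hatK ^^ n" using hatK_translate[OF k(2) ih] .
      then have "inv h \<otimes> k \<in> {k \<in> K. (\<one>, k) \<in> hatK ^^ n}"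
        using hc subgroup.m_closed[OF K_subgroup ih k(1)] by simp
      moreover have "k = h \<otimes> (inv h \<otimes> k)" using hc kc by (simp add: m_assoc[symmetric])
      ultimately show "k \<in> (\<lambda>k. h \<otimes> k) ` {k \<in> K. (\<one>, k) \<in> hatK ^^ n}" by blast
    qed
    then show ?thesis using finite_hatK_ball[OF finK] finite_subset True by blast
  next
    case False
    then obtain i where "H \<subseteq> A i" "finite {h' \<in> H. (h, h') \<in> ((factor_hat i H H)\<^sup>=) ^^ n}"
      using fin[OF H(1)] H(2) by blast
    then show ?thesis using finite_hat_ball[OF False] H(2) by blast
  qed
qed

end

section \<open>Transport of relative Cayley graphs along an embedding\<close>

context rel_words_map begin

lemma map_adj:
  "{(u, u \<otimes>\<^bsub>G\<^esub> letter_val G b) | u b. u \<in> \<iota> ` carrier G0 \<and> b \<in> \<mu> ` W0.\<A>} =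
    map_prod \<iota> \<iota> ` cayley_adj G0 S0 \<H>0"
proof -
  have eq: "\<iota> u \<otimes>\<^bsub>G\<^esub> letter_val G (\<mu> a) = \<iota> (u \<otimes>\<^bsub>G0\<^esub> letter_val G0 a)"
    if "u \<in> carrier G0" "a \<in> W0.\<A>" for u a
    using that W0.letter_val_closed by (simp add: letter_val_map)
  have "{(u, u \<otimes>\<^bsub>G\<^esub> letter_val G b) | u b. u \<in> \<iota> ` carrier G0 \<and> b \<in> \<mu> ` W0.\<A>} =
      {(\<iota> u, \<iota> u \<otimes>\<^bsub>G\<^esub> letter_val G (\<mu> a)) | u a. u \<in> carrier G0 \<and> a \<in> W0.\<A>}" by blast
  also have "\<dots> = {(\<iota> u, \<iota> (u \<otimes>\<^bsub>G0\<^esub> letter_val G0 a)) | u a. u \<in> carrier G0 \<and> a \<in> W0.\<A>}"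
    using eq by (intro Collect_cong) metis
  also have "\<dots> = map_prod \<iota> \<iota> ` cayley_adj G0 S0 \<H>0"
    unfolding cayley_adj_def by force
  finally show ?thesis .
qed

lemma hyperbolic_map:
  assumes "hyperbolic_graph (carrier G0) (cayley_adj G0 S0 \<H>0)"
  shows "hyperbolic_graph (\<iota> ` carrier G0)
    {(u, u \<otimes>\<^bsub>G\<^esub> letter_val G b) | u b. u \<in> \<iota> ` carrier G0 \<and> b \<in> \<mu> ` W0.\<A>}"
proof -
  have "cayley_adj G0 S0 \<H>0 \<subseteq> carrier G0 \<times> carrier G0"
    using W0.letter_val_closed by (auto simp: cayley_adj_def)
  then show ?thesis
    using assms slim_image[OF _ _ inj] unfolding hyperbolic_graph_iff_slim map_adj by blast
qed

text \<open>Paths are pulled back along the inverse of \<open>\<iota>\<close>. They avoid the edges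
  deleted in \<open>G0\<close> because \<open>\<mu>\<close> sends labels of \<open>H\<close> to
  labels of \<open>f H\<close>, so that every such edge has its image among those deleted
  here.\<close>

lemma finite_hat_map:
  assumes H: "H \<in> \<H>0" and h: "h \<in> \<iota> ` H"
    and fin: "\<And>h n. h \<in> H \<Longrightarrow> finite {h' \<in> H. hat_dist G0 S0 \<H>0 H h h' \<le> enat n}"
  shows "finite {h' \<in> \<iota> ` H. (h, h') \<in> ({(u, u \<otimes>\<^bsub>G\<^esub> letter_val G b) | u b. u \<in> \<iota> ` carrier G0 \<and> b \<in> \<mu> ` W0.\<A> \<and>
     \<not> (u \<in> \<iota> ` H \<and> u \<otimes>\<^bsub>G\<^esub> letter_val G b \<in> \<iota> ` H \<and> b \<in> range (Sub (f H)))}\<^sup>=) ^^ n}"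
    (is "finite {h' \<in> _. (h, h') \<in> (?E\<^sup>=) ^^ n}")
proof -
  let ?g = "inv_into (carrier G0) \<iota>"
  have Hc: "H \<subseteq> carrier G0" using \<H>0_carrier[OF H] by blast
  have edge: "v \<in> \<iota> ` carrier G0 \<and> (?g u, ?g v) \<in> (hat_adj G0 S0 \<H>0 H)\<^sup>="
    if u: "u \<in> \<iota> ` carrier G0" and uv: "(u, v) \<in> ?E\<^sup>=" for u v
  proof (cases "u = v")
    case False
    then obtain x a where xa: "x \<in> carrier G0" "u = \<iota> x" "a \<in> W0.\<A>" "v = u \<otimes>\<^bsub>G\<^esub> letter_val G (\<mu> a)"
      "\<not> (u \<in> \<iota> ` H \<and> v \<in> \<iota> ` H \<and> \<mu> a \<in> range (Sub (f H)))" using uv by blast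
    have c: "letter_val G0 a \<in> carrier G0" using W0.letter_val_closed xa by blast
    let ?y = "x \<otimes>\<^bsub>G0\<^esub> letter_val G0 a"
    have v: "v = \<iota> ?y" "?y \<in> carrier G0" using xa c by (auto simp: letter_val_map)
    have "\<not> (x \<in> H \<and> ?y \<in> H \<and> a \<in> range (Sub H))"
    proof
      assume *: "x \<in> H \<and> ?y \<in> H \<and> a \<in> range (Sub H)"
      then have "u \<in> \<iota> ` H" "v \<in> \<iota> ` H" using xa(2) v(1) by blast+
      moreover have "\<mu> a \<in> range (Sub (f H))" using * by auto
      ultimately show False using xa(5) by blast
    qed
    then have "(x, ?y) \<in> hat_adj G0 S0 \<H>0 H" unfolding hat_adj_def using xa by blast
    moreover have "?g u = x" "?g v = ?y" unfolding xa(2) v(1) using inv_into_f_f[OF inj] xa(1) v(2) by blast+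
    ultimately have "(?g u, ?g v) \<in> hat_adj G0 S0 \<H>0 H" by (simp only:)
    then show ?thesis using v by blast
  qed (use u in auto)
  obtain h0 where h0: "h0 \<in> H" "h = \<iota> h0" using h by blast
  have "{h' \<in> \<iota> ` H. (h, h') \<in> (?E\<^sup>=) ^^ n} \<subseteq> \<iota> ` {h' \<in> H. hat_dist G0 S0 \<H>0 H h0 h' \<le> enat n}"
  proof clarify
    fix k assume k: "k \<in> H" "(h, \<iota> k) \<in> (?E\<^sup>=) ^^ n"
    have "(?g h, ?g (\<iota> k)) \<in> ((hat_adj G0 S0 \<H>0 H)\<^sup>=) ^^ n"
      using relpow_image[OF k(2), where V = "\<iota> ` carrier G0" and f = ?g and W' = "(hat_adj G0 S0 \<H>0 H)\<^sup>="]
        edge h Hc by blast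
    then have "(h0, k) \<in> ((hat_adj G0 S0 \<H>0 H)\<^sup>=) ^^ n" using h0 k Hc inj by (simp add: subset_iff)
    then have "hat_dist G0 S0 \<H>0 H h0 k \<le> enat n" unfolding hat_dist_def graph_dist_le_iff .
    then show "\<iota> k \<in> \<iota> ` {h' \<in> H. hat_dist G0 S0 \<H>0 H h0 h' \<le> enat n}" using k by blast
  qed
  then show ?thesis using fin[OF h0(1)] finite_subset by blast
qed

lemma generate_map:
  assumes "generate G0 (S0 \<union> \<Union>\<H>0) = carrier G0"
  shows "\<iota> ` carrier G0 \<subseteq> generate G (S \<union> \<Union>\<H>)"
proof -
  have c: "S0 \<union> \<Union>\<H>0 \<subseteq> carrier G0" using W0.S_carrier \<H>0_carrier by blast
  have "\<iota> ` (S0 \<union> \<Union>\<H>0) \<subseteq> S \<union> \<Union>\<H>" using S f by blast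
  then have "generate G (\<iota> ` (S0 \<union> \<Union>\<H>0)) \<subseteq> generate G (S \<union> \<Union>\<H>)" by (rule W.mono_generate)
  then show ?thesis using \<iota>.generate_img[OF c] assms by simp
qed

end


section \<open>Amalgamated pairs\<close>

locale amalgamated_pairs = amalgam G1 G2 C d1 d2
  for G1 :: "('a, 'm) monoid_scheme" and G2 :: "('b, 'n) monoid_scheme"
    and C :: "('c, 'k) monoid_scheme" and d1 :: "'c \<Rightarrow> 'a" and d2 :: "'c \<Rightarrow> 'b" +
  fixes \<H>1 :: "'a set set" and K1 :: "'a set" and \<H>2 :: "'b set set" and K2 :: "'b set"
  assumes pair1: "group_pair G1 (\<H>1 \<union> {K1})" and pair2: "group_pair G2 (\<H>2 \<union> {K2})"
    and K1_notin: "K1 \<notin> \<H>1" and K2_notin: "K2 \<notin> \<H>2"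
    and d1_K: "d1 ` carrier C \<subseteq> K1" and d2_K: "d2 ` carrier C \<subseteq> K2"
begin

lemma sub1: "H \<in> insert K1 \<H>1 \<Longrightarrow> subgroup H G1" and sub2: "H' \<in> insert K2 \<H>2 \<Longrightarrow> subgroup H' G2"
  using pair1 pair2 by (auto simp: group_pair_def)

lemma sub1_carrier: "H \<in> insert K1 \<H>1 \<Longrightarrow> H \<subseteq> carrier G1"
  and sub2_carrier: "H' \<in> insert K2 \<H>2 \<Longrightarrow> H' \<subseteq> carrier G2"
  using subgroup.subset[OF sub1] subgroup.subset[OF sub2] by blast+

lemma sub1_mem: "H \<in> insert K1 \<H>1 \<Longrightarrow> h \<in> H \<Longrightarrow> h \<in> carrier G1"
  and sub2_mem: "H' \<in> insert K2 \<H>2 \<Longrightarrow> h' \<in> H' \<Longrightarrow> h' \<in> carrier G2"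
  using sub1_carrier sub2_carrier by blast+

sublocale \<iota>1: group_hom G1 P in1
  using group_P in_hom(1) by (simp add: group_hom_def group_hom_axioms_def G1.is_group)

sublocale \<iota>2: group_hom G2 P in2
  using group_P in_hom(2) by (simp add: group_hom_def group_hom_axioms_def G2.is_group)

lemma generate_factors: "generate P (in1 ` carrier G1 \<union> in2 ` carrier G2) = carrier P" (is "generate P ?X = _")
proof
  have "?X \<subseteq> carrier P" using in_closed by auto
  then show "generate P ?X \<subseteq> carrier P" using group.generate_incl[OF group_P] by blast
  show "carrier P \<subseteq> generate P ?X"
  proof
    fix x assume "x \<in> carrier P"
    then obtain w where w: "w \<in> lists letters" "x = word_class letters rules w" unfolding carrier_P by blast
    have "word_class letters rules w \<in> generate P ?X" using w(1)
    proof (induction w)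
      case Nil
      have "word_class letters rules [] = \<one>\<^bsub>P\<^esub>" by (simp add: amalg_def one_presented_monoid)
      then show ?case by (simp add: generate.one)
    next
      case (Cons a w)
      have "word_class letters rules [a] \<in> ?X"
        using Cons.hyps(1) by (cases a) (auto simp: amalg_in1_def amalg_in2_def)
      then have "word_class letters rules [a] \<in> generate P ?X" by (rule generate.incl)
      moreover have "word_class letters rules (a # w) = word_class letters rules [a] \<otimes>\<^bsub>P\<^esub> word_class letters rules w"
        using mult_class[of "[a]" w] Cons.hyps by simp
      ultimately show ?case using Cons.IH generate.eng by metis
    qed
    then show "x \<in> generate P ?X" using w by simp
  qed
qed

abbreviation factor :: "bool \<Rightarrow> ('a + 'b) list set set" where
  "factor i \<equiv> (if i then in1 ` carrier G1 else in2 ` carrier G2)"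

abbreviation edge_group :: "bool \<Rightarrow> ('a + 'b) list set set" where
  "edge_group i \<equiv> (if i then in1 ` K1 else in2 ` K2)"

abbreviation half_tree :: "bool \<Rightarrow> ('a + 'b) list set set" where
  "half_tree i \<equiv> (if i then side1.starts_in (carrier G1 - K1) else side2.starts_in (carrier G2 - K2))"

text \<open>Apart from injectivity of the two embeddings, this is all that the rest of the argument
  uses of the normal forms.\<close>

sublocale T: tree_split P factor edge_group half_tree
proof (intro tree_split.intro tree_split_axioms.intro)
  show "group P" by (rule group_P)
  fix i j
  show "subgroup (factor i) P" using \<iota>1.img_is_subgroup \<iota>2.img_is_subgroup by simp
  show "subgroup (edge_group i) P"
    using \<iota>1.subgroup_img_is_subgroup[OF sub1] \<iota>2.subgroup_img_is_subgroup[OF sub2] by simp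
  show "edge_group i \<subseteq> factor i" using sub1_carrier[of K1] sub2_carrier[of K2] by (simp add: image_mono)
  show "factor i \<inter> factor (\<not> i) \<subseteq> edge_group i"
    using side1.\<iota>1_\<iota>2_inter side2.\<iota>1_\<iota>2_inter d1_K d2_K by (cases i) fastforce+
  show "generate P (factor True \<union> factor False) = carrier P" using generate_factors by simp
  show "half_tree i \<subseteq> carrier P" by (auto simp: side1.starts_in_def side2.starts_in_def)
  have s: "s \<in> in1 ` carrier G1 \<union> in2 ` carrier G2" "s \<in> in2 ` carrier G2 \<union> in1 ` carrier G1" if "s \<in> factor j" for s
    using that by (auto split: if_splits)
  show "x \<otimes>\<^bsub>P\<^esub> s \<in> half_tree i \<union> edge_group i" if "x \<in> half_tree i" "s \<in> factor j" for x s
    using side1.starts_in_step[OF sub1 d1_K] side2.starts_in_step[OF sub2 d2_K] s[OF that(2)] that(1)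
    by (cases i) simp_all
  show "x \<otimes>\<^bsub>P\<^esub> s \<in> half_tree i \<longleftrightarrow> s \<in> factor i - edge_group i" if "x \<in> edge_group i" "s \<in> factor j" for x s
    using side1.starts_in_leave[OF sub1 d1_K] side2.starts_in_leave[OF sub2 d2_K] s[OF that(2)] that(1)
    by (cases i) simp_all
qed

lemma T_K: "T.K = generate P (in1 ` K1 \<union> in2 ` K2)"
  by (simp add: T.K_def)

definition family :: "('a + 'b) list set set set" where
  "family = (`) in1 ` \<H>1 \<union> (`) in2 ` \<H>2"

lemma conj_into_iff1: "g \<in> carrier G1 \<Longrightarrow> conj_into G1 (\<H>1 \<union> {K1}) g \<longleftrightarrow> conj_into P (family \<union> {T.K}) (in1 g)"
  unfolding family_def
  by (rule T.conj_into_factor_iff[where i = True, OF G1.is_group in_hom(1) side1.\<iota>1_inj])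
    (auto intro: imageI sub1_mem sub2_mem)

lemma conj_into_iff2: "g \<in> carrier G2 \<Longrightarrow> conj_into G2 (\<H>2 \<union> {K2}) g \<longleftrightarrow> conj_into P (family \<union> {T.K}) (in2 g)"
  unfolding family_def Un_commute[of "(`) in1 ` \<H>1"]
  by (rule T.conj_into_factor_iff[where i = False, OF G2.is_group in_hom(2) side2.\<iota>1_inj])
    (auto intro: imageI sub1_mem sub2_mem)

lemma pair: "group_pair P (family \<union> {T.K})"
  unfolding group_pair_def
proof (intro conjI ballI)
  show "finite (family \<union> {T.K})" using pair1 pair2 by (auto simp: family_def group_pair_def)
  fix H assume "H \<in> family \<union> {T.K}"
  then show "subgroup H P"
    using \<iota>1.subgroup_img_is_subgroup[OF sub1] \<iota>2.subgroup_img_is_subgroup[OF sub2] T.K_subgroup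
    by (auto simp: family_def)
qed (rule group_P)

text \<open>\<open>K1\<close> is absorbed by the larger group \<open>K\<close>, the other members
  keep their images; \<open>K1 \<notin> \<H>1\<close> makes the two cases compatible with
  \<open>family\<close>.\<close>

definition image1 :: "'a set \<Rightarrow> ('a + 'b) list set set" where
  "image1 H = (if H = K1 then T.K else in1 ` H)"

definition image2 :: "'b set \<Rightarrow> ('a + 'b) list set set" where
  "image2 H = (if H = K2 then T.K else in2 ` H)"

end

locale amalgamated_words = amalgamated_pairs G1 G2 C d1 d2 \<H>1 K1 \<H>2 K2 +
  W1: rel_words G1 S1 "\<H>1 \<union> {K1}" + W2: rel_words G2 S2 "\<H>2 \<union> {K2}"
  for G1 :: "('a, 'm) monoid_scheme" and G2 :: "('b, 'n) monoid_scheme"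
    and C :: "('c, 'k) monoid_scheme" and d1 d2 \<H>1 K1 \<H>2 K2 S1 S2
begin

abbreviation "S \<equiv> in1 ` S1 \<union> in2 ` S2"

sublocale W: rel_words P S "family \<union> {T.K}"
  using pair W1.S_carrier W2.S_carrier in_closed group_P
  by (auto simp: rel_words_def rel_words_axioms_def)

sublocale M1: rel_words_map G1 S1 "\<H>1 \<union> {K1}" P S "family \<union> {T.K}" in1 image1
proof (intro rel_words_map.intro rel_words_map_axioms.intro)
  show "in1 ` H \<subseteq> image1 H" for H using T.B_K[of True] by (auto simp: image1_def)
  show "rel_words G1 S1 (\<H>1 \<union> {K1})" by (rule W1.rel_words_axioms)
  show "rel_words P S (family \<union> {T.K})" by (rule W.rel_words_axioms)
qed (use in_hom side1.\<iota>1_inj in \<open>auto simp: image1_def family_def\<close>)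

sublocale M2: rel_words_map G2 S2 "\<H>2 \<union> {K2}" P S "family \<union> {T.K}" in2 image2
proof (intro rel_words_map.intro rel_words_map_axioms.intro)
  show "in2 ` H \<subseteq> image2 H" for H using T.B_K[of False] by (auto simp: image2_def)
  show "rel_words G2 S2 (\<H>2 \<union> {K2})" by (rule W2.rel_words_axioms)
  show "rel_words P S (family \<union> {T.K})" by (rule W.rel_words_axioms)
qed (use in_hom side2.\<iota>1_inj in \<open>auto simp: image2_def family_def\<close>)

abbreviation factor_letters :: "bool \<Rightarrow> ('a + 'b) list set letter set" where
  "factor_letters i \<equiv> (if i then M1.\<mu> ` W1.\<A> else M2.\<mu> ` W2.\<A>)"

lemma Sub_factor1: "H \<in> insert K1 \<H>1 \<Longrightarrow> h \<in> in1 ` H \<Longrightarrow> h \<noteq> \<one>\<^bsub>P\<^esub> \<Longrightarrow> Sub (image1 H) h \<in> M1.\<mu> ` W1.\<A>"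
proof -
  assume H: "H \<in> insert K1 \<H>1" "h \<in> in1 ` H" "h \<noteq> \<one>\<^bsub>P\<^esub>"
  then obtain h0 where h0: "h0 \<in> H" "h = in1 h0" by blast
  then have "Sub H h0 \<in> W1.\<A>" using H by (auto simp: rel_alphabet_iff)
  then show ?thesis using h0 by (metis image_eqI letter_map.simps(3))
qed

lemma Sub_factor2: "H \<in> insert K2 \<H>2 \<Longrightarrow> h \<in> in2 ` H \<Longrightarrow> h \<noteq> \<one>\<^bsub>P\<^esub> \<Longrightarrow> Sub (image2 H) h \<in> M2.\<mu> ` W2.\<A>"
proof -
  assume H: "H \<in> insert K2 \<H>2" "h \<in> in2 ` H" "h \<noteq> \<one>\<^bsub>P\<^esub>"
  then obtain h0 where h0: "h0 \<in> H" "h = in2 h0" by blast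
  then have "Sub H h0 \<in> W2.\<A>" using H by (auto simp: rel_alphabet_iff)
  then show ?thesis using h0 by (metis image_eqI letter_map.simps(3))
qed

text \<open>
  The sets of letters need not be disjoint: members of \<open>\<H>1\<close> and \<open>\<H>2\<close> can have the same image in the amalgam.
\<close>

lemma letters_cover: "W.\<A> \<subseteq> M1.\<mu> ` W1.\<A> \<union> M2.\<mu> ` W2.\<A> \<union> range (Sub T.K)"
proof
  fix a assume a: "a \<in> W.\<A>"
  have gen1: "Gen (in1 s) \<in> M1.\<mu> ` W1.\<A>" "GenInv (in1 s) \<in> M1.\<mu> ` W1.\<A>" if "s \<in> S1" for s
    using that by (metis image_eqI letter_map.simps(1) rel_alphabet_iff(1), metis image_eqI letter_map.simps(2) rel_alphabet_iff(2))
  have gen2: "Gen (in2 s) \<in> M2.\<mu> ` W2.\<A>" "GenInv (in2 s) \<in> M2.\<mu> ` W2.\<A>" if "s \<in> S2" for s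
    using that by (metis image_eqI letter_map.simps(1) rel_alphabet_iff(1), metis image_eqI letter_map.simps(2) rel_alphabet_iff(2))
  show "a \<in> M1.\<mu> ` W1.\<A> \<union> M2.\<mu> ` W2.\<A> \<union> range (Sub T.K)"
  proof (cases a)
    case (Gen s)
    then show ?thesis using a gen1 gen2 unfolding rel_alphabet_iff Gen by blast
  next
    case (GenInv s)
    then show ?thesis using a gen1 gen2 unfolding rel_alphabet_iff GenInv by blast
  next
    case (Sub H h)
    then have "H \<in> family \<union> {T.K}" "h \<in> H" "h \<noteq> \<one>\<^bsub>P\<^esub>" using a by (simp_all add: rel_alphabet_iff)
    then consider H0 where "H0 \<in> \<H>1" "H = in1 ` H0" | H0 where "H0 \<in> \<H>2" "H = in2 ` H0" | "H = T.K"
      unfolding family_def by blast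
    then show ?thesis
    proof cases
      case (1 H0)
      then have "image1 H0 = H" using K1_notin by (auto simp: image1_def)
      then show ?thesis using Sub_factor1[of H0 h] 1 \<open>h \<in> H\<close> \<open>h \<noteq> \<one>\<^bsub>P\<^esub>\<close> Sub by simp
    next
      case (2 H0)
      then have "image2 H0 = H" using K2_notin by (auto simp: image2_def)
      then show ?thesis using Sub_factor2[of H0 h] 2 \<open>h \<in> H\<close> \<open>h \<noteq> \<one>\<^bsub>P\<^esub>\<close> Sub by simp
    next
      case 3
      then show ?thesis using Sub by blast
    qed
  qed
qed

sublocale T: tree_words P factor edge_group half_tree S "family \<union> {T.K}" factor_letters
proof (intro tree_words.intro tree_words_axioms.intro)
  fix i a k
  show "factor_letters i \<subseteq> W.\<A>" using M1.map_letters M2.map_letters by auto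
  show "W.\<A> \<subseteq> factor_letters True \<union> factor_letters False \<union> range (Sub T.K)" using letters_cover by simp
  show "letter_val P a \<in> factor i" if "a \<in> factor_letters i"
    using that M1.letter_val_map M2.letter_val_map W1.letter_val_closed W2.letter_val_closed
    by (cases i) auto
  show "Sub T.K k \<in> factor_letters i" if "k \<in> edge_group i" "k \<noteq> \<one>\<^bsub>P\<^esub>"
    using that Sub_factor1[of K1 k] Sub_factor2[of K2 k] by (cases i) (simp_all add: image1_def image2_def)
qed (use T.tree_split_axioms W.rel_words_axioms in auto)

text \<open>The images of the relators of the factors suffice. The identification of
  \<open>d1 c\<close> with \<open>d2 c\<close> costs no relator, since both elements become the same
  letter of \<open>K\<close>.\<close>

lemma dehn_class_amalg:
  assumes S: "finite S1" "finite S2"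
    and surj: "carrier G1 \<subseteq> word_val G1 ` lists W1.\<A>" "carrier G2 \<subseteq> word_val G2 ` lists W2.\<A>"
    and R: "finite R1" "R1 \<subseteq> kernel W1.F G1 (rel_eval G1)" "finite R2" "R2 \<subseteq> kernel W2.F G2 (rel_eval G2)"
    and bd: "W1.bounded_area R1 W1.\<A>" "W2.bounded_area R2 W2.\<A>"
  shows "dehn_class P (family \<union> {T.K})"
proof (rule W.dehn_classI)
  let ?R = "\<lambda>i. if i then M1.free_map ` R1 else M2.free_map ` R2"
  have Rk: "?R i \<subseteq> kernel W.F P (rel_eval P)" for i
    using M1.free_map_kernel[OF R(2)] M2.free_map_kernel[OF R(4)] by simp
  have Rc: "?R i \<subseteq> carrier W.F" for i using Rk[of i] unfolding kernel_def by blast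
  show "finite S" using S by simp
  show "finite (?R True \<union> ?R False)" using R by simp
  show "?R True \<union> ?R False \<subseteq> kernel W.F P (rel_eval P)" using Rk[of True] Rk[of False] by blast
  show "carrier P \<subseteq> word_val P ` lists W.\<A>"
    using M1.word_val_map_surj[OF surj(1)] M2.word_val_map_surj[OF surj(2)]
    by (intro T.word_val_surj) simp
  have "R1 \<subseteq> carrier W1.F" "R2 \<subseteq> carrier W2.F" using R by (auto simp: kernel_def)
  then have "W.bounded_area (?R i) (factor_letters i)" for i
    using M1.bounded_area_map[OF _ bd(1)] M2.bounded_area_map[OF _ bd(2)] by simp
  then show "W.bounded_area (?R True \<union> ?R False) W.\<A>"
    by (rule T.bounded_area_combination[OF Rc])
qed

lemma hyp_embedded_amalg:
  assumes gen: "generate G1 (S1 \<union> \<Union>(\<H>1 \<union> {K1})) = carrier G1" "generate G2 (S2 \<union> \<Union>(\<H>2 \<union> {K2})) = carrier G2"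
    and hyp: "hyperbolic_graph (carrier G1) (cayley_adj G1 S1 (\<H>1 \<union> {K1}))"
      "hyperbolic_graph (carrier G2) (cayley_adj G2 S2 (\<H>2 \<union> {K2}))"
    and fin1: "\<forall>H\<in>\<H>1 \<union> {K1}. \<forall>h\<in>H. \<forall>n. finite {h' \<in> H. hat_dist G1 S1 (\<H>1 \<union> {K1}) H h h' \<le> enat n}"
    and fin2: "\<forall>H\<in>\<H>2 \<union> {K2}. \<forall>h\<in>H. \<forall>n. finite {h' \<in> H. hat_dist G2 S2 (\<H>2 \<union> {K2}) H h h' \<le> enat n}"
  shows "family \<union> {T.K} \<hookrightarrow>\<^sub>h P"
proof (rule T.hyp_embedded_combination)
  have c: "S \<union> \<Union>(family \<union> {T.K}) \<subseteq> carrier P"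
    using W.S_carrier pair by (auto simp: group_pair_def dest: subgroup.mem_carrier)
  have "in1 ` carrier G1 \<union> in2 ` carrier G2 \<subseteq> generate P (S \<union> \<Union>(family \<union> {T.K}))"
    using M1.generate_map[OF gen(1)] M2.generate_map[OF gen(2)] by blast
  then have "generate P (in1 ` carrier G1 \<union> in2 ` carrier G2) \<subseteq> generate P (S \<union> \<Union>(family \<union> {T.K}))"
    by (rule group.generate_subgroup_incl[OF group_P _ group.generate_is_subgroup[OF group_P c]])
  then show "generate P (S \<union> \<Union>(family \<union> {T.K})) = carrier P"
    using group.generate_incl[OF group_P c] generate_factors by blast
  show "hyperbolic_graph (factor i) (T.factor_adj i)" for i
    using M1.hyperbolic_map[OF hyp(1)] M2.hyperbolic_map[OF hyp(2)] by (cases i) (simp_all add: T.factor_adj_def)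
  have hat1: "finite {h' \<in> in1 ` H. (h, h') \<in> ((T.factor_hat True (in1 ` H) (image1 H))\<^sup>=) ^^ n}"
    if H: "H \<in> insert K1 \<H>1" and h: "h \<in> in1 ` H" for H h n
  proof -
    have H': "H \<in> \<H>1 \<union> {K1}" using H by blast
    show ?thesis
      unfolding T.factor_hat_def if_True
      by (rule M1.finite_hat_map[OF H' h]) (use fin1 H' in blast)
  qed
  have hat2: "finite {h' \<in> in2 ` H. (h, h') \<in> ((T.factor_hat False (in2 ` H) (image2 H))\<^sup>=) ^^ n}"
    if H: "H \<in> insert K2 \<H>2" and h: "h \<in> in2 ` H" for H h n
  proof -
    have H': "H \<in> \<H>2 \<union> {K2}" using H by blast
    show ?thesis
      unfolding T.factor_hat_def if_False
      by (rule M2.finite_hat_map[OF H' h]) (use fin2 H' in blast)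
  qed
  show "finite {k \<in> edge_group i. (\<one>\<^bsub>P\<^esub>, k) \<in> ((T.factor_hat i (edge_group i) T.K)\<^sup>=) ^^ n}" for i n
    using hat1[of K1 "\<one>\<^bsub>P\<^esub>" n] hat2[of K2 "\<one>\<^bsub>P\<^esub>" n] subgroup.one_closed[OF T.B, of i]
    by (cases i) (simp_all add: image1_def image2_def)
  fix H assume H: "H \<in> family \<union> {T.K}" "H \<noteq> T.K"
  then consider H0 where "H0 \<in> \<H>1" "H = in1 ` H0" | H0 where "H0 \<in> \<H>2" "H = in2 ` H0"
    unfolding family_def by blast
  then show "\<exists>i. H \<subseteq> factor i \<and> (\<forall>h\<in>H. \<forall>n. finite {h' \<in> H. (h, h') \<in> ((T.factor_hat i H H)\<^sup>=) ^^ n})"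
  proof cases
    case (1 H0)
    then have "image1 H0 = H" "H \<subseteq> in1 ` carrier G1" using K1_notin sub1_carrier by (auto simp: image1_def)
    then show ?thesis using hat1[of H0] 1 by (intro exI[of _ True]) simp
  next
    case (2 H0)
    then have "image2 H0 = H" "H \<subseteq> in2 ` carrier G2" using K2_notin sub2_carrier by (auto simp: image2_def)
    then show ?thesis using hat2[of H0] 2 by (intro exI[of _ False]) simp
  qed
qed

end

theorem theorem1p2:
  fixes G1 :: "('a, 'm) monoid_scheme" and G2 :: "('b, 'n) monoid_scheme"
    and C :: "('c, 'k) monoid_scheme"
    and \<H>1 :: "'a set set" and \<H>2 :: "'b set set"
    and K1 :: "'a set" and K2 :: "'b set"
    and d1 :: "'c \<Rightarrow> 'a" and d2 :: "'c \<Rightarrow> 'b"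
  defines "G \<equiv> amalg G1 G2 C d1 d2"
    and "\<iota>1 \<equiv> amalg_in1 G1 G2 C d1 d2"
    and "\<iota>2 \<equiv> amalg_in2 G1 G2 C d1 d2"
  defines "\<H> \<equiv> (`) \<iota>1 ` \<H>1 \<union> (`) \<iota>2 ` \<H>2"
    and "K \<equiv> generate G (\<iota>1 ` K1 \<union> \<iota>2 ` K2)"
  assumes "group_pair G1 (\<H>1 \<union> {K1})" and "K1 \<notin> \<H>1"
    and "group_pair G2 (\<H>2 \<union> {K2})" and "K2 \<notin> \<H>2"
    and "group C"
    and "d1 \<in> mon C (G1\<lparr>carrier := K1\<rparr>)"
    and "d2 \<in> mon C (G2\<lparr>carrier := K2\<rparr>)"
  shows "(\<H>1 \<union> {K1} \<hookrightarrow>\<^sub>h G1 \<and> \<H>2 \<union> {K2} \<hookrightarrow>\<^sub>h G2 \<longrightarrow> \<H> \<union> {K} \<hookrightarrow>\<^sub>h G) \<and>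
    (dehn_class G1 (\<H>1 \<union> {K1}) \<and> dehn_class G2 (\<H>2 \<union> {K2}) \<longrightarrow> dehn_class G (\<H> \<union> {K})) \<and>
    (\<forall>g\<in>carrier G1. conj_into G1 (\<H>1 \<union> {K1}) g \<longleftrightarrow> conj_into G (\<H> \<union> {K}) (\<iota>1 g)) \<and>
    (\<forall>g\<in>carrier G2. conj_into G2 (\<H>2 \<union> {K2}) g \<longleftrightarrow> conj_into G (\<H> \<union> {K}) (\<iota>2 g))"
proof -
  note pairs = \<open>group_pair G1 (\<H>1 \<union> {K1})\<close> \<open>group_pair G2 (\<H>2 \<union> {K2})\<close>
  have groups: "group G1" "group G2" using pairs by (simp_all add: group_pair_def)
  have "K1 \<subseteq> carrier G1" "K2 \<subseteq> carrier G2"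
    using pairs by (auto simp: group_pair_def dest: subgroup.subset)
  \<comment> \<open>\<open>K1\<close> and \<open>K2\<close> carry the multiplication of the ambient
    groups, so monomorphisms into them are monomorphisms into \<open>G1\<close> and
    \<open>G2\<close>.\<close>
  then have d: "d1 \<in> mon C G1" "d2 \<in> mon C G2" "d1 ` carrier C \<subseteq> K1" "d2 ` carrier C \<subseteq> K2"
    using \<open>d1 \<in> _\<close> \<open>d2 \<in> _\<close> by (auto simp: mon_def hom_def)
  interpret amalgamated_pairs G1 G2 C d1 d2 \<H>1 K1 \<H>2 K2
    using pairs groups d \<open>group C\<close> \<open>K1 \<notin> \<H>1\<close> \<open>K2 \<notin> \<H>2\<close>
    by (simp add: amalgamated_pairs_def amalgamated_pairs_axioms_def amalgam_def amalgam_axioms_def)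
  have eqs: "G = P" "\<iota>1 = in1" "\<iota>2 = in2" "\<H> = family" "K = T.K"
    by (simp_all add: G_def \<iota>1_def \<iota>2_def \<H>_def K_def family_def T_K)
  show ?thesis
    unfolding eqs
  proof (intro conjI ballI impI conj_into_iff1 conj_into_iff2)
    assume h: "\<H>1 \<union> {K1} \<hookrightarrow>\<^sub>h G1 \<and> \<H>2 \<union> {K2} \<hookrightarrow>\<^sub>h G2"
    obtain X1 where X1: "X1 \<subseteq> carrier G1" "generate G1 (X1 \<union> \<Union>(\<H>1 \<union> {K1})) = carrier G1"
      "hyperbolic_graph (carrier G1) (cayley_adj G1 X1 (\<H>1 \<union> {K1}))"
      "\<forall>H\<in>\<H>1 \<union> {K1}. \<forall>h\<in>H. \<forall>n. finite {h' \<in> H. hat_dist G1 X1 (\<H>1 \<union> {K1}) H h h' \<le> enat n}"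
      by (rule hyp_embeddedE[OF conjunct1[OF h]])
    obtain X2 where X2: "X2 \<subseteq> carrier G2" "generate G2 (X2 \<union> \<Union>(\<H>2 \<union> {K2})) = carrier G2"
      "hyperbolic_graph (carrier G2) (cayley_adj G2 X2 (\<H>2 \<union> {K2}))"
      "\<forall>H\<in>\<H>2 \<union> {K2}. \<forall>h\<in>H. \<forall>n. finite {h' \<in> H. hat_dist G2 X2 (\<H>2 \<union> {K2}) H h h' \<le> enat n}"
      by (rule hyp_embeddedE[OF conjunct2[OF h]])
    interpret amalgamated_words G1 G2 C d1 d2 \<H>1 K1 \<H>2 K2 X1 X2
      using pairs groups X1(1) X2(1) amalgamated_pairs_axioms
      by (simp add: amalgamated_words_def rel_words_def rel_words_axioms_def)
    show "family \<union> {T.K} \<hookrightarrow>\<^sub>h P"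
      by (rule hyp_embedded_amalg[OF X1(2) X2(2) X1(3) X2(3) X1(4) X2(4)])
  next
    assume h: "dehn_class G1 (\<H>1 \<union> {K1}) \<and> dehn_class G2 (\<H>2 \<union> {K2})"
    obtain S1 R1 where 1: "rel_words G1 S1 (\<H>1 \<union> {K1})" "finite S1"
      "carrier G1 \<subseteq> word_val G1 ` lists (rel_alphabet G1 S1 (\<H>1 \<union> {K1}))" "finite R1"
      "R1 \<subseteq> kernel (rel_free G1 S1 (\<H>1 \<union> {K1})) G1 (rel_eval G1)"
      "rel_words.bounded_area G1 S1 (\<H>1 \<union> {K1}) R1 (rel_alphabet G1 S1 (\<H>1 \<union> {K1}))"
      by (rule dehn_classE[OF conjunct1[OF h]])
    obtain S2 R2 where 2: "rel_words G2 S2 (\<H>2 \<union> {K2})" "finite S2"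
      "carrier G2 \<subseteq> word_val G2 ` lists (rel_alphabet G2 S2 (\<H>2 \<union> {K2}))" "finite R2"
      "R2 \<subseteq> kernel (rel_free G2 S2 (\<H>2 \<union> {K2})) G2 (rel_eval G2)"
      "rel_words.bounded_area G2 S2 (\<H>2 \<union> {K2}) R2 (rel_alphabet G2 S2 (\<H>2 \<union> {K2}))"
      by (rule dehn_classE[OF conjunct2[OF h]])
    interpret amalgamated_words G1 G2 C d1 d2 \<H>1 K1 \<H>2 K2 S1 S2
      using 1 2 amalgamated_pairs_axioms by (simp add: amalgamated_words_def)
    show "dehn_class P (family \<union> {T.K})"
      by (rule dehn_class_amalg[OF 1(2) 2(2) 1(3) 2(3) 1(4,5) 2(4,5) 1(6) 2(6)])
  qed
qed

end
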